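(* Let $n\ge 2$, $1<p<q<\infty$ and $\varkappa>0$. For a bounded open set $\Omega\subset\mathbb{R}^n$ and a weight $a:\Omega\to[0,\infty)$ let $\mathcal{F}[u]=\int_\Omega |\nabla u(x)|^p+a(x)|\nabla u(x)|^q\,dx$ and $W(\Omega)=\{\varphi\in W^{1,1}_0(\Omega): \int_\Omega |\nabla\varphi|^p+a(x)|\nabla\varphi|^q\,dx<\infty\}$. Then the following hold. (i) If $q\le p+\varkappa$, $\Omega\subset\mathbb{R}^n$ is a bounded Lipschitz domain, $a\in\mathcal{Z}^\varkappa(\Omega)$, and $u_0\in W^{1,1}(\Omega)$ satisfies $\mathcal{F}[u_0]<\infty$, then $$\inf_{v\in u_0+W(\Omega)}\mathcal{F}[v]=\inf_{w\in u_0+C_c^\infty(\Omega)}\mathcal{F}[w].$$ (ii) If $p<n<n+\varkappa<q$, then there exist a bounded Lipschitz domain $\Omega\subset\mathbb{R}^n$, a weight $a\in\mathcal{Z}^\varkappa(\Omega)$ and $u_0\in W^{1,1}(\Omega)$ satisfying $\mathcal{F}[u_0]<\infty$ such that $$\inf_{v\in u_0+W(\Omega)}\mathcal{F}[v]<\inf_{w\in u_0+C_c^\infty(\Omega)}\mathcal{F}[w].$$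
   Context: For $\varkappa\in(0,\infty)$, the class $\mathcal{Z}^\varkappa(\Omega)$ consists of all (Lebesgue measurable) functions $a:\Omega\to[0,\infty)$ for which there is a constant $C>0$ such that $a(x)\le C\,(a(y)+|x-y|^\varkappa)$ for all $x,y\in\Omega$. All functions $u$ are real-valued. *)

theory Defs
  imports "HOL-Analysis.Analysis"
begin

definition partial_deriv :: "'n::finite \<Rightarrow> (real^'n \<Rightarrow> real) \<Rightarrow> real^'n \<Rightarrow> real" where
  "partial_deriv i f x = frechet_derivative f (at x) (axis i 1)"

primrec times_cont_diff :: "nat \<Rightarrow> (real^'n::finite \<Rightarrow> real) \<Rightarrow> bool" where
  "times_cont_diff 0 f \<longleftrightarrow> continuous_on UNIV f"
| "times_cont_diff (Suc k) f \<longleftrightarrow>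
     (\<forall>x. f differentiable (at x)) \<and> (\<forall>i. times_cont_diff k (partial_deriv i f))"

text \<open>Test functions are extended by zero to the whole space.\<close>

definition test_functions :: "(real^'n::finite) set \<Rightarrow> (real^'n \<Rightarrow> real) set" where
  "test_functions \<Omega> =
     {\<phi>. (\<forall>k. times_cont_diff k \<phi>) \<and>
         compact (closure {x. \<phi> x \<noteq> 0}) \<and> closure {x. \<phi> x \<noteq> 0} \<subseteq> \<Omega>}"

definition locally_integrable ::
    "(real^'n::finite) set \<Rightarrow> (real^'n \<Rightarrow> 'b::{banach, second_countable_topology}) \<Rightarrow> bool" where
  "locally_integrable \<Omega> f \<longleftrightarrow> (\<forall>K. compact K \<and> K \<subseteq> \<Omega> \<longrightarrow> integrable (lebesgue_on K) f)"

text \<open>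
  Functions on \<open>\<Omega>\<close> are represented by total functions; only their values on \<open>\<Omega>\<close>,
  up to null sets, matter below. Local integrability of \<open>g\<close> has to be demanded, because the
  Bochner integral of a non-integrable function is 0.
\<close>

definition has_weak_gradient ::
    "(real^'n::finite) set \<Rightarrow> (real^'n \<Rightarrow> real) \<Rightarrow> (real^'n \<Rightarrow> real^'n) \<Rightarrow> bool" where
  "has_weak_gradient \<Omega> u g \<longleftrightarrow>
     locally_integrable \<Omega> u \<and> locally_integrable \<Omega> g \<and>
     (\<forall>\<phi>\<in>test_functions \<Omega>. \<forall>i.
        (LINT x|lebesgue_on \<Omega>. u x * partial_deriv i \<phi> x) =
        - (LINT x|lebesgue_on \<Omega>. g x $ i * \<phi> x))"

text \<open>
  On an open \<open>\<Omega>\<close> the weak gradient is unique up to null sets, so the integrals in which it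
  occurs below do not depend on the choice. It is only used for functions possessing one.
\<close>

definition weak_gradient ::
    "(real^'n::finite) set \<Rightarrow> (real^'n \<Rightarrow> real) \<Rightarrow> real^'n \<Rightarrow> real^'n" where
  "weak_gradient \<Omega> u = (SOME g. has_weak_gradient \<Omega> u g)"

definition sobolev_W11 :: "(real^'n::finite) set \<Rightarrow> (real^'n \<Rightarrow> real) set" where
  "sobolev_W11 \<Omega> =
     {u. integrable (lebesgue_on \<Omega>) u \<and>
         (\<exists>g. has_weak_gradient \<Omega> u g \<and> integrable (lebesgue_on \<Omega>) g)}"

definition W11_norm :: "(real^'n::finite) set \<Rightarrow> (real^'n \<Rightarrow> real) \<Rightarrow> real" where
  "W11_norm \<Omega> u =
     (LINT x|lebesgue_on \<Omega>. \<bar>u x\<bar>) + (LINT x|lebesgue_on \<Omega>. norm (weak_gradient \<Omega> u x))"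

text \<open>The closure of the test functions in \<open>W\<^sup>1\<^sup>,\<^sup>1(\<Omega>)\<close>.\<close>

definition sobolev_W11_0 :: "(real^'n::finite) set \<Rightarrow> (real^'n \<Rightarrow> real) set" where
  "sobolev_W11_0 \<Omega> =
     {u \<in> sobolev_W11 \<Omega>.
        \<forall>\<epsilon>>0. \<exists>\<psi>\<in>test_functions \<Omega>. W11_norm \<Omega> (\<lambda>x. u x - \<psi> x) < \<epsilon>}"

text \<open>
  Near each boundary point, \<open>\<Omega>\<close> is the strict epigraph of a Lipschitz function in suitable
  orthonormal coordinates: \<open>e\<close> is the vertical direction, and \<open>\<gamma>\<close> is evaluated at the orthogonal
  projection of \<open>x\<close> to the hyperplane perpendicular to \<open>e\<close>.
\<close>

definition bounded_lipschitz_domain :: "(real^'n::finite) set \<Rightarrow> bool" where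
  "bounded_lipschitz_domain \<Omega> \<longleftrightarrow>
     \<Omega> \<noteq> {} \<and> open \<Omega> \<and> connected \<Omega> \<and> bounded \<Omega> \<and>
     (\<forall>z\<in>frontier \<Omega>. \<exists>r>0. \<exists>e. \<exists>L. \<exists>\<gamma> :: real^'n \<Rightarrow> real.
        norm e = 1 \<and> L-lipschitz_on {y. y \<bullet> e = 0} \<gamma> \<and>
        \<Omega> \<inter> ball z r = {x \<in> ball z r. \<gamma> (x - (x \<bullet> e) *\<^sub>R e) < x \<bullet> e})"

definition weight_class :: "real \<Rightarrow> (real^'n::finite) set \<Rightarrow> (real^'n \<Rightarrow> real) set" where
  "weight_class \<kappa> \<Omega> =
     {a. a \<in> borel_measurable (lebesgue_on \<Omega>) \<and> (\<forall>x\<in>\<Omega>. 0 \<le> a x) \<and>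
         (\<exists>C>0. \<forall>x\<in>\<Omega>. \<forall>y\<in>\<Omega>. a x \<le> C * (a y + norm (x - y) powr \<kappa>))}"

definition double_phase ::
    "real \<Rightarrow> real \<Rightarrow> (real^'n::finite \<Rightarrow> real) \<Rightarrow> (real^'n) set \<Rightarrow> (real^'n \<Rightarrow> real) \<Rightarrow> ennreal" where
  "double_phase p q a \<Omega> u =
     (\<integral>\<^sup>+ x. ennreal (norm (weak_gradient \<Omega> u x) powr p + a x * norm (weak_gradient \<Omega> u x) powr q)
        \<partial>lebesgue_on \<Omega>)"

definition energy_space ::
    "real \<Rightarrow> real \<Rightarrow> (real^'n::finite \<Rightarrow> real) \<Rightarrow> (real^'n) set \<Rightarrow> (real^'n \<Rightarrow> real) set" where
  "energy_space p q a \<Omega> = {\<phi> \<in> sobolev_W11_0 \<Omega>. double_phase p q a \<Omega> \<phi> < \<infinity>}"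

definition translate ::
    "(real^'n::finite \<Rightarrow> real) \<Rightarrow> (real^'n \<Rightarrow> real) set \<Rightarrow> (real^'n \<Rightarrow> real) set" where
  "translate u S = (\<lambda>\<phi> x. u x + \<phi> x) ` S"

end

theory Submission
  imports Defs "HOL-Computational_Algebra.Polynomial"
begin

text \<open>
  Absence of the gap. An element of \<open>W(\<Omega>)\<close> is, together with its gradient, an \<open>L\<^sup>1\<close> limit of
  \<open>C\<^sup>1\<close> functions with compact support in \<open>\<Omega>\<close>. Hence so is \<open>k arctan (\<phi>/k)\<close>, which is bounded and
  whose gradient tends to that of \<open>\<phi>\<close> in energy, so bounded \<open>\<phi>\<close> suffice. A partition of unity cuts
  \<open>\<phi>\<close> into pieces that can be convolved with mollifiers of radius \<open>\<delta>\<close> whose centres are shifted into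
  \<open>\<Omega>\<close> by a multiple of \<open>\<delta>\<close>. Where \<open>a \<lesssim> \<delta>\<^sup>\<kappa>\<close>, the gradient \<open>g\<^sub>\<delta>\<close> of the convolution satisfies
  \<open>a |g\<^sub>\<delta>|\<^sup>q \<lesssim> \<delta>\<^sup>\<kappa> (\<parallel>\<phi>\<parallel>\<^sub>\<infinity>/\<delta>)\<^bsup>q-p\<^esup> |g\<^sub>\<delta>|\<^sup>p \<lesssim> |g\<^sub>\<delta>|\<^sup>p\<close>, because \<open>q \<le> p + \<kappa>\<close>; elsewhere \<open>a(x) \<lesssim> a(y)\<close> for
  \<open>|x - y| \<lesssim> \<delta>\<close>, and Jensen's inequality applies. In both cases the energy density of the
  approximation is dominated by the convolution of an integrable function, which converges in \<open>L\<^sup>1\<close>.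

  Presence of the gap. On the unit ball let \<open>v\<close> be a function of \<open>x \<bullet> e / |x|\<close> that equals \<open>1\<close> and
  \<open>-1\<close> on two opposite cones. Then \<open>|\<nabla>v| \<lesssim> 1/|x|\<close>, so \<open>v\<close> has finite \<open>p\<close>-energy since \<open>p < n\<close>, and the
  weight \<open>\<Lambda> (|x \<bullet> e| - |x|/2)\<^sub>+\<^sup>\<kappa>\<close> does not see \<open>\<nabla>v\<close>. A competitor that is continuous at the origin
  changes by at least \<open>1\<close> along every ray of one of the cones, which costs energy at least \<open>c \<Lambda>\<close>
  with \<open>c > 0\<close> independent of \<open>\<Lambda>\<close>, since \<open>q > n + \<kappa>\<close>.
\<close>

section \<open>Smooth functions and mollifiers\<close>

text \<open>Energies are bounded from above only, so no lower semicontinuity enters: it suffices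
  that test functions have gradients converging almost everywhere and energy densities below an
  L^1-convergent sequence. Every domination constant must therefore be independent of the radius of
  mollification, which is what truncation and the coupling of shift and radius secure. For the gap,
  the datum is not v but a C^1 function that agrees with v for |x| \<ge> 1/2: every datum plus test
  function is then C^1 at the origin, while v still differs from the datum by an element of W. Two
  opposite cones are needed because the value of a competitor at the origin is unknown; at least one
  of the boundary values 1 and -1 is at distance 1 or more from it. The energy of v does not depend
  on \<Lambda>, whereas the lower bound for the competitors is linear in \<Lambda>, so a large
  \<Lambda> separates the two infima.\<close>

declare times_cont_diff.simps(2) [simp del]

section \<open>Gradients and iterated differentiability\<close>

lemma partial_deriv_eq:
  assumes "(f has_derivative (\<lambda>h. h \<bullet> G)) (at x)"
  shows "partial_deriv i f x = G $ i"
proof -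
  have "frechet_derivative f (at x) = (\<lambda>h. h \<bullet> G)"
    using frechet_derivative_at[OF assms] by simp
  then show ?thesis
    by (simp add: partial_deriv_def inner_axis')
qed

definition grad :: "(real^'n::finite \<Rightarrow> real) \<Rightarrow> real^'n \<Rightarrow> real^'n" where
  "grad f x = (\<chi> i. partial_deriv i f x)"

lemma grad_eq:
  assumes "(f has_derivative (\<lambda>h. h \<bullet> G)) (at x)"
  shows "grad f x = G"
  by (simp add: grad_def vec_eq_iff partial_deriv_eq[OF assms])

lemma has_derivative_grad:
  fixes f :: "real^'n::finite \<Rightarrow> real"
  assumes "f differentiable (at x)"
  shows "(f has_derivative (\<lambda>h. h \<bullet> grad f x)) (at x)"
proof -
  let ?D = "frechet_derivative f (at x)"
  have D: "(f has_derivative ?D) (at x)"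
    using assms frechet_derivative_works by blast
  then interpret bounded_linear ?D by (rule has_derivative_bounded_linear)
  have "?D h = h \<bullet> grad f x" for h
  proof -
    have "?D h = ?D (\<Sum>i\<in>UNIV. (h $ i) *\<^sub>R axis i 1)"
      using basis_expansion[of h] by (simp add: scalar_mult_eq_scaleR)
    also have "\<dots> = (\<Sum>i\<in>UNIV. (h $ i) *\<^sub>R ?D (axis i 1))"
      by (simp add: sum scaleR)
    finally show ?thesis
      by (simp add: inner_vec_def grad_def partial_deriv_def)
  qed
  then have "?D = (\<lambda>h. h \<bullet> grad f x)" by auto
  with D show ?thesis by simp
qed

text \<open>The gradient is an explicit argument, so that product, chain and affine rules compose by
  resolution and deliver the gradient as a term. \<open>grad_C1\<close> identifies it with
  \<open>grad f\<close>.\<close>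

definition C1_grad :: "(real^'n::finite \<Rightarrow> real) \<Rightarrow> (real^'n \<Rightarrow> real^'n) \<Rightarrow> bool" where
  "C1_grad f G \<longleftrightarrow> (\<forall>x. (f has_derivative (\<lambda>h. h \<bullet> G x)) (at x)) \<and> continuous_on UNIV G"

lemma C1_grad_continuous: "C1_grad f G \<Longrightarrow> continuous_on S f"
  unfolding C1_grad_def
  by (meson continuous_at_imp_continuous_on has_derivative_continuous)

lemma C1_grad_partial: "C1_grad f G \<Longrightarrow> partial_deriv i f x = G x $ i"
  unfolding C1_grad_def by (auto intro: partial_deriv_eq)

lemma times_cont_diff_SucI:
  assumes "\<And>x. (f has_derivative (\<lambda>h. h \<bullet> G x)) (at x)"
    and "\<And>i. times_cont_diff k (\<lambda>x. G x $ i)"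
  shows "times_cont_diff (Suc k) f"
proof -
  have "partial_deriv i f = (\<lambda>x. G x $ i)" for i
    using partial_deriv_eq[OF assms(1)] by auto
  then show ?thesis
    using assms by (auto simp: differentiable_def times_cont_diff.simps(2))
qed

lemma times_cont_diff_Suc_derivative:
  "times_cont_diff (Suc k) f \<Longrightarrow> (f has_derivative (\<lambda>h. h \<bullet> grad f x)) (at x)"
  by (simp add: has_derivative_grad times_cont_diff.simps(2))

lemma times_cont_diff_Suc_partial:
  "times_cont_diff (Suc k) f \<Longrightarrow> times_cont_diff k (\<lambda>x. grad f x $ i)"
  by (simp add: grad_def eta_contract_eq times_cont_diff.simps(2))

lemma times_cont_diff_continuous: "times_cont_diff k f \<Longrightarrow> continuous_on UNIV f"
  by (cases k) (auto intro: continuous_at_imp_continuous_on differentiable_imp_continuous_within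
      simp: times_cont_diff.simps(2))

text \<open>The recursion constrains only the partial derivatives, so lowering the order takes an
  induction of its own. The product rule needs it for the factor that is not differentiated.\<close>

lemma times_cont_diff_Suc_lower: "times_cont_diff (Suc k) f \<Longrightarrow> times_cont_diff k f"
proof (induction k arbitrary: f)
  case 0
  then show ?case using times_cont_diff_continuous[OF 0] by simp
next
  case (Suc k)
  have d: "f differentiable (at x)" for x
    using Suc.prems by (simp only: times_cont_diff.simps(2))
  have p: "times_cont_diff k (partial_deriv i f)" for i
    using Suc.prems by (intro Suc.IH) (simp only: times_cont_diff.simps(2)[of "Suc k" f])
  show ?case
    unfolding times_cont_diff.simps(2) using d p by blast
qed

lemma times_cont_diff_C1_grad:
  assumes "times_cont_diff (Suc k) f"
  shows "C1_grad f (grad f)"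
proof -
  have "continuous_on UNIV (\<lambda>x. \<chi> i. grad f x $ i)"
    by (rule continuous_on_vec_lambda)
      (rule times_cont_diff_continuous[OF times_cont_diff_Suc_partial[OF assms]])
  then show ?thesis
    unfolding C1_grad_def using times_cont_diff_Suc_derivative[OF assms] by (simp add: vec_lambda_eta)
qed

lemma times_cont_diff_const: "times_cont_diff k (\<lambda>x. c)"
proof (induction k arbitrary: c)
  case (Suc k)
  show ?case
    by (rule times_cont_diff_SucI[where G = "\<lambda>x. 0"]) (use Suc in auto)
qed auto

lemma times_cont_diff_add:
  "times_cont_diff k f \<Longrightarrow> times_cont_diff k g \<Longrightarrow> times_cont_diff k (\<lambda>x. f x + g x)"
proof (induction k arbitrary: f g)
  case (Suc k)
  show ?case
  proof (rule times_cont_diff_SucI[where G = "\<lambda>x. grad f x + grad g x"])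
    show "((\<lambda>x. f x + g x) has_derivative (\<lambda>h. h \<bullet> (grad f x + grad g x))) (at x)" for x
      unfolding inner_add_right
      by (intro has_derivative_add times_cont_diff_Suc_derivative[OF Suc.prems(1)]
          times_cont_diff_Suc_derivative[OF Suc.prems(2)])
    show "times_cont_diff k (\<lambda>x. (grad f x + grad g x) $ i)" for i
      using Suc.IH[OF times_cont_diff_Suc_partial[OF Suc.prems(1)]
          times_cont_diff_Suc_partial[OF Suc.prems(2)]] by simp
  qed
qed (auto intro: continuous_intros)

lemma times_cont_diff_mult:
  "times_cont_diff k f \<Longrightarrow> times_cont_diff k g \<Longrightarrow> times_cont_diff k (\<lambda>x. f x * g x)"
proof (induction k arbitrary: f g)
  case (Suc k)
  show ?case
  proof (rule times_cont_diff_SucI[where G = "\<lambda>x. f x *\<^sub>R grad g x + g x *\<^sub>R grad f x"])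
    show "((\<lambda>x. f x * g x) has_derivative (\<lambda>h. h \<bullet> (f x *\<^sub>R grad g x + g x *\<^sub>R grad f x))) (at x)" for x
      by (rule has_derivative_eq_rhs[OF has_derivative_mult[OF
              times_cont_diff_Suc_derivative[OF Suc.prems(1)] times_cont_diff_Suc_derivative[OF Suc.prems(2)]]])
        (auto simp: inner_add_right algebra_simps)
    show "times_cont_diff k (\<lambda>x. (f x *\<^sub>R grad g x + g x *\<^sub>R grad f x) $ i)" for i
      using times_cont_diff_add[OF Suc.IH[OF times_cont_diff_Suc_lower[OF Suc.prems(1)]
            times_cont_diff_Suc_partial[OF Suc.prems(2)]]
          Suc.IH[OF times_cont_diff_Suc_lower[OF Suc.prems(2)]
            times_cont_diff_Suc_partial[OF Suc.prems(1)]]] by simp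
  qed
qed (auto intro: continuous_intros)

lemma times_cont_diff_component: "times_cont_diff k (\<lambda>x::real^'n::finite. x $ i)"
proof (cases k)
  case (Suc m)
  show ?thesis unfolding Suc
  proof (rule times_cont_diff_SucI[where G = "\<lambda>x. axis i 1"])
    show "((\<lambda>x. x $ i) has_derivative (\<lambda>h. h \<bullet> axis i 1)) (at x)" for x :: "real^'n"
      by (simp add: inner_axis bounded_linear.has_derivative[OF bounded_linear_vec_nth])
  qed (rule times_cont_diff_const)
qed (auto intro: continuous_intros)

lemma has_derivative_affine_comp:
  assumes "(f has_derivative (\<lambda>h. h \<bullet> G)) (at (c *\<^sub>R x + v))"
  shows "((\<lambda>x. f (c *\<^sub>R x + v)) has_derivative (\<lambda>h. h \<bullet> (c *\<^sub>R G))) (at x)"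
proof -
  have "((\<lambda>x. c *\<^sub>R x + v) has_derivative (\<lambda>h. c *\<^sub>R h)) (at x)"
    by (auto intro!: derivative_eq_intros)
  from has_derivative_compose[OF this assms] show ?thesis by (simp add: mult.commute)
qed

lemma times_cont_diff_affine:
  "times_cont_diff k f \<Longrightarrow> times_cont_diff k (\<lambda>x. f (c *\<^sub>R x + v))"
proof (induction k arbitrary: f)
  case (Suc k)
  show ?case
  proof (rule times_cont_diff_SucI[where G = "\<lambda>x. c *\<^sub>R grad f (c *\<^sub>R x + v)"])
    show "((\<lambda>x. f (c *\<^sub>R x + v)) has_derivative (\<lambda>h. h \<bullet> (c *\<^sub>R grad f (c *\<^sub>R x + v)))) (at x)" for x
      by (rule has_derivative_affine_comp) (rule times_cont_diff_Suc_derivative[OF Suc.prems])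
    show "times_cont_diff k (\<lambda>x. (c *\<^sub>R grad f (c *\<^sub>R x + v)) $ i)" for i
      using times_cont_diff_mult[OF times_cont_diff_const Suc.IH[OF times_cont_diff_Suc_partial[OF Suc.prems]]]
      by simp
  qed
next
  case 0
  then have "continuous_on UNIV f" by simp
  then show ?case
    by (auto intro!: continuous_on_compose2[of UNIV f] continuous_intros)
qed

section \<open>A smooth function that is flat at the origin\<close>

definition flat :: "real poly \<Rightarrow> real \<Rightarrow> real" where
  "flat P t = (if t \<le> 0 then 0 else poly P (1 / t) * exp (- (1 / t)))"

lemma poly_exp_tendsto_0: "((\<lambda>s::real. poly P s * exp (- s)) \<longlongrightarrow> 0) at_top"
proof -
  have "((\<lambda>s::real. \<Sum>i\<le>degree P. coeff P i * (s ^ i / exp s)) \<longlongrightarrow> (\<Sum>i\<le>degree P. coeff P i * 0)) at_top"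
    by (intro tendsto_sum tendsto_mult tendsto_const tendsto_power_div_exp_0)
  then show ?thesis
    by (simp add: poly_altdef exp_minus sum_distrib_right divide_inverse mult.assoc)
qed

lemma flat_tendsto_0: "(flat P \<longlongrightarrow> 0) (at 0)"
proof -
  have "((\<lambda>t. poly P (inverse t) * exp (- inverse t)) \<longlongrightarrow> 0) (at_right 0)"
    by (rule filterlim_compose[OF poly_exp_tendsto_0 filterlim_inverse_at_top_right])
  moreover have "eventually (\<lambda>t. poly P (inverse t) * exp (- inverse t) = flat P t) (at_right (0::real))"
    by (rule eventually_at_rightI[of 0 1]) (auto simp: flat_def inverse_eq_divide)
  ultimately have right: "(flat P \<longlongrightarrow> 0) (at_right 0)"
    using Lim_transform_eventually by blast
  have "eventually (\<lambda>t. 0 = flat P t) (at_left (0::real))"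
    by (rule eventually_at_leftI[of "-1"]) (auto simp: flat_def)
  then have left: "(flat P \<longlongrightarrow> 0) (at_left 0)"
    by (rule Lim_transform_eventually[OF tendsto_const])
  from left right show ?thesis using filterlim_split_at by blast
qed

text \<open>With s = 1/t, d/dt is -s^2 d/ds, and d/ds turns P(s) e^(-s) into (P' - P)(s) e^(-s). The
  family is thus closed under differentiation, and smoothness becomes an induction over the order
  with P arbitrary.\<close>

lemma flat_has_derivative:
  "(flat P has_real_derivative flat ([:0, 0, 1:] * (P - pderiv P)) t) (at t)"
proof -
  let ?Q = "[:0, 0, 1:] * (P - pderiv P)"
  consider "t < 0" | "t = 0" | "t > 0" by linarith
  then show ?thesis
  proof cases
    case 1
    have "((\<lambda>_. 0) has_real_derivative 0) (at t)" by simp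
    then have "(flat P has_real_derivative 0) (at t)"
      by (rule DERIV_cong_ev[THEN iffD1, rotated -1])
        (use 1 eventually_nhds_in_open[of "{..<0}" t] in \<open>auto elim!: eventually_mono simp: flat_def\<close>)
    with 1 show ?thesis by (simp add: flat_def)
  next
    case 2
    \<comment> \<open>At 0 the difference quotient is again a member of the family, with P
      multiplied by the variable.\<close>
    have "((\<lambda>y. flat P y / y) \<longlongrightarrow> 0) (at 0)"
      by (rule Lim_transform_eventually[OF flat_tendsto_0[of "[:0, 1:] * P"]])
        (auto simp: flat_def eventually_at_filter)
    then show ?thesis
      using 2 by (simp add: has_field_derivative_iff flat_def)
  next
    case 3
    have "((\<lambda>t. poly P (1 / t) * exp (- (1 / t))) has_real_derivative
        poly (pderiv P) (1 / t) * (- (1 / t^2)) * exp (- (1 / t)) + poly P (1 / t) * (exp (- (1 / t)) * (1 / t^2))) (at t)"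
      using 3 by (auto intro!: derivative_eq_intros DERIV_chain'[OF _ poly_DERIV]
          simp: power2_eq_square)
    then have "(flat P has_real_derivative
        poly (pderiv P) (1 / t) * (- (1 / t^2)) * exp (- (1 / t)) + poly P (1 / t) * (exp (- (1 / t)) * (1 / t^2))) (at t)"
      by (rule DERIV_cong_ev[THEN iffD1, rotated -1])
        (use 3 eventually_nhds_in_open[of "{0<..}" t] in \<open>auto elim!: eventually_mono simp: flat_def\<close>)
    with 3 show ?thesis
      by (simp add: flat_def field_simps power2_eq_square)
  qed
qed

lemma times_cont_diff_flat_ball: "times_cont_diff k (\<lambda>x. flat P (1 - x \<bullet> x))"
proof (induction k arbitrary: P)
  case 0
  have "isCont (flat P) t" for t using flat_has_derivative DERIV_isCont by blast
  then have "continuous_on UNIV (flat P)" by (simp add: continuous_at_imp_continuous_on)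
  then show ?case
    by (auto intro!: continuous_on_compose2[of UNIV "flat P"] continuous_intros)
next
  case (Suc k)
  let ?Q = "[:0, 0, 1:] * (P - pderiv P)"
  show ?case
  proof (rule times_cont_diff_SucI[where G = "\<lambda>x. (flat ?Q (1 - x \<bullet> x) * (- 2)) *\<^sub>R x"])
    fix x :: "real^'a"
    have "((\<lambda>x. 1 - x \<bullet> x) has_derivative (\<lambda>h. - 2 * (h \<bullet> x))) (at x)"
      by (auto intro!: derivative_eq_intros simp: inner_commute)
    from has_derivative_compose[OF this flat_has_derivative[unfolded has_field_derivative_def]]
    show "((\<lambda>x. flat P (1 - x \<bullet> x)) has_derivative
        (\<lambda>h. h \<bullet> ((flat ?Q (1 - x \<bullet> x) * (- 2)) *\<^sub>R x))) (at x)"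
      by (rule has_derivative_eq_rhs) (auto simp: algebra_simps)
  next
    fix i :: 'a
    have "times_cont_diff k (\<lambda>x. (flat ?Q (1 - x \<bullet> x) * (- 2)) * x $ i)"
      by (intro times_cont_diff_mult Suc times_cont_diff_const times_cont_diff_component)
    then show "times_cont_diff k (\<lambda>x. ((flat ?Q (1 - x \<bullet> x) * (- 2)) *\<^sub>R x) $ i)" by simp
  qed
qed

lemma flat_1_pos: "t > 0 \<Longrightarrow> flat 1 t > 0" and flat_1_nonneg: "flat 1 t \<ge> 0"
  by (auto simp: flat_def)

subsection \<open>Continuous functions with bounded support\<close>

text \<open>Scalar kernels and their vector-valued gradients share this predicate. It yields
  boundedness, integrability and uniform continuity, which is what convolution asks of a
  kernel.\<close>

definition cont_bdd_supp :: "(real^'n::finite \<Rightarrow> 'b::real_normed_vector) \<Rightarrow> bool" where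
  "cont_bdd_supp K \<longleftrightarrow> continuous_on UNIV K \<and> (\<exists>R. \<forall>x. norm x > R \<longrightarrow> K x = 0)"

lemma cont_bdd_suppE:
  assumes "cont_bdd_supp K"
  obtains R where "R > 0" "continuous_on UNIV K" "\<And>x. norm x > R \<Longrightarrow> K x = 0"
proof -
  obtain R where "continuous_on UNIV K" "\<And>x. norm x > R \<Longrightarrow> K x = 0"
    using assms unfolding cont_bdd_supp_def by auto
  then show ?thesis
    by (intro that[of "max 1 R"]) auto
qed

lemma cont_bdd_supp_bounded:
  assumes "cont_bdd_supp K"
  obtains M where "M > 0" "\<And>x. norm (K x) \<le> M"
proof -
  obtain R where R: "continuous_on UNIV K" "\<And>x. norm x > R \<Longrightarrow> K x = 0"
    using cont_bdd_suppE[OF assms] by metis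
  have "compact (K ` cball 0 R)"
    by (rule compact_continuous_image[OF continuous_on_subset[OF R(1)]]) auto
  then obtain M where M: "\<And>y. y \<in> K ` cball 0 R \<Longrightarrow> norm y \<le> M"
    using compact_imp_bounded bounded_iff by metis
  show ?thesis
  proof (rule that[of "max 1 M"])
    fix x
    show "norm (K x) \<le> max 1 M"
      using M[of "K x"] R(2)[of x] by (cases "norm x > R") (auto simp: le_max_iff_disj)
  qed auto
qed

lemma cont_bdd_supp_measurable: "cont_bdd_supp K \<Longrightarrow> K \<in> borel_measurable borel"
  by (auto elim: cont_bdd_suppE intro: borel_measurable_continuous_onI)

lemma cont_bdd_supp_integrable:
  fixes K :: "real^'n::finite \<Rightarrow> 'b::euclidean_space"
  assumes "cont_bdd_supp K"
  shows "integrable lborel K"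
proof -
  obtain R where R: "continuous_on UNIV K" "\<And>x. norm x > R \<Longrightarrow> K x = 0"
    using cont_bdd_suppE[OF assms] by metis
  have "integrable lborel (\<lambda>x. indicator (cball 0 R) x *\<^sub>R K x)"
    by (rule borel_integrable_compact) (auto intro: continuous_on_subset[OF R(1)])
  also have "(\<lambda>x. indicator (cball 0 R) x *\<^sub>R K x) = K"
    using R(2) by (fastforce simp: indicator_def)
  finally show ?thesis .
qed

lemma cont_bdd_supp_uniform:
  assumes "cont_bdd_supp K" "e > 0"
  obtains d where "d > 0" "\<And>x y. dist x y < d \<Longrightarrow> dist (K x) (K y) < e"
proof -
  obtain R where R: "R > 0" "continuous_on UNIV K" "\<And>x. norm x > R \<Longrightarrow> K x = 0"
    using cont_bdd_suppE[OF assms(1)] by metis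
  have "uniformly_continuous_on (cball 0 (R + 1)) K"
    by (rule compact_uniformly_continuous) (auto intro: continuous_on_subset[OF R(2)])
  then obtain d where d: "d > 0" 
    "\<And>x y. x \<in> cball 0 (R+1) \<Longrightarrow> y \<in> cball 0 (R+1) \<Longrightarrow> dist y x < d \<Longrightarrow> dist (K y) (K x) < e"
    using assms(2) unfolding uniformly_continuous_on_def by metis
  show ?thesis
  \<comment> \<open>Points at distance below 1 either both lie outside the ball of radius R, where K
    vanishes, or both lie in the ball of radius R + 1, where compactness applies.\<close>
  proof (rule that[of "min d 1"])
    fix x y :: "real^'a" assume xy: "dist x y < min d 1"
    have n: "norm x \<le> norm y + 1" "norm y \<le> norm x + 1"
      using xy norm_triangle_ineq2[of x y] norm_triangle_ineq2[of y x]
      by (auto simp: dist_norm norm_minus_commute)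
    show "dist (K x) (K y) < e"
    proof (cases "norm x > R \<and> norm y > R")
      case True
      then show ?thesis using R(3) assms(2) by simp
    next
      case False
      then show ?thesis using n xy by (intro d(2)) auto
    qed
  qed (use d in auto)
qed

lemma grad_zero_outside:
  assumes "(f has_derivative (\<lambda>h. h \<bullet> G)) (at x)" "closed K" "x \<notin> K" "\<And>y. y \<notin> K \<Longrightarrow> f y = 0"
  shows "G = 0"
proof -
  have "((\<lambda>y. 0) has_derivative (\<lambda>h. 0)) (at x)" by simp
  then have "(f has_derivative (\<lambda>h. 0)) (at x)"
    by (rule has_derivative_transform_within_open[of _ _ _ _ "- K"]) (use assms in auto)
  then have "(\<lambda>h. h \<bullet> G) = (\<lambda>h. 0)"
    using assms(1) has_derivative_unique by blast
  then have "G \<bullet> G = 0" by metis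
  then show ?thesis by simp
qed

lemma cont_bdd_supp_compactI:
  assumes "continuous_on UNIV f" "compact K" "\<And>x. x \<notin> K \<Longrightarrow> f x = 0"
  shows "cont_bdd_supp f"
proof -
  obtain R where "\<And>x. x \<in> K \<Longrightarrow> norm x \<le> R"
    using compact_imp_bounded[OF assms(2)] bounded_iff by metis
  then show ?thesis
    unfolding cont_bdd_supp_def using assms by (metis linorder_not_le)
qed

lemma C1_grad_cont_bdd_supp:
  assumes "C1_grad f G" "compact K" "\<And>x. x \<notin> K \<Longrightarrow> f x = 0"
  shows "cont_bdd_supp f" "cont_bdd_supp G" "\<And>x. x \<notin> K \<Longrightarrow> G x = 0"
proof -
  show *: "G x = 0" if "x \<notin> K" for x
    using grad_zero_outside[of f "G x" x K] assms that
    by (auto simp: C1_grad_def compact_imp_closed)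
  show "cont_bdd_supp f" "cont_bdd_supp G"
    using assms * C1_grad_continuous[OF assms(1)]
    by (auto intro!: cont_bdd_supp_compactI[OF _ assms(2)] simp: C1_grad_def)
qed

lemma test_functionsI:
  assumes "\<And>k. times_cont_diff k \<phi>" "compact K" "K \<subseteq> \<Omega>" "\<And>x. x \<notin> K \<Longrightarrow> \<phi> x = 0"
  shows "\<phi> \<in> test_functions \<Omega>"
proof -
  have "closure {x. \<phi> x \<noteq> 0} \<subseteq> K"
    by (rule closure_minimal) (use assms compact_imp_closed in auto)
  moreover from this have "compact (closure {x. \<phi> x \<noteq> 0})"
    by (meson assms(2) bounded_subset closed_closure compact_eq_bounded_closed)
  ultimately show ?thesis
    using assms(1,3) by (simp add: test_functions_def)
qed

lemma test_functionsE:
  assumes "\<phi> \<in> test_functions \<Omega>"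
  obtains K where "\<And>k. times_cont_diff k \<phi>" "compact K" "K \<subseteq> \<Omega>" "\<And>x. x \<notin> K \<Longrightarrow> \<phi> x = 0"
proof (rule that)
  show "compact (closure {x. \<phi> x \<noteq> 0})" "closure {x. \<phi> x \<noteq> 0} \<subseteq> \<Omega>"
    and "times_cont_diff k \<phi>" for k
    using assms by (simp_all add: test_functions_def)
  show "\<phi> x = 0" if "x \<notin> closure {x. \<phi> x \<noteq> 0}" for x
    using that closure_subset[of "{x. \<phi> x \<noteq> 0}"] by blast
qed

subsection \<open>Translations in \<open>L\<^sup>1\<close>\<close>

lemma nn_integral_lborel_affine:
  fixes f :: "'a::euclidean_space \<Rightarrow> ennreal" and c :: real
  assumes [measurable]: "f \<in> borel_measurable borel" and c: "c \<noteq> 0"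
  shows "(\<integral>\<^sup>+x. f x \<partial>lborel) = ennreal (\<bar>c\<bar> ^ DIM('a)) * (\<integral>\<^sup>+x. f (t + c *\<^sub>R x) \<partial>lborel)"
  by (subst lborel_affine[OF c, of t])
    (simp add: nn_integral_density nn_integral_distr nn_integral_cmult ennreal_power)

lemma integrable_lborel_affine:
  fixes f :: "'a::euclidean_space \<Rightarrow> 'b::{banach, second_countable_topology}"
  assumes f: "integrable lborel f" and c: "c \<noteq> 0"
  shows "integrable lborel (\<lambda>x. f (t + c *\<^sub>R x))"
  using f f[THEN borel_measurable_integrable] c unfolding integrable_iff_bounded
  by (subst (asm) nn_integral_lborel_affine[where c=c and t=t]) (auto simp: ennreal_mult_less_top)

lemma integral_lborel_affine:
  fixes f :: "'a::euclidean_space \<Rightarrow> 'b::{banach, second_countable_topology}"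
  assumes f: "integrable lborel f" and c: "c \<noteq> 0"
  shows "(\<integral>x. f x \<partial>lborel) = \<bar>c\<bar> ^ DIM('a) *\<^sub>R (\<integral>x. f (t + c *\<^sub>R x) \<partial>lborel)"
proof -
  have [measurable]: "f \<in> borel_measurable borel" using f by auto
  show ?thesis
    by (subst lborel_affine[OF c, of t])
      (simp add: integral_density integral_distr integrable_lborel_affine[OF f c])
qed

lemma
  fixes f :: "'a::euclidean_space \<Rightarrow> 'b::{banach, second_countable_topology}"
  assumes f: "integrable lborel f"
  shows integrable_lborel_shift: "integrable lborel (\<lambda>x. f (x - v))"
    and integral_lborel_shift: "(\<integral>x. f (x - v) \<partial>lborel) = (\<integral>x. f x \<partial>lborel)"
    and integrable_lborel_reflect: "integrable lborel (\<lambda>x. f (v - x))"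
    and integral_lborel_reflect: "(\<integral>x. f (v - x) \<partial>lborel) = (\<integral>x. f x \<partial>lborel)"
  using integrable_lborel_affine[OF f, of 1 "- v"] integral_lborel_affine[OF f, of 1 "- v"]
    integrable_lborel_affine[OF f, of "-1" v] integral_lborel_affine[OF f, of "-1" v]
  by simp_all

text \<open>The density argument: in the splitting through g, the translated error f - g has the
  same L^1 norm as the error itself, because the measure is translation invariant.\<close>

lemma translation_L1_approx:
  fixes f :: "'a::euclidean_space \<Rightarrow> 'b::{banach, second_countable_topology}"
  assumes f: "integrable lborel f"
    and ap: "\<And>e. e > 0 \<Longrightarrow> \<exists>g. integrable lborel g \<and> (\<integral>x. norm (f x - g x) \<partial>lborel) < e \<and>
      (\<lambda>j. \<integral>x. norm (g (x - h j) - g x) \<partial>lborel) \<longlonglongrightarrow> 0"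
  shows "(\<lambda>j::nat. \<integral>x. norm (f (x - h j) - f x) \<partial>lborel) \<longlonglongrightarrow> 0"
proof (rule LIMSEQ_I)
  fix e :: real assume "e > 0"
  then obtain g where g: "integrable lborel g" "(\<integral>x. norm (f x - g x) \<partial>lborel) < e / 3"
    "(\<lambda>j. \<integral>x. norm (g (x - h j) - g x) \<partial>lborel) \<longlonglongrightarrow> 0"
    using ap[of "e/3"] by auto
  obtain N where N: "\<And>j. j \<ge> N \<Longrightarrow> norm ((\<integral>x. norm (g (x - h j) - g x) \<partial>lborel) - 0) < e / 3"
    using LIMSEQ_D[OF g(3), of "e/3"] \<open>e > 0\<close> by auto
  have d: "integrable lborel (\<lambda>x. norm (f x - g x))" using f g(1) by simp
  have "norm ((\<integral>x. norm (f (x - h j) - f x) \<partial>lborel) - 0) < e" if "j \<ge> N" for j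
  proof -
    have i: "integrable lborel (\<lambda>x. norm (f (x - h j) - g (x - h j)))"
      "integrable lborel (\<lambda>x. norm (g (x - h j) - g x))"
      using integrable_lborel_shift[OF f, of "h j"] integrable_lborel_shift[OF g(1), of "h j"] g(1) by simp_all
    have "(\<integral>x. norm (f (x - h j) - f x) \<partial>lborel) \<le>
       (\<integral>x. norm (f (x - h j) - g (x - h j)) + norm (g (x - h j) - g x) + norm (f x - g x) \<partial>lborel)"
    proof (rule integral_mono)
      show "integrable lborel (\<lambda>x. norm (f (x - h j) - f x))"
        using integrable_lborel_shift[OF f, of "h j"] f by simp
      show "integrable lborel (\<lambda>x. norm (f (x - h j) - g (x - h j)) + norm (g (x - h j) - g x) + norm (f x - g x))"
        using i d by simp
      show "norm (f (x - h j) - f x) \<le> norm (f (x - h j) - g (x - h j)) + norm (g (x - h j) - g x) + norm (f x - g x)" for x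
        using norm_triangle_ineq[of "f (x - h j) - g (x - h j)" "g (x - h j) - f x"]
          norm_triangle_ineq[of "g (x - h j) - g x" "g x - f x"]
        by (simp add: norm_minus_commute)
    qed
    also have "\<dots> = (\<integral>x. norm (f (x - h j) - g (x - h j)) \<partial>lborel) +
        (\<integral>x. norm (g (x - h j) - g x) \<partial>lborel) + (\<integral>x. norm (f x - g x) \<partial>lborel)"
      using i d by simp
    also have "(\<integral>x. norm (f (x - h j) - g (x - h j)) \<partial>lborel) = (\<integral>x. norm (f x - g x) \<partial>lborel)"
      by (rule integral_lborel_shift[OF d])
    finally show ?thesis using g(2) N[OF that] by simp
  qed
  then show "\<exists>no. \<forall>n\<ge>no. norm ((\<integral>x. norm (f (x - h n) - f x) \<partial>lborel) - 0) < e" by blast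
qed

text \<open>For open U the product of the indicator with its translates converges at every point: x
  in U implies x - h in U for small h, and off U the product is 0. The boundary of U, which may have
  positive measure, causes no trouble.\<close>

lemma translation_L1_indicator_open:
  fixes U :: "'a::euclidean_space set" and c :: "'b::{banach, second_countable_topology}"
  assumes U: "open U" "emeasure lborel U < \<infinity>" and h: "h \<longlonglongrightarrow> 0"
  shows "(\<lambda>j::nat. \<integral>x. norm (indicator U (x - h j) *\<^sub>R c - indicator U x *\<^sub>R c) \<partial>lborel) \<longlonglongrightarrow> 0"
proof -
  let ?u = "indicator U :: 'a \<Rightarrow> real"
  have [measurable]: "U \<in> sets borel" using U by simp
  have iu: "integrable lborel ?u" using U by simp
  have ish: "integrable lborel (\<lambda>x. ?u (x - h j))" for j by (rule integrable_lborel_shift[OF iu])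
  have pw: "(\<lambda>j. ?u x * ?u (x - h j)) \<longlonglongrightarrow> ?u x" for x
  proof (cases "x \<in> U")
    case True
    have "(\<lambda>j. x - h j) \<longlonglongrightarrow> x - 0" by (intro tendsto_intros h)
    then have "eventually (\<lambda>j. x - h j \<in> U) sequentially"
      using True U(1) topological_tendstoD by fastforce
    then show ?thesis by (intro tendsto_eventually) (auto elim!: eventually_mono simp: True)
  qed simp
  have ipr: "integrable lborel (\<lambda>x. ?u x * ?u (x - h j))" for j
    by (rule Bochner_Integration.integrable_bound[OF iu]) (auto simp: indicator_def)
  have lim: "(\<lambda>j. \<integral>x. ?u x * ?u (x - h j) \<partial>lborel) \<longlonglongrightarrow> (\<integral>x. ?u x \<partial>lborel)"
  proof (rule integral_dominated_convergence[OF _ _ iu])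
    show "AE x in lborel. (\<lambda>j. ?u x * ?u (x - h j)) \<longlonglongrightarrow> ?u x" by (rule AE_I2) (rule pw)
    show "AE x in lborel. norm (?u x * ?u (x - h j)) \<le> ?u x" for j
      by (rule AE_I2) (simp add: indicator_def)
  qed measurable
  \<comment> \<open>For two indicator values, |s - t| = s + t - 2 s t; only the product varies with
    j in the limit.\<close>
  have eq: "(\<integral>x. norm (?u (x - h j) *\<^sub>R c - ?u x *\<^sub>R c) \<partial>lborel) =
      (2 * (\<integral>x. ?u x \<partial>lborel) - 2 * (\<integral>x. ?u x * ?u (x - h j) \<partial>lborel)) * norm c" for j
  proof -
    have "norm (?u (x - h j) *\<^sub>R c - ?u x *\<^sub>R c) =
       (?u (x - h j) + ?u x - 2 * (?u x * ?u (x - h j))) * norm c" for x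
      by (auto simp: indicator_def)
    then have "(\<integral>x. norm (?u (x - h j) *\<^sub>R c - ?u x *\<^sub>R c) \<partial>lborel) =
       (\<integral>x. (?u (x - h j) + ?u x - 2 * (?u x * ?u (x - h j))) * norm c \<partial>lborel)" by presburger
    also have "\<dots> = ((\<integral>x. ?u (x - h j) \<partial>lborel) + (\<integral>x. ?u x \<partial>lborel) -
        2 * (\<integral>x. ?u x * ?u (x - h j) \<partial>lborel)) * norm c"
      using iu ish[of j] ipr[of j] by (simp del: integral_indicator)
    finally show ?thesis
      using integral_lborel_shift[OF iu, of "h j"] by (simp del: integral_indicator)
  qed
  have "(\<lambda>j. (2 * (\<integral>x. ?u x \<partial>lborel) - 2 * (\<integral>x. ?u x * ?u (x - h j) \<partial>lborel)) * norm c)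
      \<longlonglongrightarrow> (2 * (\<integral>x. ?u x \<partial>lborel) - 2 * (\<integral>x. ?u x \<partial>lborel)) * norm c"
    by (intro tendsto_intros lim)
  then show ?thesis unfolding eq by simp
qed

lemma translation_L1_tendsto:
  fixes f :: "'a::euclidean_space \<Rightarrow> 'b::{banach, second_countable_topology}"
  assumes f: "integrable lborel f" and h: "h \<longlonglongrightarrow> 0"
  shows "(\<lambda>j::nat. \<integral>x. norm (f (x - h j) - f x) \<partial>lborel) \<longlonglongrightarrow> 0"
  using f
proof (induction rule: integrable_induct)
  case (base A c)
  have A [measurable]: "A \<in> sets borel" using base by simp
  show ?case
  proof (rule translation_L1_approx)
    show "integrable lborel (\<lambda>x. indicat_real A x *\<^sub>R c)" using base by simp
    fix e :: real assume e: "e > 0"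
    \<comment> \<open>Outer regularity replaces the measurable set by an open one. The denominator
      norm c + 1 covers c = 0 as well.\<close>
    obtain U where U: "open U" "A \<subseteq> U" "emeasure lborel (U - A) < ennreal (e / (norm c + 1))"
      using outer_regular_lborel[OF A, of "e / (norm c + 1)"] e by (auto simp: add_nonneg_pos)
    have fin: "emeasure lborel (U - A) < \<infinity>" using U(3) by (simp add: order_less_trans)
    have [measurable]: "U \<in> sets borel" using U by simp
    have "emeasure lborel U \<le> emeasure lborel A + emeasure lborel (U - A)"
      using emeasure_subadditive[of A lborel "U - A"] U(2) by (simp add: Un_absorb1)
    also have "\<dots> < \<infinity>" using fin base by simp
    finally have Uf: "emeasure lborel U < \<infinity>" .
    have "norm (indicat_real A x *\<^sub>R c - indicat_real U x *\<^sub>R c) = indicat_real (U - A) x * norm c" for x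
      using U(2) by (auto simp: indicator_def)
    then have "(\<integral>x. norm (indicat_real A x *\<^sub>R c - indicat_real U x *\<^sub>R c) \<partial>lborel) = measure lborel (U - A) * norm c"
      using fin by simp
    also have "\<dots> \<le> measure lborel (U - A) * (norm c + 1)" by (intro mult_left_mono) auto
    also have "\<dots> < e / (norm c + 1) * (norm c + 1)"
    proof (rule mult_strict_right_mono)
      show "measure lborel (U - A) < e / (norm c + 1)"
        unfolding measure_def using U(3) e fin by (subst enn2real_less_iff) (auto simp: add_nonneg_nonneg)
    qed (simp add: add_nonneg_pos)
    also have "\<dots> = e" by (simp add: add_nonneg_eq_0_iff)
    finally show "\<exists>g. integrable lborel g \<and> (\<integral>x. norm (indicat_real A x *\<^sub>R c - g x) \<partial>lborel) < e \<and>
        (\<lambda>j. \<integral>x. norm (g (x - h j) - g x) \<partial>lborel) \<longlonglongrightarrow> 0"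
      using translation_L1_indicator_open[OF U(1) Uf h, of c] Uf
      by (intro exI[of _ "\<lambda>x. indicat_real U x *\<^sub>R c"]) auto
  qed
next
  case (add f g)
  have lim0: "(\<lambda>j. (\<integral>x. norm (f (x - h j) - f x) \<partial>lborel) + (\<integral>x. norm (g (x - h j) - g x) \<partial>lborel)) \<longlonglongrightarrow> 0"
    using tendsto_add[OF add.IH] by simp
  have bd: "norm (\<integral>x. norm (f (x - h j) + g (x - h j) - (f x + g x)) \<partial>lborel) \<le>
      (\<integral>x. norm (f (x - h j) - f x) \<partial>lborel) + (\<integral>x. norm (g (x - h j) - g x) \<partial>lborel)" for j
  proof -
    have i: "integrable lborel (\<lambda>x. norm (f (x - h j) - f x))" "integrable lborel (\<lambda>x. norm (g (x - h j) - g x))"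
      using integrable_lborel_shift[OF add.hyps(1), of "h j"] integrable_lborel_shift[OF add.hyps(2), of "h j"] add.hyps by simp_all
    have "(\<integral>x. norm (f (x - h j) + g (x - h j) - (f x + g x)) \<partial>lborel) \<le>
       (\<integral>x. norm (f (x - h j) - f x) + norm (g (x - h j) - g x) \<partial>lborel)"
    proof (rule integral_mono)
      show "integrable lborel (\<lambda>x. norm (f (x - h j) + g (x - h j) - (f x + g x)))"
        using integrable_lborel_shift[OF add.hyps(1), of "h j"]
          integrable_lborel_shift[OF add.hyps(2), of "h j"] add.hyps by simp
      show "integrable lborel (\<lambda>x. norm (f (x - h j) - f x) + norm (g (x - h j) - g x))"
        using i by simp
      show "norm (f (x - h j) + g (x - h j) - (f x + g x)) \<le> norm (f (x - h j) - f x) + norm (g (x - h j) - g x)" for x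
        by (rule norm_diff_triangle_ineq)
    qed
    then show ?thesis using i by simp
  qed
  show ?case
    by (rule Lim_null_comparison[OF always_eventually lim0]) (use bd in blast)
next
  case (lim f s)
  show ?case
  proof (rule translation_L1_approx[OF lim.hyps(4)])
    fix e :: real assume e: "e > 0"
    have "(\<lambda>i. \<integral>x. norm (f x - s i x) \<partial>lborel) \<longlonglongrightarrow> (\<integral>x. 0 \<partial>(lborel :: 'a measure))"
    proof (rule integral_dominated_convergence)
      \<comment> \<open>The induction rule provides approximants bounded by 2 |f|, so the error is
        at most 3 |f|.\<close>
      show "integrable lborel (\<lambda>x. 3 * norm (f x))" using lim.hyps(4) by simp
      show "AE x in lborel. (\<lambda>i. norm (f x - s i x)) \<longlonglongrightarrow> 0"
      proof (rule AE_I2)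
        fix x
        have "(\<lambda>i. norm (f x - s i x)) \<longlonglongrightarrow> norm (f x - f x)" by (intro tendsto_intros lim.hyps(2)) simp
        then show "(\<lambda>i. norm (f x - s i x)) \<longlonglongrightarrow> 0" by simp
      qed
      show "AE x in lborel. norm (norm (f x - s i x)) \<le> 3 * norm (f x)" for i
      proof (rule AE_I2)
        fix x
        show "norm (norm (f x - s i x)) \<le> 3 * norm (f x)"
          using lim.hyps(3)[of x i] norm_triangle_ineq4[of "f x" "s i x"] by simp
      qed
    qed (use lim.hyps(1,4) in auto)
    then have "(\<lambda>i. \<integral>x. norm (f x - s i x) \<partial>lborel) \<longlonglongrightarrow> 0" by simp
    from order_tendstoD(2)[OF this e] obtain i where "(\<integral>x. norm (f x - s i x) \<partial>lborel) < e"
      unfolding eventually_sequentially by blast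
    then show "\<exists>g. integrable lborel g \<and> (\<integral>x. norm (f x - g x) \<partial>lborel) < e \<and>
        (\<lambda>j. \<integral>x. norm (g (x - h j) - g x) \<partial>lborel) \<longlonglongrightarrow> 0"
      using lim.hyps(1) lim.IH by blast
  qed
qed

text \<open>A kernel averages over all shifts in its support at once, so a bound for a whole ball of
  shifts is needed; shifts violating it would form a null sequence that contradicts the sequential
  form.\<close>

lemma translation_L1_uniform:
  fixes f :: "'a::euclidean_space \<Rightarrow> 'b::{banach, second_countable_topology}"
  assumes f: "integrable lborel f" and e: "e > 0"
  obtains d where "d > 0" "\<And>v. norm v < d \<Longrightarrow> (\<integral>x. norm (f (x - v) - f x) \<partial>lborel) < e"
proof -
  have "\<exists>d>0. \<forall>v. norm v < d \<longrightarrow> (\<integral>x. norm (f (x - v) - f x) \<partial>lborel) < e"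
  proof (rule ccontr)
    assume a: "\<not> ?thesis"
    have "\<exists>v. norm v < inverse (real (Suc j)) \<and> \<not> (\<integral>x. norm (f (x - v) - f x) \<partial>lborel) < e" for j
    proof -
      have "inverse (real (Suc j)) > 0" by simp
      then show ?thesis using a by blast
    qed
    then obtain h where h: "\<And>j. norm (h j) < inverse (real (Suc j))"
      "\<And>j. \<not> (\<integral>x. norm (f (x - h j) - f x) \<partial>lborel) < e" by metis
    have "h \<longlonglongrightarrow> 0"
      by (rule Lim_null_comparison[OF _ LIMSEQ_inverse_real_of_nat])
        (use h(1) less_imp_le in \<open>auto intro!: always_eventually\<close>)
    then have "eventually (\<lambda>j. (\<integral>x. norm (f (x - h j) - f x) \<partial>lborel) < e) sequentially"
      using translation_L1_tendsto[OF f] e order_tendstoD(2) by blast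
    then show False using h(2) by simp
  qed
  then show ?thesis using that by blast
qed

subsection \<open>Convolution with a kernel of bounded support\<close>

text \<open>The kernel is scalar and the other factor may be a vector, so that a function and its
  gradient are mollified by the same operation.\<close>

definition conv ::
    "(real^'n::finite \<Rightarrow> real) \<Rightarrow> (real^'n \<Rightarrow> 'b::{banach, second_countable_topology}) \<Rightarrow> real^'n \<Rightarrow> 'b" where
  "conv K f x = (\<integral>y. K (x - y) *\<^sub>R f y \<partial>lborel)"

lemma conv_integrand_integrable:
  fixes f :: "real^'n::finite \<Rightarrow> 'b::{banach, second_countable_topology}"
  assumes K: "cont_bdd_supp K" and f: "integrable lborel f"
  shows "integrable lborel (\<lambda>y. K (x - y) *\<^sub>R f y)"
proof -
  obtain M where M: "\<And>x. norm (K x) \<le> M" using cont_bdd_supp_bounded[OF K] by blast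
  have [measurable]: "K \<in> borel_measurable borel" "f \<in> borel_measurable borel"
    using cont_bdd_supp_measurable[OF K] f by auto
  show ?thesis
  proof (rule Bochner_Integration.integrable_bound)
    show "integrable lborel (\<lambda>y. M *\<^sub>R f y)" using f by simp
    show "AE y in lborel. norm (K (x - y) *\<^sub>R f y) \<le> norm (M *\<^sub>R f y)"
    proof (rule AE_I2)
      fix y show "norm (K (x - y) *\<^sub>R f y) \<le> norm (M *\<^sub>R f y)"
        using M[of "x - y"] by (auto intro!: mult_right_mono)
    qed
  qed measurable
qed

lemma conv_integrand_integrable':
  fixes G :: "real^'n::finite \<Rightarrow> real^'n"
  assumes G: "cont_bdd_supp G" and f: "integrable lborel f"
  shows "integrable lborel (\<lambda>y. f y *\<^sub>R G (x - y))"
proof -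
  obtain M where M: "\<And>x. norm (G x) \<le> M" using cont_bdd_supp_bounded[OF G] by blast
  have [measurable]: "G \<in> borel_measurable borel" "f \<in> borel_measurable borel"
    using cont_bdd_supp_measurable[OF G] f by auto
  show ?thesis
  proof (rule Bochner_Integration.integrable_bound)
    show "integrable lborel (\<lambda>y. M *\<^sub>R f y)" using f by simp
    show "AE y in lborel. norm (f y *\<^sub>R G (x - y)) \<le> norm (M *\<^sub>R f y)"
    proof (rule AE_I2)
      fix y show "norm (f y *\<^sub>R G (x - y)) \<le> norm (M *\<^sub>R f y)"
        using M[of "x - y"] mult_left_mono[of "norm (G (x - y))" "\<bar>M\<bar>" "\<bar>f y\<bar>"] by (auto simp: mult.commute abs_mult)
    qed
  qed measurable
qed

lemma conv_flip:
  assumes K: "cont_bdd_supp K" and f: "integrable lborel f"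
  shows "integrable lborel (\<lambda>z. K z *\<^sub>R f (x - z))" "conv K f x = (\<integral>z. K z *\<^sub>R f (x - z) \<partial>lborel)"
  using integrable_lborel_reflect[OF conv_integrand_integrable[OF K f, of x], of x]
    integral_lborel_reflect[OF conv_integrand_integrable[OF K f, of x], of x]
  by (simp_all add: conv_def)

lemma conv_measurable [measurable]:
  fixes f :: "real^'n::finite \<Rightarrow> 'b::{banach, second_countable_topology}"
  assumes [measurable]: "K \<in> borel_measurable borel" "f \<in> borel_measurable borel"
  shows "conv K f \<in> borel_measurable borel"
proof -
  have "(\<lambda>x. \<integral>y. K (x - y) *\<^sub>R f y \<partial>lborel) \<in> borel_measurable borel"
    by (rule lborel.borel_measurable_lebesgue_integral) measurable
  then show ?thesis unfolding conv_def .
qed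

lemma norm_conv_le:
  fixes f :: "real^'n::finite \<Rightarrow> 'b::{banach, second_countable_topology}"
  assumes K: "cont_bdd_supp K" and pos: "\<And>z. K z \<ge> 0" and f: "integrable lborel f"
  shows "norm (conv K f x) \<le> conv K (\<lambda>y. norm (f y)) x"
proof -
  have "norm (conv K f x) \<le> (\<integral>y. norm (K (x - y) *\<^sub>R f y) \<partial>lborel)"
    unfolding conv_def by (rule integral_norm_bound)
  then show ?thesis by (simp add: conv_def pos)
qed

definition unit_kernel :: "(real^'n::finite \<Rightarrow> real) \<Rightarrow> bool" where
  "unit_kernel K \<longleftrightarrow> cont_bdd_supp K \<and> (\<forall>z. K z \<ge> 0) \<and> (\<integral>z. K z \<partial>lborel) = 1"

lemma unit_kernel_nn_integral:
  assumes "unit_kernel K"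
  shows "(\<integral>\<^sup>+z. ennreal (K z) \<partial>lborel) = 1"
  using assms nn_integral_eq_integral[OF cont_bdd_supp_integrable[of K]]
  by (simp add: unit_kernel_def)

text \<open>As K has mass 1, the error at x is the K-average of f(x - z) - f(x); exchanging the
  integrals leaves the average of the L^1 distances between f and its translates. The computation in
  \<open>ennreal\<close> assumes no integrability of the convolution, which instead results from
  it.\<close>

lemma conv_L1_dist:
  fixes f :: "real^'n::finite \<Rightarrow> 'b::{banach, second_countable_topology}"
  assumes K: "unit_kernel K" and f: "integrable lborel f"
    and e: "e \<ge> 0" "\<And>v. K v \<noteq> 0 \<Longrightarrow> (\<integral>x. norm (f (x - v) - f x) \<partial>lborel) \<le> e"
  shows "integrable lborel (conv K f)" "(\<integral>x. norm (conv K f x - f x) \<partial>lborel) \<le> e"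
proof -
  have Kc: "cont_bdd_supp K" and pos: "\<And>z. K z \<ge> 0" and one: "(\<integral>z. K z \<partial>lborel) = 1"
    using K by (auto simp: unit_kernel_def)
  have [measurable]: "K \<in> borel_measurable borel" "f \<in> borel_measurable borel"
    using cont_bdd_supp_measurable[OF Kc] f by auto
  have pw: "ennreal (norm (conv K f x - f x)) \<le> (\<integral>\<^sup>+z. ennreal (K z) * ennreal (norm (f (x - z) - f x)) \<partial>lborel)" for x
  proof -
    have i: "integrable lborel (\<lambda>z. K z *\<^sub>R f x)"
      using cont_bdd_supp_integrable[OF Kc] by simp
    have i2: "integrable lborel (\<lambda>z. K z *\<^sub>R (f (x - z) - f x))"
      unfolding scaleR_diff_right by (rule Bochner_Integration.integrable_diff[OF conv_flip(1)[OF Kc f] i])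
    have "conv K f x - f x = (\<integral>z. K z *\<^sub>R f (x - z) \<partial>lborel) - (\<integral>z. K z *\<^sub>R f x \<partial>lborel)"
      using conv_flip(2)[OF Kc f, of x] one cont_bdd_supp_integrable[OF Kc] by simp
    also have "\<dots> = (\<integral>z. K z *\<^sub>R (f (x - z) - f x) \<partial>lborel)"
      unfolding scaleR_diff_right by (rule Bochner_Integration.integral_diff[symmetric, OF conv_flip(1)[OF Kc f] i])
    finally have "ennreal (norm (conv K f x - f x)) \<le> (\<integral>\<^sup>+z. norm (K z *\<^sub>R (f (x - z) - f x)) \<partial>lborel)"
      using integral_norm_bound_ennreal[OF i2] by simp
    then show ?thesis by (simp add: pos ennreal_mult)
  qed
  have m2: "(\<lambda>(x, z). ennreal (K z) * ennreal (norm (f (x - z) - f x))) \<in> borel_measurable (lborel \<Otimes>\<^sub>M lborel)"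
    by measurable
  have "(\<integral>\<^sup>+x. ennreal (norm (conv K f x - f x)) \<partial>lborel) \<le>
      (\<integral>\<^sup>+x. (\<integral>\<^sup>+z. ennreal (K z) * ennreal (norm (f (x - z) - f x)) \<partial>lborel) \<partial>lborel)"
    by (intro nn_integral_mono pw)
  also have "\<dots> = (\<integral>\<^sup>+z. (\<integral>\<^sup>+x. ennreal (K z) * ennreal (norm (f (x - z) - f x)) \<partial>lborel) \<partial>lborel)"
    by (rule lborel_pair.Fubini'[OF m2, symmetric])
  also have "\<dots> \<le> (\<integral>\<^sup>+z. ennreal (K z) * ennreal e \<partial>lborel)"
  proof (rule nn_integral_mono)
    fix z
    have i: "integrable lborel (\<lambda>x. norm (f (x - z) - f x))"
      using integrable_lborel_shift[OF f, of z] f by simp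
    have "(\<integral>\<^sup>+x. ennreal (K z) * ennreal (norm (f (x - z) - f x)) \<partial>lborel) =
       ennreal (K z) * (\<integral>\<^sup>+x. ennreal (norm (f (x - z) - f x)) \<partial>lborel)"
      by (rule nn_integral_cmult) measurable
    also have "\<dots> = ennreal (K z) * ennreal (\<integral>x. norm (f (x - z) - f x) \<partial>lborel)"
      by (subst nn_integral_eq_integral[OF i]) auto
    also have "\<dots> \<le> ennreal (K z) * ennreal e"
      using e(2)[of z] by (cases "K z = 0") (auto intro!: mult_left_mono ennreal_leI)
    finally show "(\<integral>\<^sup>+x. ennreal (K z) * ennreal (norm (f (x - z) - f x)) \<partial>lborel) \<le> ennreal (K z) * ennreal e" .
  qed
  also have "\<dots> = ennreal e"
    using unit_kernel_nn_integral[OF K] by (subst nn_integral_multc) auto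
  finally have le: "(\<integral>\<^sup>+x. ennreal (norm (conv K f x - f x)) \<partial>lborel) \<le> ennreal e" .
  then have d: "integrable lborel (\<lambda>x. conv K f x - f x)"
    by (intro integrableI_bounded) (auto intro: le_less_trans)
  then show "integrable lborel (conv K f)"
    using Bochner_Integration.integrable_add[OF d f] by simp
  show "(\<integral>x. norm (conv K f x - f x) \<partial>lborel) \<le> e"
    using le nn_integral_eq_integral[OF integrable_norm[OF d]] e(1) by simp
qed

text \<open>The preceding estimate with the crude distance 2 \<parallel>f\<parallel>, valid for
  every shift.\<close>

lemma conv_integrable:
  fixes f :: "real^'n::finite \<Rightarrow> 'b::{banach, second_countable_topology}"
  assumes K: "unit_kernel K" and f: "integrable lborel f"
  shows "integrable lborel (conv K f)"
proof (rule conv_L1_dist(1)[OF K f, of "2 * (\<integral>x. norm (f x) \<partial>lborel)"])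
  fix v
  have i: "integrable lborel (\<lambda>x. f (x - v))" by (rule integrable_lborel_shift[OF f])
  have "(\<integral>x. norm (f (x - v) - f x) \<partial>lborel) \<le> (\<integral>x. norm (f (x - v)) + norm (f x) \<partial>lborel)"
    by (rule integral_mono) (use i f norm_triangle_ineq4 in auto)
  also have "\<dots> = 2 * (\<integral>x. norm (f x) \<partial>lborel)"
    using i f integral_lborel_shift[OF integrable_norm[OF f], of v] by simp
  finally show "(\<integral>x. norm (f (x - v) - f x) \<partial>lborel) \<le> 2 * (\<integral>x. norm (f x) \<partial>lborel)" .
qed simp

lemma conv_L1_tendsto:
  fixes f :: "real^'n::finite \<Rightarrow> 'b::{banach, second_countable_topology}"
  assumes K: "\<And>j. unit_kernel (K j)" and supp: "\<And>j z. K j z \<noteq> 0 \<Longrightarrow> norm z \<le> r j"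
    and r: "r \<longlonglongrightarrow> 0" and f: "integrable lborel f"
  shows "(\<lambda>j::nat. \<integral>x. norm (conv (K j) f x - f x) \<partial>lborel) \<longlonglongrightarrow> 0"
proof (rule LIMSEQ_I)
  fix e :: real assume e: "e > 0"
  obtain d where d: "d > 0" "\<And>v. norm v < d \<Longrightarrow> (\<integral>x. norm (f (x - v) - f x) \<partial>lborel) < e / 2"
    using translation_L1_uniform[OF f, of "e/2"] e by auto
  have "eventually (\<lambda>j. r j < d) sequentially" using r d(1) order_tendstoD(2) by blast
  then obtain N where N: "\<And>j. j \<ge> N \<Longrightarrow> r j < d" by (auto simp: eventually_sequentially)
  have "norm ((\<integral>x. norm (conv (K j) f x - f x) \<partial>lborel) - 0) < e" if "j \<ge> N" for j
  proof -
    have "(\<integral>x. norm (conv (K j) f x - f x) \<partial>lborel) \<le> e / 2"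
    proof (rule conv_L1_dist(2)[OF K f])
      fix v assume "K j v \<noteq> 0"
      then have "norm v < d" using supp N[OF that] by fastforce
      then show "(\<integral>x. norm (f (x - v) - f x) \<partial>lborel) \<le> e / 2" using d(2) less_imp_le by blast
    qed (use e in auto)
    then show ?thesis using e by simp
  qed
  then show "\<exists>no. \<forall>n\<ge>no. norm ((\<integral>x. norm (conv (K n) f x - f x) \<partial>lborel) - 0) < e" by blast
qed

lemma C1_grad_lipschitz:
  assumes f: "\<And>x. (f has_derivative (\<lambda>h. h \<bullet> G x)) (at x)"
    and "convex S" and B: "\<And>x. x \<in> S \<Longrightarrow> norm (G x) \<le> B" and xy: "x \<in> S" "y \<in> S"
  shows "\<bar>f x - f y\<bar> \<le> B * norm (x - y)"
proof -
  have "norm (f x - f y) \<le> B * norm (x - y)"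
  proof (rule differentiable_bound[OF \<open>convex S\<close> _ _ xy])
    show "(f has_derivative (\<lambda>h. h \<bullet> G z)) (at z within S)" for z
      using f has_derivative_at_withinI by blast
    show "onorm (\<lambda>h. h \<bullet> G z) \<le> B" if "z \<in> S" for z
    proof (rule onorm_bound)
      show "0 \<le> B" using B[OF that] norm_ge_zero order_trans by blast
      fix h
      have "norm (h \<bullet> G z) \<le> norm h * norm (G z)" using Cauchy_Schwarz_ineq2[of h "G z"] by simp
      also have "\<dots> \<le> norm h * B" by (intro mult_left_mono B that) auto
      finally show "norm (h \<bullet> G z) \<le> B * norm h" by (simp add: mult.commute)
    qed
  qed
  then show ?thesis by simp
qed

text \<open>The mean value bound is applied to K minus its linear part at x, whose gradient is small
  by uniform continuity of G. That d does not depend on x is what allows differentiation under the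
  integral in \<open>conv_has_derivative\<close>.\<close>

lemma C1_grad_uniform_linearization:
  assumes K: "C1_grad K G" and G: "cont_bdd_supp G" and e: "e > 0"
  obtains d where "d > 0" "\<And>x y. norm (y - x) < d \<Longrightarrow> \<bar>K y - K x - (y - x) \<bullet> G x\<bar> \<le> e * norm (y - x)"
proof -
  obtain d where d: "d > 0" "\<And>x y. dist x y < d \<Longrightarrow> dist (G x) (G y) < e"
    using cont_bdd_supp_uniform[OF G e] by blast
  have "\<bar>K y - K x - (y - x) \<bullet> G x\<bar> \<le> e * norm (y - x)" if "norm (y - x) < d" for x y
  proof -
    have "\<bar>(K y - y \<bullet> G x) - (K x - x \<bullet> G x)\<bar> \<le> e * norm (y - x)"
    proof (rule C1_grad_lipschitz[where G="\<lambda>z. G z - G x" and S="ball x d"])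
      show "((\<lambda>z. K z - z \<bullet> G x) has_derivative (\<lambda>h. h \<bullet> (G z - G x))) (at z)" for z
        using K unfolding C1_grad_def inner_diff_right
        by (intro has_derivative_diff) (auto intro!: derivative_eq_intros)
      show "norm (G z - G x) \<le> e" if "z \<in> ball x d" for z
        using d(2)[of z x] that by (simp add: dist_norm norm_minus_commute)
    qed (use that d in \<open>auto simp: dist_norm norm_minus_commute\<close>)
    then show ?thesis by (simp add: inner_diff_left)
  qed
  then show ?thesis using that d(1) by blast
qed

lemma conv_has_derivative:
  assumes K: "C1_grad K G" "cont_bdd_supp K" "cont_bdd_supp G" and f: "integrable lborel f"
  shows "(conv K f has_derivative (\<lambda>h. h \<bullet> (\<integral>t. f t *\<^sub>R G (x - t) \<partial>lborel))) (at x)"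
  unfolding has_derivative_at_alt
proof (intro conjI allI impI)
  show "bounded_linear (\<lambda>h. h \<bullet> (\<integral>t. f t *\<^sub>R G (x - t) \<partial>lborel))"
    by (rule bounded_linear_inner_left)
  fix e :: real assume e: "0 < e"
  define c where "c = (\<integral>t. \<bar>f t\<bar> \<partial>lborel)"
  have c: "c \<ge> 0" by (simp add: c_def)
  \<comment> \<open>The error of linearisation is integrated against |f|, whose integral is c; c + 1
    avoids division by zero.\<close>
  obtain d where d: "d > 0"
    "\<And>x y. norm (y - x) < d \<Longrightarrow> \<bar>K y - K x - (y - x) \<bullet> G x\<bar> \<le> e / (c + 1) * norm (y - x)"
    using C1_grad_uniform_linearization[OF K(1,3), of "e / (c + 1)"] e c by (auto simp: add_nonneg_pos)
  have "norm (conv K f y - conv K f x - (y - x) \<bullet> (\<integral>t. f t *\<^sub>R G (x - t) \<partial>lborel)) \<le> e * norm (y - x)"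
    if y: "norm (y - x) < d" for y
  proof -
    have i1: "integrable lborel (\<lambda>t. K (y - t) * f t)" "integrable lborel (\<lambda>t. K (x - t) * f t)"
      using conv_integrand_integrable[OF K(2) f] by simp_all
    have i2: "integrable lborel (\<lambda>t. f t *\<^sub>R G (x - t))" by (rule conv_integrand_integrable'[OF K(3) f])
    have "(y - x) \<bullet> (\<integral>t. f t *\<^sub>R G (x - t) \<partial>lborel) = (\<integral>t. (y - x) \<bullet> (f t *\<^sub>R G (x - t)) \<partial>lborel)"
      by (rule integral_inner_right[symmetric]) (use i2 in simp)
    then have "conv K f y - conv K f x - (y - x) \<bullet> (\<integral>t. f t *\<^sub>R G (x - t) \<partial>lborel) =
      (\<integral>t. K (y - t) * f t - K (x - t) * f t - (y - x) \<bullet> (f t *\<^sub>R G (x - t)) \<partial>lborel)"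
      unfolding conv_def using i1 integrable_inner_right[of "y - x" lborel, OF i2] by simp
    then have "norm (conv K f y - conv K f x - (y - x) \<bullet> (\<integral>t. f t *\<^sub>R G (x - t) \<partial>lborel)) \<le>
      (\<integral>t. norm (K (y - t) * f t - K (x - t) * f t - (y - x) \<bullet> (f t *\<^sub>R G (x - t))) \<partial>lborel)"
      by (simp only: integral_norm_bound)
    also have "\<dots> \<le> (\<integral>t. e / (c + 1) * norm (y - x) * \<bar>f t\<bar> \<partial>lborel)"
    proof (rule integral_mono)
      show "integrable lborel (\<lambda>t. norm (K (y - t) * f t - K (x - t) * f t - (y - x) \<bullet> (f t *\<^sub>R G (x - t))))"
        using i1 integrable_inner_right[of "y - x" lborel, OF i2] by simp
      show "integrable lborel (\<lambda>t. e / (c + 1) * norm (y - x) * \<bar>f t\<bar>)" using f by simp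
      fix t
      have "K (y - t) * f t - K (x - t) * f t - (y - x) \<bullet> (f t *\<^sub>R G (x - t)) =
        (K (y - t) - K (x - t) - ((y - t) - (x - t)) \<bullet> G (x - t)) * f t"
        by (simp add: algebra_simps)
      then have "norm (K (y - t) * f t - K (x - t) * f t - (y - x) \<bullet> (f t *\<^sub>R G (x - t))) =
        \<bar>K (y - t) - K (x - t) - ((y - t) - (x - t)) \<bullet> G (x - t)\<bar> * \<bar>f t\<bar>"
        by (simp only: real_norm_def abs_mult)
      also have "\<dots> \<le> e / (c + 1) * norm ((y - t) - (x - t)) * \<bar>f t\<bar>"
        by (rule mult_right_mono[OF d(2)]) (use y in auto)
      finally show "norm (K (y - t) * f t - K (x - t) * f t - (y - x) \<bullet> (f t *\<^sub>R G (x - t))) \<le>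
          e / (c + 1) * norm (y - x) * \<bar>f t\<bar>" by simp
    qed
    also have "\<dots> = e / (c + 1) * norm (y - x) * c" by (simp add: c_def)
    also have "\<dots> \<le> e * norm (y - x)"
    proof -
      have "c / (c + 1) \<le> 1" using c by simp
      then have "e * norm (y - x) * (c / (c + 1)) \<le> e * norm (y - x) * 1"
        using e by (intro mult_left_mono) auto
      then show ?thesis by (simp add: algebra_simps)
    qed
    finally show ?thesis .
  qed
  then show "\<exists>d>0. \<forall>y. norm (y - x) < d \<longrightarrow>
      norm (conv K f y - conv K f x - (y - x) \<bullet> (\<integral>t. f t *\<^sub>R G (x - t) \<partial>lborel)) \<le> e * norm (y - x)"
    using d(1) by blast
qed

lemma vec_nth_integral:
  fixes F :: "'a \<Rightarrow> real^'n::finite"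
  assumes "integrable M F"
  shows "(\<integral>x. F x \<partial>M) $ i = (\<integral>x. F x $ i \<partial>M)"
  using integral_bounded_linear[OF bounded_linear_vec_nth assms, of i] by simp

text \<open>Each partial derivative of the convolution is the convolution with a partial derivative
  of K, whose support lies in the same S. Hence the induction keeps S and f fixed and varies
  K.\<close>

lemma conv_times_cont_diff:
  assumes "\<And>k. times_cont_diff k K" "compact S" "\<And>x. x \<notin> S \<Longrightarrow> K x = 0" and f: "integrable lborel f"
  shows "times_cont_diff k (conv K f)"
  using assms(1,3)
proof (induction k arbitrary: K)
  case 0
  have "C1_grad K (grad K)" using 0(1)[of "Suc 0"] times_cont_diff_C1_grad by blast
  from has_derivative_continuous[OF conv_has_derivative[OF this
        C1_grad_cont_bdd_supp(1,2)[OF this assms(2) 0(2)] f]]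
  show ?case
    by (simp add: continuous_at_imp_continuous_on)
next
  case (Suc k)
  have K: "C1_grad K (grad K)" using Suc(2)[of "Suc 0"] times_cont_diff_C1_grad by blast
  note bs = C1_grad_cont_bdd_supp[OF this assms(2) Suc(3)]
  show ?case
  proof (rule times_cont_diff_SucI[OF conv_has_derivative[OF K bs(1,2) f]])
    fix i
    have "(\<integral>t. f t *\<^sub>R grad K (x - t) \<partial>lborel) $ i = conv (\<lambda>x. grad K x $ i) f x" for x
      using vec_nth_integral[OF conv_integrand_integrable'[OF bs(2) f, of x], of i]
      by (simp add: conv_def mult.commute)
    moreover have "times_cont_diff k (conv (\<lambda>x. grad K x $ i) f)"
    proof (rule Suc.IH)
      show "times_cont_diff m (\<lambda>x. grad K x $ i)" for m
        by (rule times_cont_diff_Suc_partial[OF Suc.prems(1)])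
      show "grad K x $ i = 0" if "x \<notin> S" for x using bs(3)[of x] that by simp
    qed
    ultimately show "times_cont_diff k (\<lambda>x. (\<integral>t. f t *\<^sub>R grad K (x - t) \<partial>lborel) $ i)" by simp
  qed
qed

text \<open>Translation invariance makes the integral of every difference quotient vanish, and the
  quotients converge to h \<bullet> G. Dominated convergence applies because the quotients are at
  most B |h| and, for steps at most 1, vanish off the ball of radius R + |h|.\<close>

lemma integral_gradient_zero:
  assumes f: "C1_grad f G" "compact S" "\<And>x. x \<notin> S \<Longrightarrow> f x = 0"
  shows "(\<integral>x. G x \<partial>lborel) = 0"
proof -
  note bs = C1_grad_cont_bdd_supp[OF f]
  have iG: "integrable lborel G" by (rule cont_bdd_supp_integrable[OF bs(2)])
  have if': "integrable lborel f" by (rule cont_bdd_supp_integrable[OF bs(1)])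
  obtain B where B: "B > 0" "\<And>x. norm (G x) \<le> B" using cont_bdd_supp_bounded[OF bs(2)] by blast
  obtain R where R: "\<And>x. norm x > R \<Longrightarrow> f x = 0" using cont_bdd_suppE[OF bs(1)] by metis
  have [measurable]: "f \<in> borel_measurable borel" "G \<in> borel_measurable borel"
    using bs(1,2) cont_bdd_supp_measurable by auto
  have "h \<bullet> (\<integral>x. G x \<partial>lborel) = 0" for h
  proof -
    define t where "t j = inverse (real (Suc j))" for j
    have t: "t j > 0" "t j \<le> 1" for j by (auto simp: t_def divide_simps)
    have t0: "t \<longlonglongrightarrow> 0" unfolding t_def by (rule LIMSEQ_inverse_real_of_nat)
    let ?q = "\<lambda>j x. (f (x + t j *\<^sub>R h) - f x) / t j"
    have "(\<lambda>j. \<integral>x. ?q j x \<partial>lborel) \<longlonglongrightarrow> (\<integral>x. h \<bullet> G x \<partial>lborel)"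
    proof (rule integral_dominated_convergence)
      have "emeasure lborel (cball 0 (R + norm h) :: (real^'a) set) < \<infinity>"
        by (rule emeasure_bounded_finite) simp
      then show "integrable lborel (\<lambda>x. B * norm h * indicator (cball 0 (R + norm h) :: (real^'a) set) x)"
        by (intro integrable_mult_right integrable_real_indicator) auto
      show "AE x in lborel. (\<lambda>j. ?q j x) \<longlonglongrightarrow> h \<bullet> G x"
      proof (rule AE_I2)
        fix x
        have "(f has_derivative (\<lambda>h. h \<bullet> G x)) (at (x + 0 *\<^sub>R h))"
          using f(1) by (simp add: C1_grad_def)
        moreover have "((\<lambda>s. x + s *\<^sub>R h) has_derivative (\<lambda>s. s *\<^sub>R h)) (at 0)"
          by (auto intro!: derivative_eq_intros)
        ultimately have "((\<lambda>s. f (x + s *\<^sub>R h)) has_derivative (\<lambda>s. (s *\<^sub>R h) \<bullet> G x)) (at 0)"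
          using has_derivative_compose[of "\<lambda>s. x + s *\<^sub>R h" "\<lambda>s. s *\<^sub>R h" 0 UNIV f] by blast
        then have "((\<lambda>s. f (x + s *\<^sub>R h)) has_real_derivative (h \<bullet> G x)) (at 0)"
          unfolding has_field_derivative_def by (rule has_derivative_eq_rhs) auto
        then have "((\<lambda>s. (f (x + s *\<^sub>R h) - f x) / s) \<longlongrightarrow> h \<bullet> G x) (at 0)"
          by (simp add: has_field_derivative_iff)
        moreover have "filterlim t (at 0) sequentially"
          using t0 t(1) by (auto simp: filterlim_at intro!: always_eventually) (metis less_irrefl)
        ultimately show "(\<lambda>j. ?q j x) \<longlonglongrightarrow> h \<bullet> G x"
          by (rule filterlim_compose)
      qed
      show "AE x in lborel. norm (?q j x) \<le> B * norm h * indicator (cball 0 (R + norm h)) x" for j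
      proof (rule AE_I2)
        fix x
        have "\<bar>f (x + t j *\<^sub>R h) - f x\<bar> \<le> B * norm ((x + t j *\<^sub>R h) - x)"
          using f(1) B(2) by (intro C1_grad_lipschitz[where G=G and S=UNIV]) (auto simp: C1_grad_def)
        then have 1: "norm (?q j x) \<le> B * norm h"
          using t(1)[of j] by (simp add: divide_le_eq mult_ac)
        have 2: "?q j x = 0" if "norm x > R + norm h"
        proof -
          have "norm (t j *\<^sub>R h) \<le> norm h" using t[of j] by (simp add: mult_left_le_one_le)
          then have "norm (x + t j *\<^sub>R h) > R" "norm x > R"
            using that norm_diff_ineq[of x "t j *\<^sub>R h"] norm_ge_zero[of h] by linarith+
          then show ?thesis by (simp add: R)
        qed
        show "norm (?q j x) \<le> B * norm h * indicator (cball 0 (R + norm h)) x"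
          using 1 2 by (auto simp: indicator_def)
      qed
    qed measurable
    moreover have "(\<integral>x. ?q j x \<partial>lborel) = 0" for j
      using integral_lborel_shift[OF if', of "- (t j *\<^sub>R h)"] integrable_lborel_shift[OF if', of "- (t j *\<^sub>R h)"] if'
      by simp
    ultimately have "(\<lambda>j::nat. 0) \<longlonglongrightarrow> (\<integral>x. h \<bullet> G x \<partial>lborel)"
      by (simp only:)
    then have "(\<integral>x. h \<bullet> G x \<partial>lborel) = 0" using LIMSEQ_const_iff by metis
    then show ?thesis using integral_inner_right[of h lborel G] iG by simp
  qed
  from this[of "\<integral>x. G x \<partial>lborel"] show ?thesis by simp
qed

lemma C1_grad_mult:
  assumes "C1_grad f F" "C1_grad g G"
  shows "C1_grad (\<lambda>x. f x * g x) (\<lambda>x. f x *\<^sub>R G x + g x *\<^sub>R F x)"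
  unfolding C1_grad_def
proof (intro conjI allI)
  fix x
  have "(f has_derivative (\<lambda>h. h \<bullet> F x)) (at x)" "(g has_derivative (\<lambda>h. h \<bullet> G x)) (at x)"
    using assms by (auto simp: C1_grad_def)
  from has_derivative_mult[OF this]
  show "((\<lambda>x. f x * g x) has_derivative (\<lambda>h. h \<bullet> (f x *\<^sub>R G x + g x *\<^sub>R F x))) (at x)"
    by (rule has_derivative_eq_rhs) (auto simp: inner_add_right algebra_simps)
  show "continuous_on UNIV (\<lambda>x. f x *\<^sub>R G x + g x *\<^sub>R F x)"
    using assms C1_grad_continuous[OF assms(1)] C1_grad_continuous[OF assms(2)]
    by (auto simp: C1_grad_def intro!: continuous_intros)
qed

lemma C1_grad_add:
  assumes "C1_grad f F" "C1_grad g G"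
  shows "C1_grad (\<lambda>x. f x + g x) (\<lambda>x. F x + G x)"
  using assms unfolding C1_grad_def inner_add_right
  by (auto intro!: has_derivative_add continuous_intros)

lemma C1_grad_diff:
  assumes "C1_grad f F" "C1_grad g G"
  shows "C1_grad (\<lambda>x. f x - g x) (\<lambda>x. F x - G x)"
  using assms unfolding C1_grad_def inner_diff_right
  by (auto intro!: has_derivative_diff continuous_intros)

lemma C1_grad_affine:
  assumes "C1_grad f F"
  shows "C1_grad (\<lambda>x. f (c *\<^sub>R x + v)) (\<lambda>x. c *\<^sub>R F (c *\<^sub>R x + v))"
  unfolding C1_grad_def
proof (intro conjI allI)
  show "((\<lambda>x. f (c *\<^sub>R x + v)) has_derivative (\<lambda>h. h \<bullet> (c *\<^sub>R F (c *\<^sub>R x + v)))) (at x)" for x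
    by (rule has_derivative_affine_comp) (use assms in \<open>simp add: C1_grad_def\<close>)
  show "continuous_on UNIV (\<lambda>x. c *\<^sub>R F (c *\<^sub>R x + v))"
    using assms unfolding C1_grad_def
    by (auto intro!: continuous_on_compose2[of UNIV F] continuous_intros)
qed

lemma C1_grad_compose_real:
  assumes "\<And>s. (T has_real_derivative T' s) (at s)" "continuous_on UNIV T'" "C1_grad f F"
  shows "C1_grad (\<lambda>x. T (f x)) (\<lambda>x. T' (f x) *\<^sub>R F x)"
  unfolding C1_grad_def
proof (intro conjI allI)
  fix x
  have "(f has_derivative (\<lambda>h. h \<bullet> F x)) (at x)" using assms(3) by (auto simp: C1_grad_def)
  from has_derivative_compose[OF this assms(1)[unfolded has_field_derivative_def]]
  show "((\<lambda>x. T (f x)) has_derivative (\<lambda>h. h \<bullet> (T' (f x) *\<^sub>R F x))) (at x)"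
    by (rule has_derivative_eq_rhs) auto
  show "continuous_on UNIV (\<lambda>x. T' (f x) *\<^sub>R F x)"
    using assms(3) C1_grad_continuous[OF assms(3)] continuous_on_compose2[OF assms(2), of UNIV f]
    by (auto simp: C1_grad_def intro!: continuous_intros)
qed

lemma integral_by_parts_C1:
  assumes f: "C1_grad f F" "compact S" "\<And>x. x \<notin> S \<Longrightarrow> f x = 0" and g: "C1_grad g G"
  shows "integrable lborel (\<lambda>x. f x *\<^sub>R G x)" "integrable lborel (\<lambda>x. g x *\<^sub>R F x)"
    "(\<integral>x. f x *\<^sub>R G x \<partial>lborel) = - (\<integral>x. g x *\<^sub>R F x \<partial>lborel)"
proof -
  note bs = C1_grad_cont_bdd_supp[OF f]
  have c: "continuous_on UNIV f" "continuous_on UNIV g" "continuous_on UNIV F" "continuous_on UNIV G"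
    using C1_grad_continuous f(1) g by (auto simp: C1_grad_def)
  show i: "integrable lborel (\<lambda>x. f x *\<^sub>R G x)" "integrable lborel (\<lambda>x. g x *\<^sub>R F x)"
    using bs(3) f(3)
    by (auto intro!: cont_bdd_supp_integrable cont_bdd_supp_compactI[OF _ f(2)] continuous_intros c)
  have "(\<integral>x. f x *\<^sub>R G x + g x *\<^sub>R F x \<partial>lborel) = 0"
    by (rule integral_gradient_zero[OF C1_grad_mult[OF f(1) g] f(2)]) (simp add: f(3))
  then show "(\<integral>x. f x *\<^sub>R G x \<partial>lborel) = - (\<integral>x. g x *\<^sub>R F x \<partial>lborel)"
    using i by (simp add: eq_neg_iff_add_eq_0)
qed

subsection \<open>The standard mollifier\<close>

lemma null_sequence_below:
  fixes r :: real
  assumes "r > 0"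
  obtains d where "\<And>j. d j > 0" "\<And>j. d j \<le> r" "d \<longlonglongrightarrow> 0"
proof (rule that[of "\<lambda>j. r * inverse (real (Suc j))"])
  fix j
  have "inverse (real (Suc j)) \<le> 1" by (simp add: inverse_le_1_iff)
  then show "r * inverse (real (Suc j)) \<le> r"
    using mult_left_mono[of "inverse (real (Suc j))" 1 r] assms by simp
  show "(\<lambda>j. r * inverse (real (Suc j))) \<longlonglongrightarrow> 0"
    by (rule tendsto_mult_right_zero[OF LIMSEQ_inverse_real_of_nat])
qed (use assms in simp)

definition bump :: "real^'n::finite \<Rightarrow> real" where
  "bump x = flat 1 (1 - x \<bullet> x)"

lemma times_cont_diff_bump: "times_cont_diff k bump"
  unfolding bump_def[abs_def] by (rule times_cont_diff_flat_ball)

lemma bump_nonneg: "bump x \<ge> 0"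
  by (simp add: bump_def flat_1_nonneg)

lemma bump_zero: "norm x \<ge> 1 \<Longrightarrow> bump x = 0"
  using power_mono[of 1 "norm x" 2] by (simp add: bump_def flat_def dot_square_norm)

lemma bump_pos: "norm x < 1 \<Longrightarrow> bump x > 0"
  using power_strict_mono[of "norm x" 1 2] by (simp add: bump_def flat_1_pos dot_square_norm)

lemma bump_cont_bdd_supp: "cont_bdd_supp (bump :: real^'n::finite \<Rightarrow> real)"
    "cont_bdd_supp (grad bump :: real^'n::finite \<Rightarrow> _)"
proof -
  have "C1_grad (bump :: real^'n \<Rightarrow> real) (grad bump)"
    by (rule times_cont_diff_C1_grad[OF times_cont_diff_bump])
  from C1_grad_cont_bdd_supp[OF this, of "cball 0 1"]
  show "cont_bdd_supp (bump :: real^'n::finite \<Rightarrow> real)"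
    "cont_bdd_supp (grad bump :: real^'n::finite \<Rightarrow> _)"
    by (auto simp: bump_zero)
qed

lemma integral_bump_pos: "(\<integral>x. bump (x :: real^'n::finite) \<partial>lborel) > 0"
proof -
  have i: "integrable lborel (bump :: real^'n \<Rightarrow> real)"
    by (rule cont_bdd_supp_integrable[OF bump_cont_bdd_supp(1)])
  have "(\<integral>x. bump (x :: real^'n) \<partial>lborel) \<noteq> 0"
  proof
    assume "(\<integral>x. bump (x :: real^'n) \<partial>lborel) = 0"
    then have "AE x in lborel. bump (x :: real^'n) = 0"
      using integral_nonneg_eq_0_iff_AE[OF i] bump_nonneg by auto
    then have ae: "AE x in lborel. x \<notin> ball (0 :: real^'n) 1"
      by (rule AE_mp) (use bump_pos in \<open>force intro!: AE_I2\<close>)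
    have "ball (0 :: real^'n) 1 \<in> null_sets lborel"
      using AE_iff_null_sets[of "ball (0 :: real^'n) 1" lborel] ae by simp
    then show False
      using content_ball_pos[of 1 "0 :: real^'n"] by (auto simp: null_sets_def measure_def)
  qed
  moreover have "(\<integral>x. bump (x :: real^'n) \<partial>lborel) \<ge> 0" by (simp add: bump_nonneg)
  ultimately show ?thesis by linarith
qed

text \<open>A bump of mass 1 supported in the closed ball of radius d around d v: shift and radius
  shrink at the same rate.\<close>

definition mollifier :: "real^'n::finite \<Rightarrow> real \<Rightarrow> real^'n \<Rightarrow> real" where
  "mollifier v d z = 1 / (d ^ CARD('n) * (\<integral>x. bump (x :: real^'n) \<partial>lborel)) * bump ((1 / d) *\<^sub>R z + - v)"

text \<open>The L^1 norm of the gradient of the mollifier of radius 1; at radius d it is divided by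
  d.\<close>

definition bump_variation :: "'n::finite itself \<Rightarrow> real" where
  "bump_variation _ = (\<integral>x. norm (grad bump (x :: real^'n)) \<partial>lborel) / (\<integral>x. bump (x :: real^'n) \<partial>lborel)"

lemma bump_variation_nonneg: "bump_variation TYPE('n::finite) \<ge> 0"
  unfolding bump_variation_def using integral_bump_pos[where 'n='n] by (auto intro!: divide_nonneg_pos)

lemma times_cont_diff_mollifier: "times_cont_diff k (mollifier v d)"
  unfolding mollifier_def[abs_def]
  by (intro times_cont_diff_mult times_cont_diff_const times_cont_diff_affine times_cont_diff_bump)

lemma mollifier_C1_grad: "C1_grad (mollifier v d) (grad (mollifier v d))"
  by (rule times_cont_diff_C1_grad[OF times_cont_diff_mollifier])

lemma mollifier_nonneg: "d > 0 \<Longrightarrow> mollifier v d z \<ge> 0"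
  unfolding mollifier_def using integral_bump_pos[where 'n='a]
  by (intro mult_nonneg_nonneg) (auto simp: bump_nonneg)

lemma mollifier_supp:
  assumes "d > 0" "z \<notin> cball (d *\<^sub>R v) d"
  shows "mollifier v d z = 0"
proof -
  have "d < norm (z - d *\<^sub>R v)" using assms by (simp add: dist_norm norm_minus_commute)
  moreover have "norm ((1 / d) *\<^sub>R z + - v) = norm (z - d *\<^sub>R v) / d"
  proof -
    have "(1 / d) *\<^sub>R z + - v = (1 / d) *\<^sub>R (z - d *\<^sub>R v)"
      using assms by (simp add: algebra_simps)
    then show ?thesis using assms by (simp add: norm_scaleR)
  qed
  ultimately have "norm ((1 / d) *\<^sub>R z + - v) \<ge> 1" using assms by simp
  then show ?thesis by (simp add: mollifier_def bump_zero)
qed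

lemma mollifier_cont_bdd_supp:
  assumes "d > 0"
  shows "cont_bdd_supp (mollifier v d)" "cont_bdd_supp (grad (mollifier v d))"
  using C1_grad_cont_bdd_supp(1,2)[OF mollifier_C1_grad compact_cball mollifier_supp[OF assms]] by auto

lemma mollifier_unit_kernel:
  fixes v :: "real^'n::finite"
  assumes d: "d > 0"
  shows "unit_kernel (mollifier v d)"
proof -
  have "(\<integral>x. bump (x :: real^'n) \<partial>lborel) = \<bar>1 / d\<bar> ^ DIM(real^'n) *\<^sub>R (\<integral>x. bump (- v + (1 / d) *\<^sub>R x) \<partial>lborel)"
    using d by (intro integral_lborel_affine cont_bdd_supp_integrable bump_cont_bdd_supp) simp
  then have "(\<integral>x. bump (- v + (1 / d) *\<^sub>R x) \<partial>lborel) = d ^ CARD('n) * (\<integral>x. bump (x :: real^'n) \<partial>lborel)"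
    using d by (simp add: field_simps power_one_over)
  then have "(\<integral>z. mollifier v d z \<partial>lborel) = 1"
    using d integral_bump_pos[where 'n='n] by (simp add: mollifier_def)
  then show ?thesis
    using mollifier_cont_bdd_supp(1)[OF d, of v] mollifier_nonneg[OF d, of v] by (simp add: unit_kernel_def)
qed

lemma grad_mollifier:
  fixes v :: "real^'n::finite"
  shows "grad (mollifier v d) z = (1 / (d ^ CARD('n) * (\<integral>x. bump (x :: real^'n) \<partial>lborel))) *\<^sub>R
     ((1 / d) *\<^sub>R grad bump ((1 / d) *\<^sub>R z + - v))"
proof (rule grad_eq)
  have "((\<lambda>z. bump ((1 / d) *\<^sub>R z + - v)) has_derivative (\<lambda>h. h \<bullet> ((1 / d) *\<^sub>R grad bump ((1 / d) *\<^sub>R z + - v)))) (at z)"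
    by (rule has_derivative_affine_comp[OF times_cont_diff_Suc_derivative[OF times_cont_diff_bump]])
  from has_derivative_mult_right[OF this, of "1 / (d ^ CARD('n) * (\<integral>x. bump (x :: real^'n) \<partial>lborel))"]
  show "(mollifier v d has_derivative (\<lambda>h. h \<bullet> ((1 / (d ^ CARD('n) * (\<integral>x. bump (x :: real^'n) \<partial>lborel))) *\<^sub>R
     ((1 / d) *\<^sub>R grad bump ((1 / d) *\<^sub>R z + - v))))) (at z)"
    unfolding mollifier_def[abs_def] by (rule has_derivative_eq_rhs) auto
qed

lemma integral_norm_grad_mollifier:
  fixes v :: "real^'n::finite"
  assumes d: "d > 0"
  shows "(\<integral>z. norm (grad (mollifier v d) z) \<partial>lborel) = bump_variation TYPE('n) / d"
proof -
  have "(\<integral>x. norm (grad bump (x :: real^'n)) \<partial>lborel) =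
      \<bar>1 / d\<bar> ^ DIM(real^'n) *\<^sub>R (\<integral>x. norm (grad bump (- v + (1 / d) *\<^sub>R x)) \<partial>lborel)"
    using d by (intro integral_lborel_affine integrable_norm cont_bdd_supp_integrable bump_cont_bdd_supp) simp
  then show ?thesis
    using d integral_bump_pos[where 'n='n]
    by (simp add: grad_mollifier bump_variation_def field_simps power_one_over)
qed

section \<open>Weak gradients and functions of zero trace\<close>

lemma borel_measurable_vec_component [measurable (raw)]:
  fixes f :: "'a \<Rightarrow> real^'n::finite"
  assumes "f \<in> borel_measurable M"
  shows "(\<lambda>x. f x $ i) \<in> borel_measurable M"
  by (rule measurable_compose[OF assms]) (intro borel_measurable_continuous_onI continuous_intros)

lemma AE_lebesgue_on_iff:
  fixes \<Omega> :: "'a::euclidean_space set"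
  assumes "\<Omega> \<in> sets borel"
  shows "(AE x in lebesgue_on \<Omega>. P x) \<longleftrightarrow> (AE x in lborel. x \<in> \<Omega> \<longrightarrow> P x)"
  using assms by (simp add: AE_restrict_space_iff AE_completion_iff)

text \<open>The notions of the theorem live on Lebesgue-measurable functions on \<Omega>, whereas
  convolution and Fubini are carried out with Borel functions on the whole space. These two facts
  translate between the settings.\<close>

lemma
  fixes f f' :: "'a::euclidean_space \<Rightarrow> 'b::euclidean_space"
  assumes \<Omega>: "\<Omega> \<in> sets borel" and f': "f' \<in> borel_measurable borel"
    and ae: "AE x in lborel. x \<in> \<Omega> \<longrightarrow> f x = f' x" and out: "\<And>x. x \<notin> \<Omega> \<Longrightarrow> f' x = 0"
  shows integrable_lebesgue_on_iff_lborel: "integrable (lebesgue_on \<Omega>) f \<longleftrightarrow> integrable lborel f'"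
    and integral_lebesgue_on_eq_lborel: "(\<integral>x. f x \<partial>lebesgue_on \<Omega>) = (\<integral>x. f' x \<partial>lborel)"
proof -
  let ?f = "\<lambda>x. indicator \<Omega> x *\<^sub>R f x"
  have \<Omega>': "\<Omega> \<inter> space lebesgue \<in> sets lebesgue" using \<Omega> by simp
  have "AE x in lborel. f' x = ?f x"
    using ae by eventually_elim (use out in \<open>auto simp: indicator_def\<close>)
  then have ae': "AE x in lebesgue. f' x = ?f x" by (rule AE_completion)
  have m': "f' \<in> borel_measurable lebesgue" using f' by (simp add: measurable_completion)
  have m: "?f \<in> borel_measurable lebesgue" by (rule borel_measurable_AE[OF m' ae'])
  show "integrable (lebesgue_on \<Omega>) f \<longleftrightarrow> integrable lborel f'"
    using integrable_cong_AE[OF m' m ae'] f'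
    by (simp add: integrable_restrict_space[OF \<Omega>'] integrable_completion)
  show "(\<integral>x. f x \<partial>lebesgue_on \<Omega>) = (\<integral>x. f' x \<partial>lborel)"
    using integral_cong_AE[OF m' m ae'] f'
    by (simp add: integral_restrict_space[OF \<Omega>'] integral_completion)
qed

lemma integral_lebesgue_on_zero_outside:
  fixes f :: "'a::euclidean_space \<Rightarrow> 'b::euclidean_space"
  assumes \<Omega>: "\<Omega> \<in> sets borel" and f: "f \<in> borel_measurable borel" and out: "\<And>x. x \<notin> \<Omega> \<Longrightarrow> f x = 0"
  shows "(\<integral>x. f x \<partial>lebesgue_on \<Omega>) = (\<integral>x. f x \<partial>lborel)"
  using integral_lebesgue_on_eq_lborel[OF \<Omega> f _ out, of f] by auto

text \<open>Real functions measurable for the completion have Borel representatives; applying this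
  to the finitely many coordinates costs a finite union of null sets.\<close>

lemma borel_representative:
  fixes f :: "real^'m::finite \<Rightarrow> 'b::euclidean_space"
  assumes \<Omega>: "\<Omega> \<in> sets borel" and f: "integrable (lebesgue_on \<Omega>) f"
  obtains f' where "integrable lborel f'" "\<And>x. x \<notin> \<Omega> \<Longrightarrow> f' x = 0"
    "AE x in lborel. x \<in> \<Omega> \<longrightarrow> f x = f' x"
proof -
  have \<Omega>': "\<Omega> \<inter> space lebesgue \<in> sets lebesgue" using \<Omega> by simp
  let ?f = "\<lambda>x. indicator \<Omega> x *\<^sub>R f x"
  have m: "?f \<in> borel_measurable lebesgue"
    using f \<Omega>' by (simp add: integrable_restrict_space borel_measurable_integrable)
  have "\<exists>h\<in>borel_measurable lborel. AE x in lborel. ?f x \<bullet> b = h x" for b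
    by (rule completion_ex_borel_measurable_real) (use m in measurable)
  then obtain h where h: "\<And>b. h b \<in> borel_measurable lborel"
    "\<And>b. AE x in lborel. ?f x \<bullet> b = h b x" by metis
  define f' where "f' x = indicator \<Omega> x *\<^sub>R (\<Sum>b\<in>Basis. h b x *\<^sub>R b)" for x
  have "AE x in lborel. \<forall>b\<in>Basis. ?f x \<bullet> b = h b x"
    by (rule AE_finite_allI) (use h(2) in auto)
  then have ae: "AE x in lborel. x \<in> \<Omega> \<longrightarrow> f x = f' x"
  proof eventually_elim
    case (elim x)
    have "x \<in> \<Omega> \<Longrightarrow> (\<Sum>b\<in>Basis. h b x *\<^sub>R b) = (\<Sum>b\<in>Basis. (f x \<bullet> b) *\<^sub>R b)"
      using elim by (intro sum.cong) auto
    then show ?case by (simp add: f'_def euclidean_representation)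
  qed
  have m': "f' \<in> borel_measurable borel"
    unfolding f'_def[abs_def] using h(1) \<Omega> by measurable
  have out: "f' x = 0" if "x \<notin> \<Omega>" for x using that by (simp add: f'_def)
  have "integrable lborel f'"
    using integrable_lebesgue_on_iff_lborel[OF \<Omega> m' ae out] f by blast
  from that[OF this out ae] show ?thesis .
qed

lemma locally_integrable_mult:
  fixes f :: "real^'n::finite \<Rightarrow> 'b::euclidean_space" and w :: "real^'n \<Rightarrow> real"
  assumes \<Omega>: "\<Omega> \<in> sets borel" and f: "locally_integrable \<Omega> f"
    and w: "continuous_on UNIV w" "compact S" "S \<subseteq> \<Omega>" "\<And>x. x \<notin> S \<Longrightarrow> w x = 0"
  shows "integrable (lebesgue_on \<Omega>) (\<lambda>x. w x *\<^sub>R f x)"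
    "\<exists>f'. integrable lborel f' \<and> (\<forall>x. x \<notin> S \<longrightarrow> f' x = 0) \<and> (AE x in lborel. x \<in> S \<longrightarrow> f x = f' x) \<and>
       (\<integral>x. w x *\<^sub>R f x \<partial>lebesgue_on \<Omega>) = (\<integral>x. w x *\<^sub>R f' x \<partial>lborel)"
proof -
  have S: "S \<in> sets borel" using w(2) by (simp add: borel_compact)
  have "integrable (lebesgue_on S) f" using f w(2,3) by (auto simp: locally_integrable_def)
  then obtain f' where
    f': "integrable lborel f'" "\<And>x. x \<notin> S \<Longrightarrow> f' x = 0" "AE x in lborel. x \<in> S \<longrightarrow> f x = f' x"
    using borel_representative[OF S] by blast
  have wb: "cont_bdd_supp w" using cont_bdd_supp_compactI w by blast
  obtain M where M: "\<And>x. norm (w x) \<le> M" using cont_bdd_supp_bounded[OF wb] by blast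
  have [measurable]: "f' \<in> borel_measurable borel" "w \<in> borel_measurable borel"
    using f'(1) cont_bdd_supp_measurable[OF wb] by auto
  have i: "integrable lborel (\<lambda>x. w x *\<^sub>R f' x)"
  proof (rule Bochner_Integration.integrable_bound)
    show "integrable lborel (\<lambda>y. M *\<^sub>R f' y)" using f'(1) by simp
    show "AE y in lborel. norm (w y *\<^sub>R f' y) \<le> norm (M *\<^sub>R f' y)"
    proof (rule AE_I2)
      fix y show "norm (w y *\<^sub>R f' y) \<le> norm (M *\<^sub>R f' y)"
        using M[of y] by (auto intro!: mult_right_mono)
    qed
  qed measurable
  have ae: "AE x in lborel. x \<in> \<Omega> \<longrightarrow> w x *\<^sub>R f x = w x *\<^sub>R f' x"
    using f'(3) by eventually_elim (use w(4) in force)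
  have z: "w x *\<^sub>R f' x = 0" if "x \<notin> \<Omega>" for x using w(3,4) that by auto
  have m: "(\<lambda>x. w x *\<^sub>R f' x) \<in> borel_measurable borel" by measurable
  show "integrable (lebesgue_on \<Omega>) (\<lambda>x. w x *\<^sub>R f x)"
    using integrable_lebesgue_on_iff_lborel[OF \<Omega> m ae z] i by blast
  show "\<exists>f'. integrable lborel f' \<and> (\<forall>x. x \<notin> S \<longrightarrow> f' x = 0) \<and> (AE x in lborel. x \<in> S \<longrightarrow> f x = f' x) \<and>
       (\<integral>x. w x *\<^sub>R f x \<partial>lebesgue_on \<Omega>) = (\<integral>x. w x *\<^sub>R f' x \<partial>lborel)"
    using f' integral_lebesgue_on_eq_lborel[OF \<Omega> m ae z] by blast
qed

lemma locally_integrable_component: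
  "locally_integrable \<Omega> (g :: real^'n::finite \<Rightarrow> real^'m::finite) \<Longrightarrow> locally_integrable \<Omega> (\<lambda>x. g x $ i)"
  unfolding locally_integrable_def
  by (auto intro: integrable_bounded_linear[OF bounded_linear_vec_nth])

lemma integrable_lebesgue_onI:
  fixes f :: "'a::euclidean_space \<Rightarrow> 'b::euclidean_space"
  assumes "\<Omega> \<in> sets borel" "integrable lborel f"
  shows "integrable (lebesgue_on \<Omega>) f"
proof -
  have "integrable lebesgue f" using assms(2) by (simp add: integrable_completion borel_measurable_integrable)
  then show ?thesis using assms(1) by (simp add: integrable_restrict_space integrable_mult_indicator)
qed

lemma integrable_lborel_locally_integrable:
  fixes f :: "real^'n::finite \<Rightarrow> 'b::euclidean_space"
  shows "integrable lborel f \<Longrightarrow> locally_integrable \<Omega> f"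
  unfolding locally_integrable_def by (auto intro: integrable_lebesgue_onI borel_compact)

lemma continuous_locally_integrable:
  fixes f :: "real^'n::finite \<Rightarrow> 'b::euclidean_space"
  assumes "continuous_on UNIV f"
  shows "locally_integrable \<Omega> f"
  unfolding locally_integrable_def
proof (intro allI impI)
  fix K assume "compact K \<and> K \<subseteq> \<Omega>"
  then have K: "compact K" "K \<in> sets borel" by (auto simp: borel_compact)
  have "integrable lborel (\<lambda>x. indicator K x *\<^sub>R f x)"
    by (rule borel_integrable_compact[OF K(1) continuous_on_subset[OF assms]]) simp
  from integrable_lebesgue_onI[OF K(2) this]
  show "integrable (lebesgue_on K) f"
    by (rule Bochner_Integration.integrable_cong[THEN iffD1, rotated -1]) (auto simp: indicator_def)
qed

section \<open>The fundamental lemma and uniqueness of weak gradients\<close>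

lemma L1_limit_zero_AE:
  fixes f :: "'a::euclidean_space \<Rightarrow> 'b::{banach, second_countable_topology}"
  assumes f: "integrable lborel f" and g: "\<And>j. integrable lborel (g j)"
    and lim: "(\<lambda>j::nat. \<integral>x. norm (g j x - f x) \<partial>lborel) \<longlonglongrightarrow> 0"
    and z: "\<And>j x. x \<in> A \<Longrightarrow> g j x = 0" and A: "A \<in> sets borel"
  shows "AE x in lborel. x \<in> A \<longrightarrow> f x = 0"
proof -
  have i: "integrable lborel (\<lambda>x. indicator A x * norm (f x))"
    using integrable_mult_indicator[of A lborel "\<lambda>x. norm (f x)"] A f by simp
  have "(\<integral>x. indicator A x * norm (f x) \<partial>lborel) \<le> (\<integral>x. norm (g j x - f x) \<partial>lborel)" for j
    by (rule integral_mono[OF i]) (use f g z in \<open>auto simp: indicator_def\<close>)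
  then have "(\<integral>x. indicator A x * norm (f x) \<partial>lborel) \<le> 0"
    by (intro LIMSEQ_le_const[OF lim]) auto
  moreover have "(\<integral>x. indicator A x * norm (f x) \<partial>lborel) \<ge> 0"
    by (intro integral_nonneg_AE) auto
  ultimately have "(\<integral>x. indicator A x * norm (f x) \<partial>lborel) = 0" by linarith
  then have "AE x in lborel. indicator A x * norm (f x) = 0"
    using integral_nonneg_eq_0_iff_AE[OF i] by auto
  then show ?thesis by eventually_elim (auto simp: indicator_def split: if_splits)
qed

text \<open>The balls are uncountably many, so their exceptional sets cannot simply be united;
  negligibility, however, is a local property.\<close>

lemma AE_locally:
  fixes \<Omega> :: "'a::euclidean_space set"
  assumes "\<And>z. z \<in> \<Omega> \<Longrightarrow> \<exists>r>0. AE x in lborel. x \<in> ball z r \<longrightarrow> P x"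
  shows "AE x in lborel. x \<in> \<Omega> \<longrightarrow> P x"
proof -
  let ?N = "{x \<in> \<Omega>. \<not> P x}"
  have "negligible ?N"
    unfolding locally_negligible_alt[of ?N]
  proof
    fix z assume z: "z \<in> ?N"
    then obtain r where r: "r > 0" "AE x in lborel. x \<in> ball z r \<longrightarrow> P x" using assms by blast
    have "AE x in lebesgue. x \<notin> ?N \<inter> ball z r"
      using AE_completion[OF r(2)] by eventually_elim auto
    then obtain N where N: "N \<in> null_sets lebesgue" "\<And>x. x \<notin> N \<Longrightarrow> x \<notin> ?N \<inter> ball z r"
      unfolding completion.AE_iff_null_sets by auto
    have "?N \<inter> ball z r \<subseteq> N" using N(2) by blast
    moreover have "negligible N" using N(1) by (simp add: negligible_iff_null_sets)
    ultimately have "negligible (?N \<inter> ball z r)" using negligible_subset by blast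
    then show "\<exists>U. openin (top_of_set ?N) U \<and> z \<in> U \<and> negligible U"
      using r(1) z by (intro exI[of _ "?N \<inter> ball z r"]) auto
  qed
  then have "AE x in lebesgue. x \<notin> ?N"
    unfolding negligible_iff_null_sets by (rule AE_not_in)
  then have "AE x in lborel. x \<notin> ?N" by (simp only: AE_completion_iff)
  then show ?thesis by eventually_elim blast
qed

text \<open>The value at x of the mollification of g is the pairing of g with the test function y
  \<mapsto> K(x - y), hence 0, while the mollifications converge in L^1. This works near a point z,
  where g is replaced by an integrable Borel function.\<close>

lemma weak_gradient_zero:
  fixes g :: "real^'n::finite \<Rightarrow> real^'n"
  assumes \<Omega>: "open \<Omega>" and g: "locally_integrable \<Omega> g"
    and z: "\<And>\<phi> i. \<phi> \<in> test_functions \<Omega> \<Longrightarrow> (\<integral>x. g x $ i * \<phi> x \<partial>lebesgue_on \<Omega>) = 0"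
  shows "AE x in lborel. x \<in> \<Omega> \<longrightarrow> g x = 0"
proof (rule AE_locally)
  fix z assume "z \<in> \<Omega>"
  then obtain r0 where r0: "r0 > 0" "cball z r0 \<subseteq> \<Omega>" using \<Omega> open_contains_cball by blast
  \<comment> \<open>Mollification at points of \<open>ball z r\<close> with radius at most r sees
    only \<open>cball z (2 * r)\<close>, which still lies in \<Omega>.\<close>
  define r where "r = r0 / 2"
  have r: "r > 0" "cball z (2 * r) \<subseteq> \<Omega>" using r0 by (auto simp: r_def)
  let ?S = "cball z (2 * r)"
  have S: "?S \<in> sets borel" by simp
  have "integrable (lebesgue_on ?S) g" using g r(2) by (auto simp: locally_integrable_def)
  then obtain f where
    f: "integrable lborel f" "\<And>x. x \<notin> ?S \<Longrightarrow> f x = 0" "AE x in lborel. x \<in> ?S \<longrightarrow> g x = f x"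
    using borel_representative[OF S] by blast
  obtain d where d: "\<And>j. d j > 0" "\<And>j. d j \<le> r" and d0: "d \<longlonglongrightarrow> 0"
    using null_sequence_below[OF r(1)] by blast
  let ?K = "\<lambda>j. mollifier (0 :: real^'n) (d j)"
  have "AE x in lborel. x \<in> ball z r \<longrightarrow> f x = 0"
  proof (rule L1_limit_zero_AE[OF f(1)])
    show "integrable lborel (conv (?K j) f)" for j
      by (rule conv_integrable[OF mollifier_unit_kernel[OF d(1)] f(1)])
    show "(\<lambda>j. \<integral>x. norm (conv (?K j) f x - f x) \<partial>lborel) \<longlonglongrightarrow> 0"
    proof (rule conv_L1_tendsto[OF mollifier_unit_kernel[OF d(1)] _ d0 f(1)])
      show "norm z \<le> d j" if "?K j z \<noteq> 0" for j z
        using mollifier_supp[OF d(1), of z j 0] that by (force simp: dist_norm)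
    qed
    show "conv (?K j) f x = 0" if x: "x \<in> ball z r" for j x
    proof -
      let ?\<phi> = "\<lambda>y. ?K j (x - y)"
      have \<phi>z: "?\<phi> y = 0" if "y \<notin> cball x (d j)" for y
        using mollifier_supp[OF d(1), of "x - y" j 0] that by (auto simp: dist_norm norm_minus_commute)
      have sub: "cball x (d j) \<subseteq> ?S"
      proof
        fix y assume "y \<in> cball x (d j)"
        then have "dist z y \<le> r + r" using dist_triangle[of z y x] x d(2)[of j] by auto
        then show "y \<in> ?S" by simp
      qed
      have "times_cont_diff k ?\<phi>" for k
        using times_cont_diff_affine[OF times_cont_diff_mollifier, of k 0 "d j" "-1" x] by simp
      then have test: "?\<phi> \<in> test_functions \<Omega>"
        by (rule test_functionsI[of _ "cball x (d j)"]) (use \<phi>z sub r(2) in auto)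
      have cont: "continuous_on UNIV ?\<phi>"
        using times_cont_diff_continuous[OF \<open>times_cont_diff 0 ?\<phi>\<close>] .
      have i: "integrable lborel (\<lambda>y. ?\<phi> y *\<^sub>R f y)"
        by (rule conv_integrand_integrable[OF mollifier_cont_bdd_supp(1)[OF d(1)] f(1)])
      have "conv (?K j) f x $ i = 0" for i
      proof -
        have [measurable]: "f \<in> borel_measurable borel" using f(1) by simp
        have [measurable]: "?\<phi> \<in> borel_measurable borel"
          using cont borel_measurable_continuous_onI by blast
        have m: "(\<lambda>y. f y $ i * ?\<phi> y) \<in> borel_measurable borel" by measurable
        have ae: "AE y in lborel. y \<in> \<Omega> \<longrightarrow> g y $ i * ?\<phi> y = f y $ i * ?\<phi> y"
          using f(3) by eventually_elim (use \<phi>z sub in force)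
        have "conv (?K j) f x $ i = (\<integral>y. f y $ i * ?\<phi> y \<partial>lborel)"
          unfolding conv_def vec_nth_integral[OF i] by (simp add: mult.commute)
        also have "\<dots> = (\<integral>y. g y $ i * ?\<phi> y \<partial>lebesgue_on \<Omega>)"
        proof (rule integral_lebesgue_on_eq_lborel[symmetric, OF _ m ae])
          fix y assume "y \<notin> \<Omega>"
          then have "y \<notin> cball x (d j)" using sub r(2) by blast
          from \<phi>z[OF this] show "f y $ i * ?\<phi> y = 0" by simp
        qed (use \<Omega> in simp)
        also have "\<dots> = 0" by (rule z[OF test])
        finally show ?thesis .
      qed
      then show ?thesis by (simp add: vec_eq_iff)
    qed
  qed simp
  then have "AE x in lborel. x \<in> ball z r \<longrightarrow> g x = 0"
    using f(3) by eventually_elim (use r(1) in auto)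
  then show "\<exists>r>0. AE x in lborel. x \<in> ball z r \<longrightarrow> g x = 0" using r(1) by blast
qed

lemma test_function_C1:
  assumes "\<phi> \<in> test_functions \<Omega>"
  obtains S where "C1_grad \<phi> (grad \<phi>)" "compact S" "S \<subseteq> \<Omega>" "\<And>x. x \<notin> S \<Longrightarrow> \<phi> x = 0" "\<And>x. x \<notin> S \<Longrightarrow> grad \<phi> x = 0"
proof -
  obtain S where S: "\<And>k. times_cont_diff k \<phi>" "compact S" "S \<subseteq> \<Omega>" "\<And>x. x \<notin> S \<Longrightarrow> \<phi> x = 0"
    using test_functionsE[OF assms] by metis
  have "C1_grad \<phi> (grad \<phi>)" using S(1)[of "Suc 0"] times_cont_diff_C1_grad by blast
  then show ?thesis using that S C1_grad_cont_bdd_supp(3) by metis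
qed

lemma weak_gradient_integrands:
  fixes u :: "real^'n::finite \<Rightarrow> real"
  assumes \<Omega>: "open \<Omega>" and u: "has_weak_gradient \<Omega> u g" and \<phi>: "\<phi> \<in> test_functions \<Omega>"
  shows "integrable (lebesgue_on \<Omega>) (\<lambda>x. u x * partial_deriv i \<phi> x)"
    "integrable (lebesgue_on \<Omega>) (\<lambda>x. g x $ i * \<phi> x)"
proof -
  obtain S where S: "C1_grad \<phi> (grad \<phi>)" "compact S" "S \<subseteq> \<Omega>" "\<And>x. x \<notin> S \<Longrightarrow> \<phi> x = 0" "\<And>x. x \<notin> S \<Longrightarrow> grad \<phi> x = 0"
    using test_function_C1[OF \<phi>] by metis
  have c: "continuous_on UNIV \<phi>" "continuous_on UNIV (partial_deriv i \<phi>)"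
    using C1_grad_continuous[OF S(1)] S(1) C1_grad_partial[OF S(1), of i]
    by (auto simp: C1_grad_def intro!: continuous_intros)
  have \<Omega>': "\<Omega> \<in> sets borel" using \<Omega> by simp
  show "integrable (lebesgue_on \<Omega>) (\<lambda>x. u x * partial_deriv i \<phi> x)"
    using locally_integrable_mult(1)[OF \<Omega>' _ c(2) S(2,3), of u] S(5) u C1_grad_partial[OF S(1), of i]
    by (simp add: has_weak_gradient_def mult.commute)
  show "integrable (lebesgue_on \<Omega>) (\<lambda>x. g x $ i * \<phi> x)"
    using locally_integrable_mult(1)[OF \<Omega>' _ c(1) S(2,3,4), of "\<lambda>x. g x $ i"] u
      locally_integrable_component[of \<Omega> g i]
    by (simp add: has_weak_gradient_def mult.commute)
qed

lemma has_weak_gradient_add: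
  assumes \<Omega>: "open \<Omega>" and u: "has_weak_gradient \<Omega> u g" and v: "has_weak_gradient \<Omega> v h"
  shows "has_weak_gradient \<Omega> (\<lambda>x. u x + v x) (\<lambda>x. g x + h x)"
  unfolding has_weak_gradient_def
proof (intro conjI ballI allI)
  show "locally_integrable \<Omega> (\<lambda>x. u x + v x)" "locally_integrable \<Omega> (\<lambda>x. g x + h x)"
    using u v by (auto simp: has_weak_gradient_def locally_integrable_def)
  fix \<phi> i assume \<phi>: "\<phi> \<in> test_functions \<Omega>"
  show "(\<integral>x. (u x + v x) * partial_deriv i \<phi> x \<partial>lebesgue_on \<Omega>) =
       - (\<integral>x. (g x + h x) $ i * \<phi> x \<partial>lebesgue_on \<Omega>)"
    using weak_gradient_integrands[OF \<Omega> u \<phi>, of i] weak_gradient_integrands[OF \<Omega> v \<phi>, of i] u v \<phi>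
    by (simp add: has_weak_gradient_def distrib_right)
qed

lemma has_weak_gradient_minus:
  assumes u: "has_weak_gradient \<Omega> u g"
  shows "has_weak_gradient \<Omega> (\<lambda>x. - u x) (\<lambda>x. - g x)"
  using u by (auto simp: has_weak_gradient_def locally_integrable_def)

lemma has_weak_gradient_diff:
  assumes "open \<Omega>" "has_weak_gradient \<Omega> u g" "has_weak_gradient \<Omega> v h"
  shows "has_weak_gradient \<Omega> (\<lambda>x. u x - v x) (\<lambda>x. g x - h x)"
  using has_weak_gradient_add[OF assms(1,2) has_weak_gradient_minus[OF assms(3)]] by simp

lemma has_weak_gradient_unique:
  assumes \<Omega>: "open \<Omega>" and g: "has_weak_gradient \<Omega> u g" and h: "has_weak_gradient \<Omega> u h"
  shows "AE x in lborel. x \<in> \<Omega> \<longrightarrow> g x = h x"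
proof -
  have d: "has_weak_gradient \<Omega> (\<lambda>x. 0) (\<lambda>x. g x - h x)"
    using has_weak_gradient_diff[OF \<Omega> g h] by simp
  have "AE x in lborel. x \<in> \<Omega> \<longrightarrow> g x - h x = 0"
    by (rule weak_gradient_zero[OF \<Omega>]) (use d in \<open>auto simp: has_weak_gradient_def\<close>)
  then show ?thesis by simp
qed

lemma weak_gradient_AE_eq:
  assumes "open \<Omega>" "has_weak_gradient \<Omega> u g"
  shows "AE x in lborel. x \<in> \<Omega> \<longrightarrow> weak_gradient \<Omega> u x = g x"
  using has_weak_gradient_unique[OF assms(1) _ assms(2)] someI[of "has_weak_gradient \<Omega> u", OF assms(2)]
  unfolding weak_gradient_def by blast

lemma C1_grad_has_weak_gradient:
  assumes \<Omega>: "open \<Omega>" and f: "C1_grad f F"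
  shows "has_weak_gradient \<Omega> f F"
  unfolding has_weak_gradient_def
proof (intro conjI ballI allI)
  have c: "continuous_on UNIV f" "continuous_on UNIV F"
    using f C1_grad_continuous by (auto simp: C1_grad_def)
  then show "locally_integrable \<Omega> f" "locally_integrable \<Omega> F" by (auto intro: continuous_locally_integrable)
  fix \<phi> i assume "\<phi> \<in> test_functions \<Omega>"
  then obtain S where S: "C1_grad \<phi> (grad \<phi>)" "compact S" "S \<subseteq> \<Omega>" "\<And>x. x \<notin> S \<Longrightarrow> \<phi> x = 0" "\<And>x. x \<notin> S \<Longrightarrow> grad \<phi> x = 0"
    using test_function_C1 by metis
  note ibp = integral_by_parts_C1[OF S(1,2,4) f]
  have [measurable]: "f \<in> borel_measurable borel" "F \<in> borel_measurable borel"
    "\<phi> \<in> borel_measurable borel" "grad \<phi> \<in> borel_measurable borel"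
    using c S(1) C1_grad_continuous[OF S(1)] by (auto simp: C1_grad_def intro: borel_measurable_continuous_onI)
  have \<Omega>': "\<Omega> \<in> sets borel" using \<Omega> by simp
  have "(\<integral>x. f x * partial_deriv i \<phi> x \<partial>lebesgue_on \<Omega>) = (\<integral>x. f x * grad \<phi> x $ i \<partial>lborel)"
    unfolding C1_grad_partial[OF S(1)]
  proof (rule integral_lebesgue_on_zero_outside[OF \<Omega>'])
    show "(\<lambda>x. f x * grad \<phi> x $ i) \<in> borel_measurable borel" by measurable
    show "f x * grad \<phi> x $ i = 0" if "x \<notin> \<Omega>" for x
    proof -
      have "x \<notin> S" using S(3) that by blast
      then show ?thesis by (simp add: S(5))
    qed
  qed
  also have "\<dots> = (\<integral>x. f x *\<^sub>R grad \<phi> x \<partial>lborel) $ i"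
    using vec_nth_integral[OF ibp(2), of i] by simp
  also have "\<dots> = - (\<integral>x. \<phi> x *\<^sub>R F x \<partial>lborel) $ i" by (simp add: ibp(3))
  also have "\<dots> = - (\<integral>x. F x $ i * \<phi> x \<partial>lborel)"
    using vec_nth_integral[OF ibp(1), of i] by (simp add: mult.commute)
  also have "(\<integral>x. F x $ i * \<phi> x \<partial>lborel) = (\<integral>x. F x $ i * \<phi> x \<partial>lebesgue_on \<Omega>)"
  proof (rule integral_lebesgue_on_zero_outside[OF \<Omega>', symmetric])
    show "(\<lambda>x. F x $ i * \<phi> x) \<in> borel_measurable borel" by measurable
    show "F x $ i * \<phi> x = 0" if "x \<notin> \<Omega>" for x
    proof -
      have "x \<notin> S" using S(3) that by blast
      then show ?thesis by (simp add: S(4))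
    qed
  qed
  finally show "(\<integral>x. f x * partial_deriv i \<phi> x \<partial>lebesgue_on \<Omega>) = - (\<integral>x. F x $ i * \<phi> x \<partial>lebesgue_on \<Omega>)" .
qed

text \<open>A pair \<open>(u, g)\<close> on the whole space stands for \<open>u\<close> in the closure of the test functions,
  extended by zero, with weak gradient \<open>g\<close>. Approximation by \<open>C\<^sup>1\<close> functions makes the chain and
  product rules immediate, and both functions are Borel, as convolutions require.\<close>

definition zero_trace_seq ::
    "(real^'n::finite) set \<Rightarrow> (nat \<Rightarrow> real^'n \<Rightarrow> real) \<Rightarrow> (nat \<Rightarrow> real^'n \<Rightarrow> real^'n) \<Rightarrow>
      (real^'n \<Rightarrow> real) \<Rightarrow> (real^'n \<Rightarrow> real^'n) \<Rightarrow> bool" where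
  "zero_trace_seq \<Omega> \<psi> \<Psi> u g \<longleftrightarrow>
    (\<forall>j. C1_grad (\<psi> j) (\<Psi> j) \<and> (\<exists>S. compact S \<and> S \<subseteq> \<Omega> \<and> (\<forall>x. x \<notin> S \<longrightarrow> \<psi> j x = 0))) \<and>
    (\<lambda>j. \<integral>x. norm (\<psi> j x - u x) \<partial>lborel) \<longlonglongrightarrow> 0 \<and>
    (\<lambda>j. \<integral>x. norm (\<Psi> j x - g x) \<partial>lborel) \<longlonglongrightarrow> 0"

definition zero_trace_pair :: "(real^'n::finite) set \<Rightarrow> (real^'n \<Rightarrow> real) \<Rightarrow> (real^'n \<Rightarrow> real^'n) \<Rightarrow> bool" where
  "zero_trace_pair \<Omega> u g \<longleftrightarrow> integrable lborel u \<and> integrable lborel g \<and> (\<exists>\<psi> \<Psi>. zero_trace_seq \<Omega> \<psi> \<Psi> u g)"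

section \<open>Calculus of zero-trace pairs\<close>

lemma zero_trace_pair_integrable:
  "zero_trace_pair \<Omega> u g \<Longrightarrow> integrable lborel u" "zero_trace_pair \<Omega> u g \<Longrightarrow> integrable lborel g"
  by (simp_all add: zero_trace_pair_def)

lemma zero_trace_seqD:
  assumes "zero_trace_seq \<Omega> \<psi> \<Psi> u g"
  shows "C1_grad (\<psi> j) (\<Psi> j)" "\<exists>S. compact S \<and> S \<subseteq> \<Omega> \<and> (\<forall>x. x \<notin> S \<longrightarrow> \<psi> j x = 0)"
    "cont_bdd_supp (\<psi> j)" "cont_bdd_supp (\<Psi> j)" "integrable lborel (\<psi> j)" "integrable lborel (\<Psi> j)"
    "x \<notin> \<Omega> \<Longrightarrow> \<psi> j x = 0" "x \<notin> \<Omega> \<Longrightarrow> \<Psi> j x = 0"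
    "(\<lambda>j. \<integral>x. norm (\<psi> j x - u x) \<partial>lborel) \<longlonglongrightarrow> 0" "(\<lambda>j. \<integral>x. norm (\<Psi> j x - g x) \<partial>lborel) \<longlonglongrightarrow> 0"
proof -
  show C: "C1_grad (\<psi> j) (\<Psi> j)" and ex: "\<exists>S. compact S \<and> S \<subseteq> \<Omega> \<and> (\<forall>x. x \<notin> S \<longrightarrow> \<psi> j x = 0)"
    and "(\<lambda>j. \<integral>x. norm (\<psi> j x - u x) \<partial>lborel) \<longlonglongrightarrow> 0" "(\<lambda>j. \<integral>x. norm (\<Psi> j x - g x) \<partial>lborel) \<longlonglongrightarrow> 0"
    using assms by (simp_all add: zero_trace_seq_def)
  obtain S where S: "compact S" "S \<subseteq> \<Omega>" "\<forall>x. x \<notin> S \<longrightarrow> \<psi> j x = 0" using ex by blast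
  have z: "\<psi> j x = 0" if "x \<notin> S" for x using S(3) that by simp
  note bs = C1_grad_cont_bdd_supp[OF C S(1) z]
  show "cont_bdd_supp (\<psi> j)" "cont_bdd_supp (\<Psi> j)" using bs(1,2) by blast+
  then show "integrable lborel (\<psi> j)" "integrable lborel (\<Psi> j)" by (auto intro: cont_bdd_supp_integrable)
  show "x \<notin> \<Omega> \<Longrightarrow> \<psi> j x = 0" "x \<notin> \<Omega> \<Longrightarrow> \<Psi> j x = 0" using z[of x] bs(3)[of x] S(2) by blast+
qed

lemma C1_zero_trace_pair:
  assumes "C1_grad f F" "compact S" "S \<subseteq> \<Omega>" "\<And>x. x \<notin> S \<Longrightarrow> f x = 0"
  shows "zero_trace_pair \<Omega> f F"
proof -
  note bs = C1_grad_cont_bdd_supp[OF assms(1,2,4)]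
  have "\<exists>S. compact S \<and> S \<subseteq> \<Omega> \<and> (\<forall>x. x \<notin> S \<longrightarrow> f x = 0)"
    using assms(2-4) by (intro exI[of _ S]) simp
  then have "zero_trace_seq \<Omega> (\<lambda>j. f) (\<lambda>j. F) f F"
    using assms(1) by (simp add: zero_trace_seq_def)
  moreover have "integrable lborel f" "integrable lborel F"
    using bs(1,2) by (auto intro: cont_bdd_supp_integrable)
  ultimately show ?thesis
    unfolding zero_trace_pair_def by (intro conjI exI)
qed

lemma zero_trace_pair_outside:
  assumes p: "zero_trace_pair \<Omega> u g" and \<Omega>: "\<Omega> \<in> sets borel"
  shows "AE x in lborel. x \<notin> \<Omega> \<longrightarrow> u x = 0" "AE x in lborel. x \<notin> \<Omega> \<longrightarrow> g x = 0"
proof -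
  obtain \<psi> \<Psi> where s: "zero_trace_seq \<Omega> \<psi> \<Psi> u g" using p unfolding zero_trace_pair_def by blast
  note i = zero_trace_pair_integrable[OF p]
  have "AE x in lborel. x \<in> - \<Omega> \<longrightarrow> u x = 0"
    by (rule L1_limit_zero_AE[OF i(1) zero_trace_seqD(5)[OF s] zero_trace_seqD(9)[OF s]])
      (use zero_trace_seqD(7)[OF s] \<Omega> in auto)
  then show "AE x in lborel. x \<notin> \<Omega> \<longrightarrow> u x = 0" by simp
  have "AE x in lborel. x \<in> - \<Omega> \<longrightarrow> g x = 0"
    by (rule L1_limit_zero_AE[OF i(2) zero_trace_seqD(6)[OF s] zero_trace_seqD(10)[OF s]])
      (use zero_trace_seqD(8)[OF s] \<Omega> in auto)
  then show "AE x in lborel. x \<notin> \<Omega> \<longrightarrow> g x = 0" by simp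
qed

lemma
  fixes w :: "'a::euclidean_space \<Rightarrow> real" and f :: "'a \<Rightarrow> 'b::euclidean_space"
  assumes w: "w \<in> borel_measurable borel" "\<And>x. norm (w x) \<le> M" and f: "integrable lborel f"
  shows integrable_bounded_weight: "integrable lborel (\<lambda>x. w x *\<^sub>R f x)"
    and integral_bounded_weight: "(\<integral>x. norm (w x *\<^sub>R f x) \<partial>lborel) \<le> M * (\<integral>x. norm (f x) \<partial>lborel)"
proof -
  have [measurable]: "f \<in> borel_measurable borel" using f by simp
  note w(1) [measurable]
  have le: "norm (w x *\<^sub>R f x) \<le> M * norm (f x)" for x
    using w(2)[of x] by (simp add: mult_right_mono)
  show i: "integrable lborel (\<lambda>x. w x *\<^sub>R f x)"
  proof (rule Bochner_Integration.integrable_bound)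
    show "integrable lborel (\<lambda>x. M * norm (f x))" using f by simp
    show "AE x in lborel. norm (w x *\<^sub>R f x) \<le> norm (M * norm (f x))"
      by (rule AE_I2, rule order_trans[OF le]) (simp only: real_norm_def abs_ge_self)
  qed measurable
  have "(\<integral>x. norm (w x *\<^sub>R f x) \<partial>lborel) \<le> (\<integral>x. M * norm (f x) \<partial>lborel)"
    by (rule integral_mono[OF integrable_norm[OF i] _ le]) (use f in simp)
  then show "(\<integral>x. norm (w x *\<^sub>R f x) \<partial>lborel) \<le> M * (\<integral>x. norm (f x) \<partial>lborel)"
    by simp
qed

lemma
  fixes w :: "'a::euclidean_space \<Rightarrow> 'b::euclidean_space" and f :: "'a \<Rightarrow> real"
  assumes w: "w \<in> borel_measurable borel" "\<And>x. norm (w x) \<le> M" and f: "integrable lborel f"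
  shows integrable_bounded_vector_weight: "integrable lborel (\<lambda>x. f x *\<^sub>R w x)"
    and integral_bounded_vector_weight: "(\<integral>x. norm (f x *\<^sub>R w x) \<partial>lborel) \<le> M * (\<integral>x. norm (f x) \<partial>lborel)"
proof -
  have [measurable]: "f \<in> borel_measurable borel" using f by simp
  note w(1) [measurable]
  have le: "norm (f x *\<^sub>R w x) \<le> M * norm (f x)" for x
    using mult_left_mono[OF w(2)[of x], of "\<bar>f x\<bar>"] by (simp add: mult.commute)
  show i: "integrable lborel (\<lambda>x. f x *\<^sub>R w x)"
  proof (rule Bochner_Integration.integrable_bound)
    show "integrable lborel (\<lambda>x. M * norm (f x))" using f by simp
    show "AE x in lborel. norm (f x *\<^sub>R w x) \<le> norm (M * norm (f x))"
      by (rule AE_I2, rule order_trans[OF le]) (simp only: real_norm_def abs_ge_self)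
  qed measurable
  have "(\<integral>x. norm (f x *\<^sub>R w x) \<partial>lborel) \<le> (\<integral>x. M * norm (f x) \<partial>lborel)"
    by (rule integral_mono[OF integrable_norm[OF i] _ le]) (use f in simp)
  then show "(\<integral>x. norm (f x *\<^sub>R w x) \<partial>lborel) \<le> M * (\<integral>x. norm (f x) \<partial>lborel)"
    by simp
qed

lemma L1_tendsto_weight:
  fixes w :: "'a::euclidean_space \<Rightarrow> real" and f :: "'a \<Rightarrow> 'b::euclidean_space"
  assumes w: "w \<in> borel_measurable borel" "\<And>x. norm (w x) \<le> M"
    and f: "integrable lborel f" "\<And>j. integrable lborel (F j)"
    and lim: "(\<lambda>j::nat. \<integral>x. norm (F j x - f x) \<partial>lborel) \<longlonglongrightarrow> 0"
  shows "(\<lambda>j. \<integral>x. norm (w x *\<^sub>R F j x - w x *\<^sub>R f x) \<partial>lborel) \<longlonglongrightarrow> 0"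
    "(\<lambda>j. \<integral>x. w x *\<^sub>R F j x \<partial>lborel) \<longlonglongrightarrow> (\<integral>x. w x *\<^sub>R f x \<partial>lborel)"
proof -
  have d: "integrable lborel (\<lambda>x. F j x - f x)" for j using f by simp
  have lim': "(\<lambda>j. M * (\<integral>x. norm (F j x - f x) \<partial>lborel)) \<longlonglongrightarrow> 0"
    using tendsto_mult_right_zero[OF lim] by simp
  have b: "(\<integral>x. norm (w x *\<^sub>R F j x - w x *\<^sub>R f x) \<partial>lborel) \<le> M * (\<integral>x. norm (F j x - f x) \<partial>lborel)" for j
    using integral_bounded_weight[OF w d, of j] by (simp add: scaleR_diff_right)
  have "norm (\<integral>x. norm (w x *\<^sub>R F j x - w x *\<^sub>R f x) \<partial>lborel) \<le> M * (\<integral>x. norm (F j x - f x) \<partial>lborel)" for j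
    using b[of j] by simp
  then show "(\<lambda>j. \<integral>x. norm (w x *\<^sub>R F j x - w x *\<^sub>R f x) \<partial>lborel) \<longlonglongrightarrow> 0"
    by (intro Lim_null_comparison[OF always_eventually lim'] allI)
  have "norm ((\<integral>x. w x *\<^sub>R F j x \<partial>lborel) - (\<integral>x. w x *\<^sub>R f x \<partial>lborel)) \<le>
      M * (\<integral>x. norm (F j x - f x) \<partial>lborel)" for j
  proof -
    have "(\<integral>x. w x *\<^sub>R F j x \<partial>lborel) - (\<integral>x. w x *\<^sub>R f x \<partial>lborel) = (\<integral>x. w x *\<^sub>R F j x - w x *\<^sub>R f x \<partial>lborel)"
      using integrable_bounded_weight[OF w f(1)] integrable_bounded_weight[OF w f(2), of j] by simp
    then show ?thesis
      using order_trans[OF integral_norm_bound[of lborel "\<lambda>x. w x *\<^sub>R F j x - w x *\<^sub>R f x"] b[of j]] by (simp only:)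
  qed
  then have "(\<lambda>j. (\<integral>x. w x *\<^sub>R F j x \<partial>lborel) - (\<integral>x. w x *\<^sub>R f x \<partial>lborel)) \<longlonglongrightarrow> 0"
    by (intro Lim_null_comparison[OF always_eventually lim'] allI)
  then show "(\<lambda>j. \<integral>x. w x *\<^sub>R F j x \<partial>lborel) \<longlonglongrightarrow> (\<integral>x. w x *\<^sub>R f x \<partial>lborel)"
    by (simp add: LIM_zero_iff)
qed

lemma L1_tendsto_vector_weight:
  fixes w :: "'a::euclidean_space \<Rightarrow> 'b::euclidean_space" and f :: "'a \<Rightarrow> real"
  assumes w: "w \<in> borel_measurable borel" "\<And>x. norm (w x) \<le> M"
    and f: "integrable lborel f" "\<And>j. integrable lborel (F j)"
    and lim: "(\<lambda>j::nat. \<integral>x. norm (F j x - f x) \<partial>lborel) \<longlonglongrightarrow> 0"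
  shows "(\<lambda>j. \<integral>x. norm (F j x *\<^sub>R w x - f x *\<^sub>R w x) \<partial>lborel) \<longlonglongrightarrow> 0"
    "(\<lambda>j. \<integral>x. F j x *\<^sub>R w x \<partial>lborel) \<longlonglongrightarrow> (\<integral>x. f x *\<^sub>R w x \<partial>lborel)"
proof -
  have d: "integrable lborel (\<lambda>x. F j x - f x)" for j using f by simp
  have lim': "(\<lambda>j. M * (\<integral>x. norm (F j x - f x) \<partial>lborel)) \<longlonglongrightarrow> 0"
    using tendsto_mult_right_zero[OF lim] by simp
  have b: "(\<integral>x. norm (F j x *\<^sub>R w x - f x *\<^sub>R w x) \<partial>lborel) \<le> M * (\<integral>x. norm (F j x - f x) \<partial>lborel)" for j
    using integral_bounded_vector_weight[OF w d, of j] by (simp add: scaleR_diff_left)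
  have "norm (\<integral>x. norm (F j x *\<^sub>R w x - f x *\<^sub>R w x) \<partial>lborel) \<le> M * (\<integral>x. norm (F j x - f x) \<partial>lborel)" for j
    using b[of j] by simp
  then show "(\<lambda>j. \<integral>x. norm (F j x *\<^sub>R w x - f x *\<^sub>R w x) \<partial>lborel) \<longlonglongrightarrow> 0"
    by (intro Lim_null_comparison[OF always_eventually lim'] allI)
  have "norm ((\<integral>x. F j x *\<^sub>R w x \<partial>lborel) - (\<integral>x. f x *\<^sub>R w x \<partial>lborel)) \<le>
      M * (\<integral>x. norm (F j x - f x) \<partial>lborel)" for j
  proof -
    have "(\<integral>x. F j x *\<^sub>R w x \<partial>lborel) - (\<integral>x. f x *\<^sub>R w x \<partial>lborel) = (\<integral>x. F j x *\<^sub>R w x - f x *\<^sub>R w x \<partial>lborel)"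
      using integrable_bounded_vector_weight[OF w f(1)] integrable_bounded_vector_weight[OF w f(2), of j] by simp
    then show ?thesis
      using order_trans[OF integral_norm_bound[of lborel "\<lambda>x. F j x *\<^sub>R w x - f x *\<^sub>R w x"] b[of j]] by (simp only:)
  qed
  then have "(\<lambda>j. (\<integral>x. F j x *\<^sub>R w x \<partial>lborel) - (\<integral>x. f x *\<^sub>R w x \<partial>lborel)) \<longlonglongrightarrow> 0"
    by (intro Lim_null_comparison[OF always_eventually lim'] allI)
  then show "(\<lambda>j. \<integral>x. F j x *\<^sub>R w x \<partial>lborel) \<longlonglongrightarrow> (\<integral>x. f x *\<^sub>R w x \<partial>lborel)"
    by (simp add: LIM_zero_iff)
qed

text \<open>The approximants of u have compact support, so f need not vanish near the boundary of
  \<Omega>; boundedness of f and F suffices for passing to the limit. This is how zero trace is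
  exploited: no boundary term appears.\<close>

lemma zero_trace_pair_by_parts:
  assumes p: "zero_trace_pair \<Omega> u g" and f: "C1_grad f F" "f \<in> borel_measurable borel" "F \<in> borel_measurable borel"
    and b: "\<And>x. norm (f x) \<le> M" "\<And>x. norm (F x) \<le> M"
  shows "(\<integral>x. u x *\<^sub>R F x \<partial>lborel) = - (\<integral>x. f x *\<^sub>R g x \<partial>lborel)"
proof -
  obtain \<psi> \<Psi> where s: "zero_trace_seq \<Omega> \<psi> \<Psi> u g" using p unfolding zero_trace_pair_def by blast
  note i = zero_trace_pair_integrable[OF p]
  have "(\<integral>x. \<psi> j x *\<^sub>R F x \<partial>lborel) = - (\<integral>x. f x *\<^sub>R \<Psi> j x \<partial>lborel)" for j
  proof -
    obtain S where S: "compact S" "\<And>x. x \<notin> S \<Longrightarrow> \<psi> j x = 0" using zero_trace_seqD(2)[OF s, of j] by blast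
    show ?thesis by (rule integral_by_parts_C1(3)[OF zero_trace_seqD(1)[OF s] S f(1)])
  qed
  moreover have "(\<lambda>j. \<integral>x. \<psi> j x *\<^sub>R F x \<partial>lborel) \<longlonglongrightarrow> (\<integral>x. u x *\<^sub>R F x \<partial>lborel)"
    by (rule L1_tendsto_vector_weight(2)[OF f(3) b(2) i(1) zero_trace_seqD(5)[OF s] zero_trace_seqD(9)[OF s]])
  moreover have "(\<lambda>j. - (\<integral>x. f x *\<^sub>R \<Psi> j x \<partial>lborel)) \<longlonglongrightarrow> - (\<integral>x. f x *\<^sub>R g x \<partial>lborel)"
    by (rule tendsto_minus[OF L1_tendsto_weight(2)[OF f(2) b(1) i(2) zero_trace_seqD(6)[OF s] zero_trace_seqD(10)[OF s]]])
  ultimately show ?thesis using LIMSEQ_unique by simp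
qed

text \<open>Integration by parts against the reflected kernel t \<mapsto> K(x - t), also when its
  support crosses the boundary of \<Omega>: the extension by zero of u has the extension by zero of
  g as its gradient.\<close>

lemma zero_trace_pair_conv:
  assumes p: "zero_trace_pair \<Omega> u g" and K: "C1_grad K G" "cont_bdd_supp K" "cont_bdd_supp G"
  shows "(\<integral>t. u t *\<^sub>R G (x - t) \<partial>lborel) = conv K g x"
proof -
  obtain M1 where M1: "\<And>x. norm (K x) \<le> M1" using cont_bdd_supp_bounded[OF K(2)] by blast
  obtain M2 where M2: "\<And>x. norm (G x) \<le> M2" using cont_bdd_supp_bounded[OF K(3)] by blast
  have [measurable]: "K \<in> borel_measurable borel" "G \<in> borel_measurable borel"
    using cont_bdd_supp_measurable K(2,3) by auto
  have C: "C1_grad (\<lambda>t. K (x - t)) (\<lambda>t. - G (x - t))"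
    using C1_grad_affine[OF K(1), of "-1" x] by simp
  have "(\<integral>t. u t *\<^sub>R (- G (x - t)) \<partial>lborel) = - (\<integral>t. K (x - t) *\<^sub>R g t \<partial>lborel)"
  proof (rule zero_trace_pair_by_parts[OF p C, of "max M1 M2"])
    show "norm (K (x - t)) \<le> max M1 M2" "norm (- G (x - t)) \<le> max M1 M2" for t
      using M1[of "x - t"] M2[of "x - t"] by (auto simp: le_max_iff_disj)
  qed measurable
  then show ?thesis by (simp add: conv_def)
qed

lemma conv_test_function:
  assumes K: "\<And>k. times_cont_diff k K" "compact B" "\<And>z. z \<notin> B \<Longrightarrow> K z = 0"
    and f: "integrable lborel f" "compact S" "AE x in lborel. x \<notin> S \<longrightarrow> f x = 0"
    and sub: "\<And>x y. x \<in> S \<Longrightarrow> y \<in> B \<Longrightarrow> x + y \<in> \<Omega>"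
  shows "conv K f \<in> test_functions \<Omega>"
proof (rule test_functionsI)
  show "times_cont_diff k (conv K f)" for k by (rule conv_times_cont_diff[OF K f(1)])
  show "compact {x + y | x y. x \<in> S \<and> y \<in> B}" by (rule compact_sums[OF f(2) K(2)])
  show "{x + y | x y. x \<in> S \<and> y \<in> B} \<subseteq> \<Omega>" using sub by blast
  fix x assume x: "x \<notin> {x + y | x y. x \<in> S \<and> y \<in> B}"
  have "AE y in lborel. K (x - y) *\<^sub>R f y = 0"
    using f(3)
  proof eventually_elim
    case (elim y)
    show ?case
    proof (cases "y \<in> S")
      case True
      then have "x - y \<notin> B" using x by force
      then show ?thesis by (simp add: K(3))
    qed (use elim in simp)
  qed
  then show "conv K f x = 0"
    unfolding conv_def by (rule integral_eq_zero_AE)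
qed

lemma zero_trace_pair_conv_grad:
  assumes p: "zero_trace_pair \<Omega> u g" and K: "C1_grad K G" "cont_bdd_supp K" "cont_bdd_supp G"
  shows "(conv K u has_derivative (\<lambda>h. h \<bullet> conv K g x)) (at x)"
  using conv_has_derivative[OF K zero_trace_pair_integrable(1)[OF p], of x]
  by (simp only: zero_trace_pair_conv[OF p K])

text \<open>Moving the derivative to the kernel trades the unbounded g for the bounded u, at the
  price of the L^1 norm of the gradient of the kernel, which is of order 1/d.\<close>

lemma norm_conv_grad_le:
  fixes v :: "real^'n::finite"
  assumes p: "zero_trace_pair \<Omega> u g" and b: "\<And>x. \<bar>u x\<bar> \<le> M" and d: "d > 0"
  shows "norm (conv (mollifier v d) g x) \<le> M * bump_variation TYPE('n) / d"
proof -
  let ?K = "mollifier v d"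
  note Kb = mollifier_cont_bdd_supp[OF d, of v]
  have M: "M \<ge> 0" using b[of 0] by simp
  have i: "integrable lborel (\<lambda>t. norm (grad ?K (x - t)))"
    using integrable_lborel_reflect[OF cont_bdd_supp_integrable[OF Kb(2)]] by simp
  have "norm (conv ?K g x) = norm (\<integral>t. u t *\<^sub>R grad ?K (x - t) \<partial>lborel)"
    by (simp add: zero_trace_pair_conv[OF p mollifier_C1_grad Kb])
  also have "\<dots> \<le> (\<integral>t. norm (u t *\<^sub>R grad ?K (x - t)) \<partial>lborel)" by (rule integral_norm_bound)
  also have "\<dots> \<le> (\<integral>t. M * norm (grad ?K (x - t)) \<partial>lborel)"
  proof (rule integral_mono[OF integrable_norm])
    show "integrable lborel (\<lambda>t. u t *\<^sub>R grad ?K (x - t))"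
      by (rule conv_integrand_integrable'[OF Kb(2) zero_trace_pair_integrable(1)[OF p]])
    show "integrable lborel (\<lambda>t. M * norm (grad ?K (x - t)))" using i by simp
    show "norm (u t *\<^sub>R grad ?K (x - t)) \<le> M * norm (grad ?K (x - t))" for t
      using b[of t] by (simp add: mult_right_mono)
  qed
  also have "\<dots> = M * (\<integral>t. norm (grad ?K (x - t)) \<partial>lborel)" by simp
  also have "(\<integral>t. norm (grad ?K (x - t)) \<partial>lborel) = (\<integral>t. norm (grad ?K t) \<partial>lborel)"
    by (rule integral_lborel_reflect) (use cont_bdd_supp_integrable[OF Kb(2)] in simp)
  finally show ?thesis by (simp add: integral_norm_grad_mollifier[OF d])
qed

text \<open>The condition T(0) = 0 preserves supports. The gradient error is split into
  T'(\<psi>)(\<Psi> - g), controlled by |T'| \<le> 1, and (T'(\<psi>) - T'(u)) g, which tends to 0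
  by dominated convergence along a subsequence with \<psi> \<rightarrow> u almost
  everywhere.\<close>

lemma zero_trace_pair_compose:
  assumes \<Omega>: "zero_trace_pair \<Omega> u g"
    and T: "\<And>s. (T has_real_derivative T' s) (at s)" "continuous_on UNIV T'" "\<And>s. \<bar>T' s\<bar> \<le> 1" "T 0 = 0"
  shows "zero_trace_pair \<Omega> (\<lambda>x. T (u x)) (\<lambda>x. T' (u x) *\<^sub>R g x)"
proof -
  obtain \<psi> \<Psi> where s: "zero_trace_seq \<Omega> \<psi> \<Psi> u g" using \<Omega> unfolding zero_trace_pair_def by blast
  note i = zero_trace_pair_integrable[OF \<Omega>]
  note D = zero_trace_seqD[OF s]
  have lip: "\<bar>T s - T t\<bar> \<le> \<bar>s - t\<bar>" for s t
  proof -
    have "norm (T s - T t) \<le> 1 * norm (s - t)"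
      by (rule field_differentiable_bound[of UNIV T T']) (use T(1,3) in auto)
    then show ?thesis by simp
  qed
  have lip0: "\<bar>T s\<bar> \<le> \<bar>s\<bar>" for s using lip[of s 0] T(4) by simp
  have Tc: "continuous_on UNIV T" using T(1) by (meson DERIV_isCont continuous_at_imp_continuous_on)
  note [measurable] = borel_measurable_continuous_onI[OF Tc] borel_measurable_continuous_onI[OF T(2)]
  have um [measurable]: "u \<in> borel_measurable borel" "g \<in> borel_measurable borel"
    "\<psi> j \<in> borel_measurable borel" "\<Psi> j \<in> borel_measurable borel" for j
    using i D(5,6) by auto
  have iu: "integrable lborel (\<lambda>x. T (u x))"
    by (rule Bochner_Integration.integrable_bound[OF i(1)]) (use lip0 in auto)
  have ig: "integrable lborel (\<lambda>x. T' (u x) *\<^sub>R g x)"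
    by (rule integrable_bounded_weight[OF _ _ i(2), where M=1]) (use T(3) in auto)
  have igj: "integrable lborel (\<lambda>x. T' (\<psi> j x) *\<^sub>R \<Psi> j x)" for j
    by (rule integrable_bounded_weight[OF _ _ D(6), where M=1]) (use T(3) in auto)
  obtain r :: "nat \<Rightarrow> nat" where r: "strict_mono r" "AE x in lborel. (\<lambda>j. \<psi> (r j) x - u x) \<longlonglongrightarrow> 0"
    using tendsto_L1_AE_subseq[of lborel "\<lambda>j x. \<psi> j x - u x"] D(5,9) i(1) by auto
  have "zero_trace_seq \<Omega> (\<lambda>j x. T (\<psi> (r j) x)) (\<lambda>j x. T' (\<psi> (r j) x) *\<^sub>R \<Psi> (r j) x) (\<lambda>x. T (u x)) (\<lambda>x. T' (u x) *\<^sub>R g x)"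
    unfolding zero_trace_seq_def
  proof (intro conjI allI)
    show "C1_grad (\<lambda>x. T (\<psi> (r j) x)) (\<lambda>x. T' (\<psi> (r j) x) *\<^sub>R \<Psi> (r j) x)" for j
      by (rule C1_grad_compose_real[OF T(1,2) D(1)])
    show "\<exists>S. compact S \<and> S \<subseteq> \<Omega> \<and> (\<forall>x. x \<notin> S \<longrightarrow> T (\<psi> (r j) x) = 0)" for j
      using D(2)[of "r j"] T(4) by auto
    have lim1: "(\<lambda>j. \<integral>x. norm (\<psi> (r j) x - u x) \<partial>lborel) \<longlonglongrightarrow> 0"
      using LIMSEQ_subseq_LIMSEQ[OF D(9) r(1)] by (simp add: o_def)
    have "norm (\<integral>x. norm (T (\<psi> (r j) x) - T (u x)) \<partial>lborel) \<le> (\<integral>x. norm (\<psi> (r j) x - u x) \<partial>lborel)" for j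
    proof -
      have "(\<integral>x. norm (T (\<psi> (r j) x) - T (u x)) \<partial>lborel) \<le> (\<integral>x. norm (\<psi> (r j) x - u x) \<partial>lborel)"
      proof (rule integral_mono)
        have "integrable lborel (\<lambda>x. T (\<psi> (r j) x))"
          by (rule Bochner_Integration.integrable_bound[OF D(5)[of "r j"]]) (use lip0 in auto)
        then show "integrable lborel (\<lambda>x. norm (T (\<psi> (r j) x) - T (u x)))" using iu by simp
      qed (use D(5) i(1) lip in auto)
      then show ?thesis by simp
    qed
    then show "(\<lambda>j. \<integral>x. norm (T (\<psi> (r j) x) - T (u x)) \<partial>lborel) \<longlonglongrightarrow> 0"
      by (intro Lim_null_comparison[OF always_eventually lim1] allI)
    have lim2: "(\<lambda>j. \<integral>x. norm (\<Psi> (r j) x - g x) \<partial>lborel) \<longlonglongrightarrow> 0"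
      using LIMSEQ_subseq_LIMSEQ[OF D(10) r(1)] by (simp add: o_def)
    have lim3: "(\<lambda>j. \<integral>x. \<bar>T' (\<psi> (r j) x) - T' (u x)\<bar> * norm (g x) \<partial>lborel) \<longlonglongrightarrow> (\<integral>x. 0 \<partial>(lborel :: (real^'a) measure))"
    proof (rule integral_dominated_convergence)
      show "integrable lborel (\<lambda>x. 2 * norm (g x))" using i(2) by simp
      show "AE x in lborel. (\<lambda>j. \<bar>T' (\<psi> (r j) x) - T' (u x)\<bar> * norm (g x)) \<longlonglongrightarrow> 0"
        using r(2)
      proof eventually_elim
        case (elim x)
        then have "(\<lambda>j. \<psi> (r j) x) \<longlonglongrightarrow> u x" by (simp add: LIM_zero_iff)
        moreover have "isCont T' (u x)" using T(2) by (simp add: continuous_on_eq_continuous_at)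
        ultimately have "(\<lambda>j. T' (\<psi> (r j) x)) \<longlonglongrightarrow> T' (u x)" using isCont_tendsto_compose by blast
        then have "(\<lambda>j. \<bar>T' (\<psi> (r j) x) - T' (u x)\<bar> * norm (g x)) \<longlonglongrightarrow> \<bar>T' (u x) - T' (u x)\<bar> * norm (g x)"
          by (intro tendsto_intros)
        then show ?case by simp
      qed
      show "AE x in lborel. norm (\<bar>T' (\<psi> (r j) x) - T' (u x)\<bar> * norm (g x)) \<le> 2 * norm (g x)" for j
      proof (rule AE_I2)
        fix x
        have "\<bar>T' (\<psi> (r j) x) - T' (u x)\<bar> \<le> 2" using T(3)[of "\<psi> (r j) x"] T(3)[of "u x"] by linarith
        then show "norm (\<bar>T' (\<psi> (r j) x) - T' (u x)\<bar> * norm (g x)) \<le> 2 * norm (g x)"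
          by (simp add: mult_right_mono)
      qed
    qed measurable
    have lim4: "(\<lambda>j. (\<integral>x. norm (\<Psi> (r j) x - g x) \<partial>lborel) +
        (\<integral>x. \<bar>T' (\<psi> (r j) x) - T' (u x)\<bar> * norm (g x) \<partial>lborel)) \<longlonglongrightarrow> 0"
      using tendsto_add[OF lim2 lim3] by simp
    have "norm (\<integral>x. norm (T' (\<psi> (r j) x) *\<^sub>R \<Psi> (r j) x - T' (u x) *\<^sub>R g x) \<partial>lborel) \<le>
       (\<integral>x. norm (\<Psi> (r j) x - g x) \<partial>lborel) + (\<integral>x. \<bar>T' (\<psi> (r j) x) - T' (u x)\<bar> * norm (g x) \<partial>lborel)" for j
    proof -
      have i3: "integrable lborel (\<lambda>x. \<bar>T' (\<psi> (r j) x) - T' (u x)\<bar> * norm (g x))"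
        using integrable_bounded_weight[of "\<lambda>x. \<bar>T' (\<psi> (r j) x) - T' (u x)\<bar>" 2 "\<lambda>x. norm (g x)"] i(2)
          T(3) abs_triangle_ineq4 order_trans[OF abs_triangle_ineq4 add_mono[OF T(3) T(3)]] by fastforce
      have i4: "integrable lborel (\<lambda>x. norm (\<Psi> (r j) x - g x))" using D(6)[of "r j"] i(2) by simp
      have "(\<integral>x. norm (T' (\<psi> (r j) x) *\<^sub>R \<Psi> (r j) x - T' (u x) *\<^sub>R g x) \<partial>lborel) \<le>
        (\<integral>x. norm (\<Psi> (r j) x - g x) + \<bar>T' (\<psi> (r j) x) - T' (u x)\<bar> * norm (g x) \<partial>lborel)"
      proof (rule integral_mono)
        show "integrable lborel (\<lambda>x. norm (T' (\<psi> (r j) x) *\<^sub>R \<Psi> (r j) x - T' (u x) *\<^sub>R g x))"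
          using igj[of "r j"] ig by simp
        show "integrable lborel (\<lambda>x. norm (\<Psi> (r j) x - g x) + \<bar>T' (\<psi> (r j) x) - T' (u x)\<bar> * norm (g x))"
          using i3 i4 by simp
        fix x
        have "T' (\<psi> (r j) x) *\<^sub>R \<Psi> (r j) x - T' (u x) *\<^sub>R g x =
          T' (\<psi> (r j) x) *\<^sub>R (\<Psi> (r j) x - g x) + (T' (\<psi> (r j) x) - T' (u x)) *\<^sub>R g x"
          by (simp add: algebra_simps)
        then have "norm (T' (\<psi> (r j) x) *\<^sub>R \<Psi> (r j) x - T' (u x) *\<^sub>R g x) \<le>
          \<bar>T' (\<psi> (r j) x)\<bar> * norm (\<Psi> (r j) x - g x) + \<bar>T' (\<psi> (r j) x) - T' (u x)\<bar> * norm (g x)"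
          using norm_triangle_ineq[of "T' (\<psi> (r j) x) *\<^sub>R (\<Psi> (r j) x - g x)" "(T' (\<psi> (r j) x) - T' (u x)) *\<^sub>R g x"]
          by simp
        also have "\<bar>T' (\<psi> (r j) x)\<bar> * norm (\<Psi> (r j) x - g x) \<le> 1 * norm (\<Psi> (r j) x - g x)"
          by (intro mult_right_mono T(3)) simp
        finally show "norm (T' (\<psi> (r j) x) *\<^sub>R \<Psi> (r j) x - T' (u x) *\<^sub>R g x) \<le>
          norm (\<Psi> (r j) x - g x) + \<bar>T' (\<psi> (r j) x) - T' (u x)\<bar> * norm (g x)" by simp
      qed
      then show ?thesis using i3 i4 by simp
    qed
    then show "(\<lambda>j. \<integral>x. norm (T' (\<psi> (r j) x) *\<^sub>R \<Psi> (r j) x - T' (u x) *\<^sub>R g x) \<partial>lborel) \<longlonglongrightarrow> 0"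
      by (intro Lim_null_comparison[OF always_eventually lim4] allI)
  qed
  then show ?thesis unfolding zero_trace_pair_def using iu ig by blast
qed

text \<open>The support of \<theta> may stick out of \<Omega>; the products with the approximants of
  u are supported in \<Omega> nevertheless. Cut-offs centred at boundary points are therefore
  admissible.\<close>

lemma zero_trace_pair_mult:
  assumes p: "zero_trace_pair \<Omega> u g" and \<theta>: "C1_grad \<theta> \<Theta>" "cont_bdd_supp \<theta>" "cont_bdd_supp \<Theta>"
  shows "zero_trace_pair \<Omega> (\<lambda>x. \<theta> x * u x) (\<lambda>x. \<theta> x *\<^sub>R g x + u x *\<^sub>R \<Theta> x)"
proof -
  obtain \<psi> \<Psi> where s: "zero_trace_seq \<Omega> \<psi> \<Psi> u g" using p unfolding zero_trace_pair_def by blast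
  note i = zero_trace_pair_integrable[OF p]
  note D = zero_trace_seqD[OF s]
  obtain M1 where M1: "\<And>x. norm (\<theta> x) \<le> M1" using cont_bdd_supp_bounded[OF \<theta>(2)] by blast
  obtain M2 where M2: "\<And>x. norm (\<Theta> x) \<le> M2" using cont_bdd_supp_bounded[OF \<theta>(3)] by blast
  note m = cont_bdd_supp_measurable[OF \<theta>(2)] cont_bdd_supp_measurable[OF \<theta>(3)]
  have I: "integrable lborel (\<lambda>x. \<theta> x * u x)" "integrable lborel (\<lambda>x. \<theta> x *\<^sub>R g x)" "integrable lborel (\<lambda>x. u x *\<^sub>R \<Theta> x)"
    "integrable lborel (\<lambda>x. \<theta> x *\<^sub>R \<Psi> j x)" "integrable lborel (\<lambda>x. \<psi> j x *\<^sub>R \<Theta> x)" for j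
    using integrable_bounded_weight[OF m(1) M1 i(1)] integrable_bounded_weight[OF m(1) M1 i(2)]
      integrable_bounded_vector_weight[OF m(2) M2 i(1)] integrable_bounded_weight[OF m(1) M1 D(6)]
      integrable_bounded_vector_weight[OF m(2) M2 D(5)] by simp_all
  have "zero_trace_seq \<Omega> (\<lambda>j x. \<theta> x * \<psi> j x) (\<lambda>j x. \<theta> x *\<^sub>R \<Psi> j x + \<psi> j x *\<^sub>R \<Theta> x)
      (\<lambda>x. \<theta> x * u x) (\<lambda>x. \<theta> x *\<^sub>R g x + u x *\<^sub>R \<Theta> x)"
    unfolding zero_trace_seq_def
  proof (intro conjI allI)
    show "C1_grad (\<lambda>x. \<theta> x * \<psi> j x) (\<lambda>x. \<theta> x *\<^sub>R \<Psi> j x + \<psi> j x *\<^sub>R \<Theta> x)" for j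
      by (rule C1_grad_mult[OF \<theta>(1) D(1)])
    show "\<exists>S. compact S \<and> S \<subseteq> \<Omega> \<and> (\<forall>x. x \<notin> S \<longrightarrow> \<theta> x * \<psi> j x = 0)" for j
      using D(2)[of j] by auto
    show "(\<lambda>j. \<integral>x. norm (\<theta> x * \<psi> j x - \<theta> x * u x) \<partial>lborel) \<longlonglongrightarrow> 0"
      using L1_tendsto_weight(1)[OF m(1) M1 i(1) D(5) D(9)] by simp
    have lim: "(\<lambda>j. (\<integral>x. norm (\<theta> x *\<^sub>R \<Psi> j x - \<theta> x *\<^sub>R g x) \<partial>lborel) +
        (\<integral>x. norm (\<psi> j x *\<^sub>R \<Theta> x - u x *\<^sub>R \<Theta> x) \<partial>lborel)) \<longlonglongrightarrow> 0"
      using tendsto_add[OF L1_tendsto_weight(1)[OF m(1) M1 i(2) D(6) D(10)]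
          L1_tendsto_vector_weight(1)[OF m(2) M2 i(1) D(5) D(9)]] by simp
    have "norm (\<integral>x. norm (\<theta> x *\<^sub>R \<Psi> j x + \<psi> j x *\<^sub>R \<Theta> x - (\<theta> x *\<^sub>R g x + u x *\<^sub>R \<Theta> x)) \<partial>lborel) \<le>
       (\<integral>x. norm (\<theta> x *\<^sub>R \<Psi> j x - \<theta> x *\<^sub>R g x) \<partial>lborel) + (\<integral>x. norm (\<psi> j x *\<^sub>R \<Theta> x - u x *\<^sub>R \<Theta> x) \<partial>lborel)" for j
    proof -
      have "(\<integral>x. norm (\<theta> x *\<^sub>R \<Psi> j x + \<psi> j x *\<^sub>R \<Theta> x - (\<theta> x *\<^sub>R g x + u x *\<^sub>R \<Theta> x)) \<partial>lborel) \<le>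
       (\<integral>x. norm (\<theta> x *\<^sub>R \<Psi> j x - \<theta> x *\<^sub>R g x) + norm (\<psi> j x *\<^sub>R \<Theta> x - u x *\<^sub>R \<Theta> x) \<partial>lborel)"
      proof (rule integral_mono)
        show "norm (\<theta> x *\<^sub>R \<Psi> j x + \<psi> j x *\<^sub>R \<Theta> x - (\<theta> x *\<^sub>R g x + u x *\<^sub>R \<Theta> x)) \<le>
          norm (\<theta> x *\<^sub>R \<Psi> j x - \<theta> x *\<^sub>R g x) + norm (\<psi> j x *\<^sub>R \<Theta> x - u x *\<^sub>R \<Theta> x)" for x
          by (rule norm_diff_triangle_ineq)
      qed (use I in simp_all)
      then show ?thesis using I by simp
    qed
    then show "(\<lambda>j. \<integral>x. norm (\<theta> x *\<^sub>R \<Psi> j x + \<psi> j x *\<^sub>R \<Theta> x - (\<theta> x *\<^sub>R g x + u x *\<^sub>R \<Theta> x)) \<partial>lborel) \<longlonglongrightarrow> 0"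
      by (intro Lim_null_comparison[OF always_eventually lim] allI)
  qed
  then show ?thesis unfolding zero_trace_pair_def using I by auto
qed

lemma conv_mollifier_tendsto:
  fixes f :: "real^'n::finite \<Rightarrow> 'b::{banach, second_countable_topology}"
  assumes d: "\<And>j. d j > 0" "d \<longlonglongrightarrow> 0" and f: "integrable lborel f"
  shows "(\<lambda>j::nat. \<integral>x. norm (conv (mollifier v (d j)) f x - f x) \<partial>lborel) \<longlonglongrightarrow> 0"
proof (rule conv_L1_tendsto[OF mollifier_unit_kernel[OF d(1)] _ _ f])
  show "(\<lambda>j. d j * (norm v + 1)) \<longlonglongrightarrow> 0"
    using tendsto_mult_left_zero[OF d(2)] by simp
  fix j z assume "mollifier v (d j) z \<noteq> 0"
  then have "z \<in> cball (d j *\<^sub>R v) (d j)" using mollifier_supp[OF d(1)] by blast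
  then have "norm (z - d j *\<^sub>R v) \<le> d j" by (simp add: dist_norm norm_minus_commute)
  moreover have "norm z \<le> norm (z - d j *\<^sub>R v) + norm (d j *\<^sub>R v)"
    using norm_triangle_ineq[of "z - d j *\<^sub>R v" "d j *\<^sub>R v"] by simp
  ultimately show "norm z \<le> d j * (norm v + 1)"
    using d(1)[of j] by (simp add: algebra_simps)
qed

lemma compact_open_margin:
  fixes S :: "'a::euclidean_space set"
  assumes "compact S" "open \<Omega>" "S \<subseteq> \<Omega>"
  obtains d where "d > 0" "\<And>x y. x \<in> S \<Longrightarrow> norm y \<le> d \<Longrightarrow> x + y \<in> \<Omega>"
proof -
  obtain d where d: "d > 0" "\<forall>x\<in>S. \<forall>y\<in>- \<Omega>. d \<le> dist x y"
    using separate_compact_closed[of S "- \<Omega>"] assms by auto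
  have "x + y \<in> \<Omega>" if "x \<in> S" "norm y \<le> d / 2" for x y
  proof (rule ccontr)
    assume "x + y \<notin> \<Omega>"
    then have "d \<le> dist x (x + y)" using d(2) that(1) by blast
    then show False using d(1) that(2) by (simp add: dist_norm)
  qed
  then show ?thesis using that[of "d / 2"] d(1) by simp
qed

lemma zero_trace_pair_has_weak_gradient:
  assumes \<Omega>: "open \<Omega>" and p: "zero_trace_pair \<Omega> u g"
  shows "has_weak_gradient \<Omega> u g"
  unfolding has_weak_gradient_def
proof (intro conjI ballI allI)
  note i = zero_trace_pair_integrable[OF p]
  show "locally_integrable \<Omega> u" "locally_integrable \<Omega> g"
    using i by (auto intro: integrable_lborel_locally_integrable)
  fix \<phi> i assume "\<phi> \<in> test_functions \<Omega>"
  then obtain S where S: "C1_grad \<phi> (grad \<phi>)" "compact S" "S \<subseteq> \<Omega>" "\<And>x. x \<notin> S \<Longrightarrow> \<phi> x = 0" "\<And>x. x \<notin> S \<Longrightarrow> grad \<phi> x = 0"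
    using test_function_C1 by metis
  note bs = C1_grad_cont_bdd_supp(1,2)[OF S(1,2,4)]
  obtain M1 where M1: "\<And>x. norm (\<phi> x) \<le> M1" using cont_bdd_supp_bounded[OF bs(1)] by blast
  obtain M2 where M2: "\<And>x. norm (grad \<phi> x) \<le> M2" using cont_bdd_supp_bounded[OF bs(2)] by blast
  note m = cont_bdd_supp_measurable[OF bs(1)] cont_bdd_supp_measurable[OF bs(2)]
  note [measurable] = m
  have [measurable]: "u \<in> borel_measurable borel" "g \<in> borel_measurable borel" using i by auto
  have \<Omega>': "\<Omega> \<in> sets borel" using \<Omega> by simp
  have z: "\<phi> x = 0" "grad \<phi> x = 0" if "x \<notin> \<Omega>" for x
  proof -
    have "x \<notin> S" using S(3) that by blast
    then show "\<phi> x = 0" "grad \<phi> x = 0" by (simp_all add: S(4,5))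
  qed
  have i1: "integrable lborel (\<lambda>x. u x *\<^sub>R grad \<phi> x)" by (rule integrable_bounded_vector_weight[OF m(2) M2 i(1)])
  have i2: "integrable lborel (\<lambda>x. \<phi> x *\<^sub>R g x)" by (rule integrable_bounded_weight[OF m(1) M1 i(2)])
  have "(\<integral>x. u x * partial_deriv i \<phi> x \<partial>lebesgue_on \<Omega>) = (\<integral>x. u x * grad \<phi> x $ i \<partial>lborel)"
    unfolding C1_grad_partial[OF S(1)]
    by (rule integral_lebesgue_on_zero_outside[OF \<Omega>']) (simp_all add: z)
  also have "\<dots> = (\<integral>x. u x *\<^sub>R grad \<phi> x \<partial>lborel) $ i"
    using vec_nth_integral[OF i1, of i] by simp
  also have "(\<integral>x. u x *\<^sub>R grad \<phi> x \<partial>lborel) = - (\<integral>x. \<phi> x *\<^sub>R g x \<partial>lborel)"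
    by (rule zero_trace_pair_by_parts[OF p S(1) m, of "max M1 M2"])
      (simp_all add: le_max_iff_disj M1[simplified] M2)
  also have "(- (\<integral>x. \<phi> x *\<^sub>R g x \<partial>lborel)) $ i = - (\<integral>x. g x $ i * \<phi> x \<partial>lborel)"
    using vec_nth_integral[OF i2, of i] by (simp add: mult.commute)
  also have "(\<integral>x. g x $ i * \<phi> x \<partial>lborel) = (\<integral>x. g x $ i * \<phi> x \<partial>lebesgue_on \<Omega>)"
    by (rule integral_lebesgue_on_zero_outside[OF \<Omega>', symmetric]) (simp_all add: z)
  finally show "(\<integral>x. u x * partial_deriv i \<phi> x \<partial>lebesgue_on \<Omega>) = - (\<integral>x. g x $ i * \<phi> x \<partial>lebesgue_on \<Omega>)" .
qed

lemma test_function_pair: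
  assumes "\<phi> \<in> test_functions \<Omega>"
  shows "zero_trace_pair \<Omega> \<phi> (grad \<phi>)"
  using test_function_C1[OF assms] C1_zero_trace_pair by metis

text \<open>The approximating functions are only C^1. Mollifying one of them at a radius below the
  distance from its support to the complement of \<Omega> makes it a test function, and each of the
  two errors is kept below e/2.\<close>

lemma zero_trace_pair_approx_test:
  assumes \<Omega>: "open \<Omega>" and p: "zero_trace_pair \<Omega> u g" and e: "e > 0"
  shows "\<exists>\<psi>\<in>test_functions \<Omega>. (\<integral>x. norm (u x - \<psi> x) \<partial>lborel) < e \<and> (\<integral>x. norm (g x - grad \<psi> x) \<partial>lborel) < e"
proof -
  obtain \<psi> \<Psi> where s: "zero_trace_seq \<Omega> \<psi> \<Psi> u g" using p unfolding zero_trace_pair_def by blast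
  note i = zero_trace_pair_integrable[OF p]
  note D = zero_trace_seqD[OF s]
  have "eventually (\<lambda>j. (\<integral>x. norm (\<psi> j x - u x) \<partial>lborel) < e / 2 \<and> (\<integral>x. norm (\<Psi> j x - g x) \<partial>lborel) < e / 2) sequentially"
    using order_tendstoD(2)[OF D(9), of "e/2"] order_tendstoD(2)[OF D(10), of "e/2"] e by (auto intro: eventually_conj)
  then obtain j where j: "(\<integral>x. norm (\<psi> j x - u x) \<partial>lborel) < e / 2" "(\<integral>x. norm (\<Psi> j x - g x) \<partial>lborel) < e / 2"
    unfolding eventually_sequentially by blast
  obtain S where S: "compact S" "S \<subseteq> \<Omega>" "\<And>x. x \<notin> S \<Longrightarrow> \<psi> j x = 0" using D(2)[of j] by blast
  have pj: "zero_trace_pair \<Omega> (\<psi> j) (\<Psi> j)" by (rule C1_zero_trace_pair[OF D(1) S])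
  obtain d0 where d0: "d0 > 0" "\<And>x y. x \<in> S \<Longrightarrow> norm y \<le> d0 \<Longrightarrow> x + y \<in> \<Omega>"
    using compact_open_margin[OF S(1) \<Omega> S(2)] by blast
  obtain d where dpos: "\<And>k. d k > 0" and dle: "\<And>k. d k \<le> d0" and dlim: "d \<longlonglongrightarrow> 0"
    using null_sequence_below[OF d0(1)] by blast
  let ?K = "\<lambda>k. mollifier (0 :: real^'a) (d k)"
  have "eventually (\<lambda>k. (\<integral>x. norm (conv (?K k) (\<psi> j) x - \<psi> j x) \<partial>lborel) < e / 2 \<and>
      (\<integral>x. norm (conv (?K k) (\<Psi> j) x - \<Psi> j x) \<partial>lborel) < e / 2) sequentially"
    using order_tendstoD(2)[OF conv_mollifier_tendsto[OF dpos dlim D(5)[of j], of 0], of "e/2"]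
      order_tendstoD(2)[OF conv_mollifier_tendsto[OF dpos dlim D(6)[of j], of 0], of "e/2"] e by (auto intro: eventually_conj)
  then obtain k where k: "(\<integral>x. norm (conv (?K k) (\<psi> j) x - \<psi> j x) \<partial>lborel) < e / 2"
      "(\<integral>x. norm (conv (?K k) (\<Psi> j) x - \<Psi> j x) \<partial>lborel) < e / 2"
    unfolding eventually_sequentially by blast
  let ?w = "conv (?K k) (\<psi> j)"
  have gw: "grad ?w x = conv (?K k) (\<Psi> j) x" for x
    by (rule grad_eq[OF zero_trace_pair_conv_grad[OF pj mollifier_C1_grad mollifier_cont_bdd_supp[OF dpos]]])
  have "?w \<in> test_functions \<Omega>"
  proof (rule conv_test_function[OF times_cont_diff_mollifier compact_cball mollifier_supp[OF dpos] D(5) S(1)])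
    show "AE x in lborel. x \<notin> S \<longrightarrow> \<psi> j x = 0" using S(3) by simp
    show "x + y \<in> \<Omega>" if "x \<in> S" "y \<in> cball (d k *\<^sub>R (0 :: real^'a)) (d k)" for x y
      using d0(2)[OF that(1), of y] that(2) dle[of k] by simp
  qed
  have L: "(\<integral>x. norm (f x - h x) \<partial>lborel) < e"
    if "integrable lborel f" "integrable lborel m" "integrable lborel h" 
      "(\<integral>x. norm (m x - f x) \<partial>lborel) < e / 2" "(\<integral>x. norm (h x - m x) \<partial>lborel) < e / 2"
    for f m h :: "real^'a \<Rightarrow> 'c::euclidean_space"
  proof -
    have "(\<integral>x. norm (f x - h x) \<partial>lborel) \<le> (\<integral>x. norm (m x - f x) + norm (h x - m x) \<partial>lborel)"
    proof (rule integral_mono)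
      show "norm (f x - h x) \<le> norm (m x - f x) + norm (h x - m x)" for x
        using norm_triangle_ineq[of "f x - m x" "m x - h x"] by (simp add: norm_minus_commute)
    qed (use that in auto)
    also have "\<dots> = (\<integral>x. norm (m x - f x) \<partial>lborel) + (\<integral>x. norm (h x - m x) \<partial>lborel)"
      using that by simp
    finally show ?thesis using that by linarith
  qed
  have "(\<integral>x. norm (u x - ?w x) \<partial>lborel) < e"
    by (rule L[OF i(1) D(5) conv_integrable[OF mollifier_unit_kernel[OF dpos] D(5)] j(1) k(1)])
  moreover have "(\<integral>x. norm (g x - grad ?w x) \<partial>lborel) < e"
    unfolding gw by (rule L[OF i(2) D(6) conv_integrable[OF mollifier_unit_kernel[OF dpos] D(6)] j(2) k(2)])
  ultimately show ?thesis using \<open>?w \<in> test_functions \<Omega>\<close> by blast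
qed

section \<open>Zero-trace pairs and the closure of the test functions in W^{1,1}\<close>

lemma W11_norm_eq_lborel:
  fixes u :: "real^'n::finite \<Rightarrow> real"
  assumes \<Omega>: "open \<Omega>" and w: "has_weak_gradient \<Omega> u g"
    and u': "u' \<in> borel_measurable borel" "\<And>x. x \<notin> \<Omega> \<Longrightarrow> u' x = 0" "AE x in lborel. x \<in> \<Omega> \<longrightarrow> u x = u' x"
    and g': "g' \<in> borel_measurable borel" "\<And>x. x \<notin> \<Omega> \<Longrightarrow> g' x = 0" "AE x in lborel. x \<in> \<Omega> \<longrightarrow> g x = g' x"
  shows "W11_norm \<Omega> u = (\<integral>x. norm (u' x) \<partial>lborel) + (\<integral>x. norm (g' x) \<partial>lborel)"
proof -
  have \<Omega>': "\<Omega> \<in> sets borel" using \<Omega> by simp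
  note [measurable] = u'(1) g'(1)
  have "(\<integral>x. \<bar>u x\<bar> \<partial>lebesgue_on \<Omega>) = (\<integral>x. norm (u' x) \<partial>lborel)"
    by (rule integral_lebesgue_on_eq_lborel[OF \<Omega>']) (use u'(2,3) in \<open>auto elim: eventually_mono\<close>)
  moreover have "(\<integral>x. norm (weak_gradient \<Omega> u x) \<partial>lebesgue_on \<Omega>) = (\<integral>x. norm (g' x) \<partial>lborel)"
  proof (rule integral_lebesgue_on_eq_lborel[OF \<Omega>'])
    show "AE x in lborel. x \<in> \<Omega> \<longrightarrow> norm (weak_gradient \<Omega> u x) = norm (g' x)"
      using weak_gradient_AE_eq[OF \<Omega> w] g'(3) by eventually_elim auto
  qed (use g'(2) in auto)
  ultimately show ?thesis by (simp add: W11_norm_def)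
qed

text \<open>The pair vanishes outside \<Omega> only almost everywhere;
  \<open>W11_norm_eq_lborel\<close> asks for representatives that vanish there at every
  point.\<close>

lemma zero_trace_pair_vanish:
  assumes p: "zero_trace_pair \<Omega> u g" and \<Omega>: "\<Omega> \<in> sets borel"
  shows "zero_trace_pair \<Omega> (\<lambda>x. indicator \<Omega> x *\<^sub>R u x) (\<lambda>x. indicator \<Omega> x *\<^sub>R g x)"
proof -
  obtain \<psi> \<Psi> where s: "zero_trace_seq \<Omega> \<psi> \<Psi> u g" using p unfolding zero_trace_pair_def by blast
  note i = zero_trace_pair_integrable[OF p]
  note D = zero_trace_seqD[OF s]
  note o = zero_trace_pair_outside[OF p \<Omega>]
  have [measurable]: "u \<in> borel_measurable borel" "g \<in> borel_measurable borel"
    "\<psi> j \<in> borel_measurable borel" "\<Psi> j \<in> borel_measurable borel" for j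
    using i D(5,6) by auto
  note [measurable] = \<Omega>
  have I: "integrable lborel (\<lambda>x. indicator \<Omega> x *\<^sub>R u x)" "integrable lborel (\<lambda>x. indicator \<Omega> x *\<^sub>R g x)"
    using i \<Omega> by (auto intro!: integrable_mult_indicator simp del: real_scaleR_def)
  have "(\<integral>x. norm (\<psi> j x - indicator \<Omega> x *\<^sub>R u x) \<partial>lborel) = (\<integral>x. norm (\<psi> j x - u x) \<partial>lborel)" for j
    by (rule integral_cong_AE) (measurable, use o(1) in \<open>auto elim!: eventually_mono simp: indicator_def\<close>)
  moreover have "(\<integral>x. norm (\<Psi> j x - indicator \<Omega> x *\<^sub>R g x) \<partial>lborel) = (\<integral>x. norm (\<Psi> j x - g x) \<partial>lborel)" for j
    by (rule integral_cong_AE) (measurable, use o(2) in \<open>auto elim!: eventually_mono simp: indicator_def\<close>)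
  ultimately have "zero_trace_seq \<Omega> \<psi> \<Psi> (\<lambda>x. indicator \<Omega> x *\<^sub>R u x) (\<lambda>x. indicator \<Omega> x *\<^sub>R g x)"
    using s unfolding zero_trace_seq_def by (simp only: simp_thms)
  then show ?thesis unfolding zero_trace_pair_def using I by blast
qed

lemma zero_trace_pair_sobolev_W11_0:
  fixes u :: "real^'n::finite \<Rightarrow> real"
  assumes \<Omega>: "open \<Omega>" and p: "zero_trace_pair \<Omega> u g"
  shows "u \<in> sobolev_W11_0 \<Omega>"
proof -
  have \<Omega>': "\<Omega> \<in> sets borel" using \<Omega> by simp
  note i = zero_trace_pair_integrable[OF p]
  have w: "has_weak_gradient \<Omega> u g" by (rule zero_trace_pair_has_weak_gradient[OF \<Omega> p])
  have W: "u \<in> sobolev_W11 \<Omega>"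
    unfolding sobolev_W11_def mem_Collect_eq
    using w integrable_lebesgue_onI[OF \<Omega>' i(1)] integrable_lebesgue_onI[OF \<Omega>' i(2)]
    by (intro conjI exI[of _ g])
  let ?u = "\<lambda>x. indicator \<Omega> x *\<^sub>R u x" and ?g = "\<lambda>x. indicator \<Omega> x *\<^sub>R g x"
  note q = zero_trace_pair_vanish[OF p \<Omega>']
  note qi = zero_trace_pair_integrable[OF q]
  have "\<exists>\<psi>\<in>test_functions \<Omega>. W11_norm \<Omega> (\<lambda>x. u x - \<psi> x) < e" if e: "e > 0" for e
  proof -
    obtain \<psi> where \<psi>: "\<psi> \<in> test_functions \<Omega>" "(\<integral>x. norm (?u x - \<psi> x) \<partial>lborel) < e / 2"
      "(\<integral>x. norm (?g x - grad \<psi> x) \<partial>lborel) < e / 2"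
      using zero_trace_pair_approx_test[OF \<Omega> q, of "e/2"] e by auto
    obtain S where S: "C1_grad \<psi> (grad \<psi>)" "compact S" "S \<subseteq> \<Omega>" "\<And>x. x \<notin> S \<Longrightarrow> \<psi> x = 0" "\<And>x. x \<notin> S \<Longrightarrow> grad \<psi> x = 0"
      using test_function_C1[OF \<psi>(1)] by metis
    note bs = C1_grad_cont_bdd_supp(1,2)[OF S(1,2,4)]
    have [measurable]: "?u \<in> borel_measurable borel" "?g \<in> borel_measurable borel"
      "\<psi> \<in> borel_measurable borel" "grad \<psi> \<in> borel_measurable borel"
      using qi cont_bdd_supp_measurable[OF bs(1)] cont_bdd_supp_measurable[OF bs(2)] by (auto simp del: real_scaleR_def)
    have "W11_norm \<Omega> (\<lambda>x. u x - \<psi> x) = (\<integral>x. norm (?u x - \<psi> x) \<partial>lborel) + (\<integral>x. norm (?g x - grad \<psi> x) \<partial>lborel)"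
    proof (rule W11_norm_eq_lborel[OF \<Omega> has_weak_gradient_diff[OF \<Omega> w C1_grad_has_weak_gradient[OF \<Omega> S(1)]]])
      fix x assume "x \<notin> \<Omega>"
      moreover from this have "x \<notin> S" using S(3) by blast
      ultimately show "?u x - \<psi> x = 0" "?g x - grad \<psi> x = 0" by (simp_all add: S(4,5))
    next
      show "(\<lambda>x. ?u x - \<psi> x) \<in> borel_measurable borel" "(\<lambda>x. ?g x - grad \<psi> x) \<in> borel_measurable borel"
        by measurable
    qed simp_all
    then show ?thesis using \<psi> by (intro bexI[of _ \<psi>]) auto
  qed
  then show ?thesis using W by (simp add: sobolev_W11_0_def)
qed

text \<open>The converse of \<open>zero_trace_pair_sobolev_W11_0\<close>. Test functions within
  1/(j+1) of \<phi> in the W^{1,1} norm approximate its Borel representatives, because the norm may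
  be computed from these on the whole space.\<close>

lemma sobolev_W11_0_pair:
  fixes \<phi> :: "real^'n::finite \<Rightarrow> real"
  assumes \<Omega>: "open \<Omega>" and \<phi>: "\<phi> \<in> sobolev_W11_0 \<Omega>"
  obtains u g where "zero_trace_pair \<Omega> u g" "has_weak_gradient \<Omega> \<phi> (weak_gradient \<Omega> \<phi>)"
    "AE x in lborel. x \<in> \<Omega> \<longrightarrow> weak_gradient \<Omega> \<phi> x = g x" "\<forall>x. x \<notin> \<Omega> \<longrightarrow> u x = 0 \<and> g x = 0"
proof -
  have \<Omega>': "\<Omega> \<in> sets borel" using \<Omega> by simp
  obtain g0 where g0: "integrable (lebesgue_on \<Omega>) \<phi>" "has_weak_gradient \<Omega> \<phi> g0" "integrable (lebesgue_on \<Omega>) g0"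
    using \<phi> by (auto simp: sobolev_W11_0_def sobolev_W11_def)
  obtain u where u: "integrable lborel u" "\<And>x. x \<notin> \<Omega> \<Longrightarrow> u x = 0" "AE x in lborel. x \<in> \<Omega> \<longrightarrow> \<phi> x = u x"
    using borel_representative[OF \<Omega>' g0(1)] by blast
  obtain g where g: "integrable lborel g" "\<And>x. x \<notin> \<Omega> \<Longrightarrow> g x = 0" "AE x in lborel. x \<in> \<Omega> \<longrightarrow> g0 x = g x"
    using borel_representative[OF \<Omega>' g0(3)] by blast
  have "\<exists>\<psi>\<in>test_functions \<Omega>. W11_norm \<Omega> (\<lambda>x. \<phi> x - \<psi> x) < inverse (real (Suc j))" for j
    using \<phi> by (simp add: sobolev_W11_0_def del: of_nat_Suc)
  then obtain \<psi> where \<psi>: "\<And>j. \<psi> j \<in> test_functions \<Omega>"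
    "\<And>j. W11_norm \<Omega> (\<lambda>x. \<phi> x - \<psi> j x) < inverse (real (Suc j))" by metis
  have b: "(\<integral>x. norm (\<psi> j x - u x) \<partial>lborel) + (\<integral>x. norm (grad (\<psi> j) x - g x) \<partial>lborel) \<le> inverse (real (Suc j))" for j
  proof -
    obtain S where S: "C1_grad (\<psi> j) (grad (\<psi> j))" "compact S" "S \<subseteq> \<Omega>" "\<And>x. x \<notin> S \<Longrightarrow> \<psi> j x = 0" "\<And>x. x \<notin> S \<Longrightarrow> grad (\<psi> j) x = 0"
      using test_function_C1[OF \<psi>(1)[of j]] by metis
    note bs = C1_grad_cont_bdd_supp(1,2)[OF S(1,2,4)]
    have [measurable]: "u \<in> borel_measurable borel" "g \<in> borel_measurable borel"
      "\<psi> j \<in> borel_measurable borel" "grad (\<psi> j) \<in> borel_measurable borel"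
      using u(1) g(1) cont_bdd_supp_measurable[OF bs(1)] cont_bdd_supp_measurable[OF bs(2)] by auto
    have "W11_norm \<Omega> (\<lambda>x. \<phi> x - \<psi> j x) = (\<integral>x. norm (u x - \<psi> j x) \<partial>lborel) + (\<integral>x. norm (g x - grad (\<psi> j) x) \<partial>lborel)"
    proof (rule W11_norm_eq_lborel[OF \<Omega> has_weak_gradient_diff[OF \<Omega> g0(2) C1_grad_has_weak_gradient[OF \<Omega> S(1)]]])
      fix x assume "x \<notin> \<Omega>"
      moreover from this have "x \<notin> S" using S(3) by blast
      ultimately show "u x - \<psi> j x = 0" "g x - grad (\<psi> j) x = 0" by (simp_all add: S(4,5) u(2) g(2))
    next
      show "(\<lambda>x. u x - \<psi> j x) \<in> borel_measurable borel" "(\<lambda>x. g x - grad (\<psi> j) x) \<in> borel_measurable borel"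
        by measurable
      show "AE x in lborel. x \<in> \<Omega> \<longrightarrow> \<phi> x - \<psi> j x = u x - \<psi> j x" using u(3) by eventually_elim auto
      show "AE x in lborel. x \<in> \<Omega> \<longrightarrow> g0 x - grad (\<psi> j) x = g x - grad (\<psi> j) x" using g(3) by eventually_elim auto
    qed
    then show ?thesis using \<psi>(2)[of j] by (simp add: norm_minus_commute abs_minus_commute)
  qed
  have "zero_trace_seq \<Omega> \<psi> (\<lambda>j. grad (\<psi> j)) u g"
    unfolding zero_trace_seq_def
  proof (intro conjI allI)
    show "C1_grad (\<psi> j) (grad (\<psi> j))" for j using test_function_C1[OF \<psi>(1)[of j]] by metis
    show "\<exists>S. compact S \<and> S \<subseteq> \<Omega> \<and> (\<forall>x. x \<notin> S \<longrightarrow> \<psi> j x = 0)" for j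
      using test_functionsE[OF \<psi>(1)[of j]] by metis
    have nn: "(\<integral>x. norm (\<psi> j x - u x) \<partial>lborel) \<ge> 0" "(\<integral>x. norm (grad (\<psi> j) x - g x) \<partial>lborel) \<ge> 0" for j
      by simp_all
    have A: "norm c \<le> t" if "0 \<le> c" "c \<le> t" for c t :: real using that by simp
    have "norm (\<integral>x. norm (\<psi> j x - u x) \<partial>lborel) \<le> inverse (real (Suc j))" for j
      by (rule A[OF nn(1)]) (use b[of j] nn(2)[of j] in linarith)
    then show "(\<lambda>j. \<integral>x. norm (\<psi> j x - u x) \<partial>lborel) \<longlonglongrightarrow> 0"
      by (intro Lim_null_comparison[OF always_eventually LIMSEQ_inverse_real_of_nat] allI)
    have "norm (\<integral>x. norm (grad (\<psi> j) x - g x) \<partial>lborel) \<le> inverse (real (Suc j))" for j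
      by (rule A[OF nn(2)]) (use b[of j] nn(1)[of j] in linarith)
    then show "(\<lambda>j. \<integral>x. norm (grad (\<psi> j) x - g x) \<partial>lborel) \<longlonglongrightarrow> 0"
      by (intro Lim_null_comparison[OF always_eventually LIMSEQ_inverse_real_of_nat] allI)
  qed
  then have p: "zero_trace_pair \<Omega> u g" unfolding zero_trace_pair_def using u(1) g(1) by blast
  have w: "has_weak_gradient \<Omega> \<phi> (weak_gradient \<Omega> \<phi>)"
    unfolding weak_gradient_def by (rule someI[of "has_weak_gradient \<Omega> \<phi>", OF g0(2)])
  have ae: "AE x in lborel. x \<in> \<Omega> \<longrightarrow> weak_gradient \<Omega> \<phi> x = g x"
    using weak_gradient_AE_eq[OF \<Omega> g0(2)] g(3) by eventually_elim auto
  show ?thesis by (rule that[OF p w ae]) (simp add: u(2) g(2))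
qed

section \<open>Modular convergence\<close>

text \<open>Convexity in the form of a supporting line, ready to be integrated against a kernel for
  Jensen's inequality.\<close>

lemma powr_above_tangent:
  fixes s t p :: real
  assumes p: "p \<ge> 1" and s: "s \<ge> 0" and t: "t \<ge> 0"
  shows "s powr p + p * s powr (p - 1) * (t - s) \<le> t powr p"
\<comment> \<open>The tangent theorem is applied on the open half-line, so the end points are done
  by hand. At s = 0 the slope is 0, since \<open>0 powr r = 0\<close> for every r, including r =
  0.\<close>
proof (cases "s = 0 \<or> t = 0")
  case True
  then show ?thesis
  proof
    assume "t = 0"
    have "s powr p = s powr (p - 1) * s"
      using s by (cases "s = 0") (auto simp: powr_diff)
    then have "s powr p + p * s powr (p - 1) * (t - s) = (1 - p) * s powr p"
      using \<open>t = 0\<close> by (simp add: algebra_simps)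
    also have "\<dots> \<le> 0" using p by (simp add: mult_nonpos_nonneg)
    finally show ?thesis using \<open>t = 0\<close> by simp
  qed simp
next
  case False
  then have st: "s > 0" "t > 0" using s t by auto
  have "t powr p - s powr p \<ge> p * s powr (p - 1) * (t - s)"
  proof (rule convex_on_imp_above_tangent[where A="{0<..}"])
    show "convex_on {0<..} (\<lambda>x. x powr p)" by (rule powr_convex[OF p])
    have "((\<lambda>x. x powr p) has_real_derivative p * s powr (p - 1)) (at s)"
      using st(1) by (rule has_real_derivative_powr)
    then show "((\<lambda>x. x powr p) has_real_derivative p * s powr (p - 1)) (at s within {0<..})"
      by (rule has_field_derivative_at_within)
  qed (use st in \<open>auto simp: interior_open\<close>)
  then show ?thesis by simp
qed

text \<open>Jensen's inequality for the probability density K(x - y): the supporting line at the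
  average s is integrated. The majorant B need dominate the power of f only where the kernel is
  nonzero, because at the other points both sides carry the factor 0.\<close>

lemma conv_powr_le:
  fixes f B :: "real^'n::finite \<Rightarrow> real"
  assumes K: "unit_kernel K" and p: "p \<ge> 1" and f: "integrable lborel f" "\<And>y. f y \<ge> 0"
    and B: "integrable lborel B" "AE y in lborel. K (x - y) \<noteq> 0 \<longrightarrow> f y powr p \<le> B y"
  shows "conv K f x powr p \<le> conv K B x"
proof -
  have Kc: "cont_bdd_supp K" and pos: "\<And>z. K z \<ge> 0" and one: "(\<integral>z. K z \<partial>lborel) = 1"
    using K by (auto simp: unit_kernel_def)
  define s where "s = conv K f x"
  have s: "s \<ge> 0" unfolding s_def conv_def by (intro integral_nonneg_AE AE_I2) (simp add: pos f(2))
  let ?c = "p * s powr (p - 1)"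
  have iK: "integrable lborel (\<lambda>y. K (x - y))" "(\<integral>y. K (x - y) \<partial>lborel) = 1"
    using integrable_lborel_reflect[OF cont_bdd_supp_integrable[OF Kc], of x]
      integral_lborel_reflect[OF cont_bdd_supp_integrable[OF Kc], of x] one by simp_all
  have if': "integrable lborel (\<lambda>y. K (x - y) * f y)" and iB: "integrable lborel (\<lambda>y. K (x - y) * B y)"
    using conv_integrand_integrable[OF Kc f(1), of x] conv_integrand_integrable[OF Kc B(1), of x] by simp_all
  have "s powr p = (\<integral>y. (s powr p - ?c * s) * K (x - y) + ?c * (K (x - y) * f y) \<partial>lborel)"
    using iK if' by (simp add: s_def conv_def)
  also have "\<dots> \<le> (\<integral>y. K (x - y) * B y \<partial>lborel)"
  proof (rule integral_mono_AE)
    show "AE y in lborel. (s powr p - ?c * s) * K (x - y) + ?c * (K (x - y) * f y) \<le> K (x - y) * B y"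
      using B(2)
    proof eventually_elim
      case (elim y)
      have "s powr p + ?c * (f y - s) \<le> f y powr p" by (rule powr_above_tangent[OF p s f(2)])
      then have "K (x - y) \<noteq> 0 \<Longrightarrow> s powr p + ?c * (f y - s) \<le> B y" using elim by linarith
      then have "K (x - y) * (s powr p + ?c * (f y - s)) \<le> K (x - y) * B y"
        using pos[of "x - y"] by (cases "K (x - y) = 0") (auto intro: mult_left_mono)
      then show ?case by (simp add: algebra_simps)
    qed
  qed (use iK if' iB in auto)
  finally show ?thesis by (simp add: s_def conv_def)
qed

section \<open>Inequalities for the energy density\<close>

lemma powr_add_le:
  fixes s t :: real
  assumes "s \<ge> 0" "t \<ge> 0" "q \<ge> 0"
  shows "(s + t) powr q \<le> 2 powr q * (s powr q + t powr q)"
proof -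
  have "(s + t) powr q \<le> (2 * max s t) powr q" using assms by (intro powr_mono2) auto
  also have "\<dots> = 2 powr q * max s t powr q" by (rule powr_mult)
  also have "max s t powr q \<le> s powr q + t powr q" by (simp add: max_def)
  finally show ?thesis by simp
qed

definition phase_density :: "real \<Rightarrow> real \<Rightarrow> real \<Rightarrow> 'v::real_normed_vector \<Rightarrow> real" where
  "phase_density p q c v = norm v powr p + c * norm v powr q"

lemma phase_density_nonneg: "c \<ge> 0 \<Longrightarrow> phase_density p q c v \<ge> 0"
  by (simp add: phase_density_def)

lemma phase_density_mono:
  assumes "0 \<le> p" "0 \<le> q" "c \<ge> 0" "norm v \<le> norm w"
  shows "phase_density p q c v \<le> phase_density p q c w"
  unfolding phase_density_def using assms by (intro add_mono mult_left_mono powr_mono2) auto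

lemma phase_density_add:
  assumes "0 \<le> p" "p \<le> q" "c \<ge> 0"
  shows "phase_density p q c (v + w) \<le> 2 powr q * (phase_density p q c v + phase_density p q c w)"
proof -
  have n: "norm (v + w) \<le> norm v + norm w" by (rule norm_triangle_ineq)
  have "norm (v + w) powr p \<le> 2 powr p * (norm v powr p + norm w powr p)"
    using powr_mono2[OF assms(1) norm_ge_zero n] powr_add_le[of "norm v" "norm w" p] assms by simp
  also have "\<dots> \<le> 2 powr q * (norm v powr p + norm w powr p)"
    using assms by (intro mult_right_mono powr_mono) auto
  finally have 1: "norm (v + w) powr p \<le> 2 powr q * (norm v powr p + norm w powr p)" .
  have "norm (v + w) powr q \<le> 2 powr q * (norm v powr q + norm w powr q)"
    using powr_mono2[OF _ norm_ge_zero n, of q] powr_add_le[of "norm v" "norm w" q] assms by simp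
  then have "c * norm (v + w) powr q \<le> c * (2 powr q * (norm v powr q + norm w powr q))"
    using assms(3) by (rule mult_left_mono)
  with 1 show ?thesis by (simp add: phase_density_def algebra_simps)
qed

lemma phase_density_scale:
  assumes "0 \<le> p" "p \<le> q" "c \<ge> 0" "\<bar>l\<bar> \<le> M" "M \<ge> 1"
  shows "phase_density p q c (l *\<^sub>R v) \<le> M powr q * phase_density p q c v"
proof -
  have "\<bar>l\<bar> powr p \<le> M powr q"
    using powr_mono2[of p "\<bar>l\<bar>" M] powr_mono[of p q M] assms by auto
  moreover have "\<bar>l\<bar> powr q \<le> M powr q"
    using assms by (intro powr_mono2) auto
  ultimately have "\<bar>l\<bar> powr p * norm v powr p + c * (\<bar>l\<bar> powr q * norm v powr q) \<le>
      M powr q * norm v powr p + c * (M powr q * norm v powr q)"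
    using assms(3) by (intro add_mono mult_left_mono mult_right_mono) auto
  then show ?thesis by (simp add: phase_density_def powr_mult algebra_simps)
qed

lemma phase_density_tendsto:
  assumes "0 < p" "0 < q" "(f \<longlongrightarrow> v) F"
  shows "((\<lambda>j. phase_density p q c (f j)) \<longlongrightarrow> phase_density p q c v) F"
  unfolding phase_density_def
  by (intro tendsto_intros tendsto_powr' tendsto_norm assms(3)) (use assms in auto)

lemma borel_measurable_lebesgue_on:
  fixes f :: "'a::euclidean_space \<Rightarrow> 'b::topological_space"
  shows "f \<in> borel_measurable borel \<Longrightarrow> f \<in> borel_measurable (lebesgue_on \<Omega>)"
  by (intro measurable_restrict_space1 measurable_completion) simp

lemma borel_measurable_phase_density [measurable (raw)]:
  fixes f :: "'a \<Rightarrow> 'v::euclidean_space"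
  assumes [measurable]: "c \<in> borel_measurable M" "f \<in> borel_measurable M"
  shows "(\<lambda>x. phase_density p q (c x) (f x)) \<in> borel_measurable M"
  unfolding phase_density_def by measurable

text \<open>A dominated convergence theorem for the upper bound only, with dominating functions that
  converge in \<open>L\<^sup>1\<close>: truncating at the limit \<open>h\<close> of the bounds costs at most \<open>\<integral>\<bar>h\<^sub>j - h\<bar>\<close>.\<close>

lemma nn_integral_ge_of_limit:
  fixes E :: "'a \<Rightarrow> real" and c :: ennreal
  assumes E: "E \<in> borel_measurable M" "\<And>j. Ej j \<in> borel_measurable M"
    and pos: "AE x in M. 0 \<le> E x" "\<And>j. AE x in M. 0 \<le> Ej j x"
    and h: "integrable M h" "\<And>j. integrable M (hj j)" "(\<lambda>j::nat. \<integral>x. \<bar>hj j x - h x\<bar> \<partial>M) \<longlonglongrightarrow> 0"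
    and le: "\<And>j. AE x in M. Ej j x \<le> hj j x"
    and lim: "AE x in M. (\<lambda>j. Ej j x) \<longlonglongrightarrow> E x"
    and c: "\<And>j. c \<le> (\<integral>\<^sup>+x. ennreal (Ej j x) \<partial>M)"
  shows "c \<le> (\<integral>\<^sup>+x. ennreal (E x) \<partial>M)"
proof -
  note [measurable] = E
  have [measurable]: "h \<in> borel_measurable M" "hj j \<in> borel_measurable M" for j using h by auto
  have I: "integrable M (\<lambda>x. min (Ej j x) \<bar>h x\<bar>)" "integrable M (\<lambda>x. min (E x) \<bar>h x\<bar>)" for j
  proof -
    show "integrable M (\<lambda>x. min (Ej j x) \<bar>h x\<bar>)"
    proof (rule Bochner_Integration.integrable_bound[OF h(1)])
      show "AE x in M. norm (min (Ej j x) \<bar>h x\<bar>) \<le> norm (h x)" using pos(2)[of j] by eventually_elim auto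
    qed measurable
    show "integrable M (\<lambda>x. min (E x) \<bar>h x\<bar>)"
    proof (rule Bochner_Integration.integrable_bound[OF h(1)])
      show "AE x in M. norm (min (E x) \<bar>h x\<bar>) \<le> norm (h x)" using pos(1) by eventually_elim auto
    qed measurable
  qed
  have d: "integrable M (\<lambda>x. \<bar>hj j x - h x\<bar>)" for j using h by simp
  have "c \<le> ennreal ((\<integral>x. min (Ej j x) \<bar>h x\<bar> \<partial>M) + (\<integral>x. \<bar>hj j x - h x\<bar> \<partial>M))" for j
  proof -
    have "c \<le> (\<integral>\<^sup>+x. ennreal (Ej j x) \<partial>M)" by (rule c)
    also have "\<dots> \<le> (\<integral>\<^sup>+x. ennreal (min (Ej j x) \<bar>h x\<bar> + \<bar>hj j x - h x\<bar>) \<partial>M)"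
    proof (rule nn_integral_mono_AE)
      show "AE x in M. ennreal (Ej j x) \<le> ennreal (min (Ej j x) \<bar>h x\<bar> + \<bar>hj j x - h x\<bar>)"
        using le[of j]
      proof eventually_elim
        case (elim x)
        then show ?case by (intro ennreal_leI) linarith
      qed
    qed
    also have "\<dots> = ennreal (\<integral>x. min (Ej j x) \<bar>h x\<bar> + \<bar>hj j x - h x\<bar> \<partial>M)"
      by (rule nn_integral_eq_integral) (use I(1)[of j] d[of j] pos(2)[of j] in \<open>auto elim!: eventually_mono\<close>)
    finally show ?thesis using I(1)[of j] d[of j] by simp
  qed
  moreover have "(\<lambda>j. ennreal ((\<integral>x. min (Ej j x) \<bar>h x\<bar> \<partial>M) + (\<integral>x. \<bar>hj j x - h x\<bar> \<partial>M)))
      \<longlonglongrightarrow> ennreal ((\<integral>x. min (E x) \<bar>h x\<bar> \<partial>M) + 0)"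
  proof (intro tendsto_ennrealI tendsto_add h(3))
    show "(\<lambda>j. \<integral>x. min (Ej j x) \<bar>h x\<bar> \<partial>M) \<longlonglongrightarrow> (\<integral>x. min (E x) \<bar>h x\<bar> \<partial>M)"
    proof (rule integral_dominated_convergence)
      show "integrable M (\<lambda>x. \<bar>h x\<bar>)" using h(1) by simp
      show "AE x in M. (\<lambda>j. min (Ej j x) \<bar>h x\<bar>) \<longlonglongrightarrow> min (E x) \<bar>h x\<bar>"
        using lim by eventually_elim (intro tendsto_min tendsto_const)
      show "AE x in M. norm (min (Ej j x) \<bar>h x\<bar>) \<le> \<bar>h x\<bar>" for j
        using pos(2)[of j] by eventually_elim auto
    qed measurable
  qed
  ultimately have "c \<le> ennreal (\<integral>x. min (E x) \<bar>h x\<bar> \<partial>M)"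
    by (intro LIMSEQ_le_const) auto
  also have "\<dots> = (\<integral>\<^sup>+x. ennreal (min (E x) \<bar>h x\<bar>) \<partial>M)"
    by (rule nn_integral_eq_integral[symmetric]) (use I(2) pos(1) in \<open>auto elim!: eventually_mono\<close>)
  also have "\<dots> \<le> (\<integral>\<^sup>+x. ennreal (E x) \<partial>M)"
    by (rule nn_integral_mono) (simp add: ennreal_leI)
  finally show ?thesis .
qed

text \<open>Domination by an L^1-convergent sequence is recorded instead of convergence of the
  energies: it is stable under finite sums, up to a factor 2^q, and under adding the fixed gradient
  of the datum.\<close>

definition modular_limit ::
    "real \<Rightarrow> real \<Rightarrow> (real^'n::finite \<Rightarrow> real) \<Rightarrow> (real^'n) set \<Rightarrow> (real^'n \<Rightarrow> real^'n) \<Rightarrow> bool" where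
  "modular_limit p q a \<Omega> g \<longleftrightarrow> (\<exists>w h H.
     (\<forall>j. w j \<in> test_functions \<Omega>) \<and> (\<forall>j. integrable lborel (h j)) \<and> integrable lborel H \<and>
     (\<lambda>j::nat. \<integral>x. norm (h j x - H x) \<partial>lborel) \<longlonglongrightarrow> 0 \<and>
     (AE x in lborel. x \<in> \<Omega> \<longrightarrow> (\<lambda>j. grad (w j) x) \<longlonglongrightarrow> g x) \<and>
     (\<forall>j. AE x in lborel. x \<in> \<Omega> \<longrightarrow> phase_density p q (a x) (grad (w j) x) \<le> h j x))"

lemma test_functions_zero: "(\<lambda>x. 0) \<in> test_functions \<Omega>"
  by (rule test_functionsI[of _ "{}"]) (auto intro: times_cont_diff_const)

lemma test_functions_add:
  assumes "\<phi> \<in> test_functions \<Omega>" "\<psi> \<in> test_functions \<Omega>"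
  shows "(\<lambda>x. \<phi> x + \<psi> x) \<in> test_functions \<Omega>"
proof -
  obtain S where S: "\<And>k. times_cont_diff k \<phi>" "compact S" "S \<subseteq> \<Omega>" "\<And>x. x \<notin> S \<Longrightarrow> \<phi> x = 0"
    using test_functionsE[OF assms(1)] by metis
  obtain T where T: "\<And>k. times_cont_diff k \<psi>" "compact T" "T \<subseteq> \<Omega>" "\<And>x. x \<notin> T \<Longrightarrow> \<psi> x = 0"
    using test_functionsE[OF assms(2)] by metis
  show ?thesis
    by (rule test_functionsI[of _ "S \<union> T"])
      (use S(2-4) T(2-4) in \<open>auto intro: times_cont_diff_add[OF S(1) T(1)]\<close>)
qed

lemma grad_C1: "C1_grad f F \<Longrightarrow> grad f x = F x"
  by (rule grad_eq) (simp add: C1_grad_def)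

lemma test_function_C1_grad: "\<phi> \<in> test_functions \<Omega> \<Longrightarrow> C1_grad \<phi> (grad \<phi>)"
  using test_function_C1 by metis

lemma modular_limit_add:
  assumes pq: "0 \<le> p" "p \<le> q" and a: "\<And>x. x \<in> \<Omega> \<Longrightarrow> 0 \<le> a x"
    and g1: "modular_limit p q a \<Omega> g1" and g2: "modular_limit p q a \<Omega> g2"
  shows "modular_limit p q a \<Omega> (\<lambda>x. g1 x + g2 x)"
proof -
  obtain w1 h1 H1 where 1: "\<forall>j. w1 j \<in> test_functions \<Omega>" "\<forall>j. integrable lborel (h1 j)" "integrable lborel H1"
     "(\<lambda>j::nat. \<integral>x. norm (h1 j x - H1 x) \<partial>lborel) \<longlonglongrightarrow> 0"
     "AE x in lborel. x \<in> \<Omega> \<longrightarrow> (\<lambda>j. grad (w1 j) x) \<longlonglongrightarrow> g1 x"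
     "\<forall>j. AE x in lborel. x \<in> \<Omega> \<longrightarrow> phase_density p q (a x) (grad (w1 j) x) \<le> h1 j x"
    using g1 unfolding modular_limit_def by (elim exE conjE) (rule that)
  obtain w2 h2 H2 where 2: "\<forall>j. w2 j \<in> test_functions \<Omega>" "\<forall>j. integrable lborel (h2 j)" "integrable lborel H2"
     "(\<lambda>j::nat. \<integral>x. norm (h2 j x - H2 x) \<partial>lborel) \<longlonglongrightarrow> 0"
     "AE x in lborel. x \<in> \<Omega> \<longrightarrow> (\<lambda>j. grad (w2 j) x) \<longlonglongrightarrow> g2 x"
     "\<forall>j. AE x in lborel. x \<in> \<Omega> \<longrightarrow> phase_density p q (a x) (grad (w2 j) x) \<le> h2 j x"
    using g2 unfolding modular_limit_def by (elim exE conjE) (rule that)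
  let ?w = "\<lambda>j x. w1 j x + w2 j x" and ?h = "\<lambda>j x. 2 powr q * (h1 j x + h2 j x)"
    and ?H = "\<lambda>x. 2 powr q * (H1 x + H2 x)"
  have gw: "grad (?w j) x = grad (w1 j) x + grad (w2 j) x" for j x
    by (rule grad_C1[OF C1_grad_add]) (use 1(1) 2(1) test_function_C1_grad in auto)
  show ?thesis
    unfolding modular_limit_def
  proof (intro exI conjI allI)
    show "?w j \<in> test_functions \<Omega>" for j using 1(1) 2(1) by (intro test_functions_add) auto
    show "integrable lborel (?h j)" for j using 1(2) 2(2) by simp
    show "integrable lborel ?H" using 1(3) 2(3) by simp
    have lim: "(\<lambda>j. 2 powr q * ((\<integral>x. norm (h1 j x - H1 x) \<partial>lborel) + (\<integral>x. norm (h2 j x - H2 x) \<partial>lborel))) \<longlonglongrightarrow> 0"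
      using tendsto_mult_right_zero[OF tendsto_add_zero[OF 1(4) 2(4)]] by simp
    have "norm (\<integral>x. norm (?h j x - ?H x) \<partial>lborel) \<le>
        2 powr q * ((\<integral>x. norm (h1 j x - H1 x) \<partial>lborel) + (\<integral>x. norm (h2 j x - H2 x) \<partial>lborel))" for j
    proof -
      have i: "integrable lborel (h1 j)" "integrable lborel (h2 j)" using 1(2) 2(2) by auto
      have "(\<integral>x. norm (?h j x - ?H x) \<partial>lborel) \<le>
        (\<integral>x. 2 powr q * (norm (h1 j x - H1 x) + norm (h2 j x - H2 x)) \<partial>lborel)"
      proof (rule integral_mono)
        fix x
        have "norm (?h j x - ?H x) = 2 powr q * norm ((h1 j x - H1 x) + (h2 j x - H2 x))"
        proof -
          have "?h j x - ?H x = 2 powr q * ((h1 j x - H1 x) + (h2 j x - H2 x))"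
            by (simp add: algebra_simps)
          then show ?thesis by (simp only: real_norm_def abs_mult abs_of_nonneg[OF powr_ge_zero])
        qed
        also have "\<dots> \<le> 2 powr q * (norm (h1 j x - H1 x) + norm (h2 j x - H2 x))"
          by (intro mult_left_mono norm_triangle_ineq) simp
        finally show "norm (?h j x - ?H x) \<le> 2 powr q * (norm (h1 j x - H1 x) + norm (h2 j x - H2 x))" .
      qed (use i 1(3) 2(3) in simp_all)
      then show ?thesis using i 1(3) 2(3) by simp
    qed
    then show "(\<lambda>j. \<integral>x. norm (?h j x - ?H x) \<partial>lborel) \<longlonglongrightarrow> 0"
      by (intro Lim_null_comparison[OF always_eventually lim] allI)
    show "AE x in lborel. x \<in> \<Omega> \<longrightarrow> (\<lambda>j. grad (?w j) x) \<longlonglongrightarrow> g1 x + g2 x"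
      unfolding gw using 1(5) 2(5) by eventually_elim (auto intro: tendsto_add)
    show "AE x in lborel. x \<in> \<Omega> \<longrightarrow> phase_density p q (a x) (grad (?w j) x) \<le> ?h j x" for j
      unfolding gw using 1(6)[rule_format, of j] 2(6)[rule_format, of j]
    proof eventually_elim
      case (elim x)
      show ?case
      proof
        assume x: "x \<in> \<Omega>"
        have "phase_density p q (a x) (grad (w1 j) x + grad (w2 j) x) \<le>
          2 powr q * (phase_density p q (a x) (grad (w1 j) x) + phase_density p q (a x) (grad (w2 j) x))"
          by (rule phase_density_add[OF pq a[OF x]])
        also have "\<dots> \<le> ?h j x" using elim x by (intro mult_left_mono add_mono) auto
        finally show "phase_density p q (a x) (grad (w1 j) x + grad (w2 j) x) \<le> ?h j x" .
      qed
    qed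
  qed
qed

lemma modular_limit_zero:
  assumes "0 < p" "0 < q"
  shows "modular_limit p q a \<Omega> (\<lambda>x. 0)"
proof -
  have C: "C1_grad (\<lambda>x. 0) (\<lambda>x. 0)" by (simp add: C1_grad_def)
  note g = grad_C1[OF C]
  show ?thesis
    unfolding modular_limit_def
    by (rule exI[of _ "\<lambda>j x. 0"], rule exI[of _ "\<lambda>j x. 0"], rule exI[of _ "\<lambda>x. 0"])
      (use assms in \<open>simp add: test_functions_zero g phase_density_def\<close>)
qed

lemma modular_limit_sum:
  assumes pq: "0 < p" "p \<le> q" and a: "\<And>x. x \<in> \<Omega> \<Longrightarrow> 0 \<le> a x"
    and "finite I" and g: "\<And>i. i \<in> I \<Longrightarrow> modular_limit p q a \<Omega> (g i)"
  shows "modular_limit p q a \<Omega> (\<lambda>x. \<Sum>i\<in>I. g i x)"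
  using assms(4) g
proof (induction I rule: finite_induct)
  case empty
  show ?case using modular_limit_zero[of p q a \<Omega>] pq by simp
next
  case (insert i I)
  have "modular_limit p q a \<Omega> (\<lambda>x. g i x + (\<Sum>i\<in>I. g i x))"
    using insert by (intro modular_limit_add[OF less_imp_le[OF pq(1)] pq(2) a]) auto
  with insert show ?case by simp
qed

lemma modular_limit_cong:
  assumes "modular_limit p q a \<Omega> g" "AE x in lborel. x \<in> \<Omega> \<longrightarrow> g x = g' x"
  shows "modular_limit p q a \<Omega> g'"
proof -
  obtain w h H where 1: "\<forall>j. w j \<in> test_functions \<Omega>" "\<forall>j. integrable lborel (h j)" "integrable lborel H"
     "(\<lambda>j::nat. \<integral>x. norm (h j x - H x) \<partial>lborel) \<longlonglongrightarrow> 0"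
     "AE x in lborel. x \<in> \<Omega> \<longrightarrow> (\<lambda>j. grad (w j) x) \<longlonglongrightarrow> g x"
     "\<forall>j. AE x in lborel. x \<in> \<Omega> \<longrightarrow> phase_density p q (a x) (grad (w j) x) \<le> h j x"
    using assms(1) unfolding modular_limit_def by (elim exE conjE) (rule that)
  have "AE x in lborel. x \<in> \<Omega> \<longrightarrow> (\<lambda>j. grad (w j) x) \<longlonglongrightarrow> g' x"
    using 1(5) assms(2) by eventually_elim auto
  with 1 show ?thesis unfolding modular_limit_def by (intro exI conjI)
qed

lemma double_phase_eq:
  assumes "open \<Omega>" "has_weak_gradient \<Omega> u g"
  shows "double_phase p q a \<Omega> u = (\<integral>\<^sup>+x. ennreal (phase_density p q (a x) (g x)) \<partial>lebesgue_on \<Omega>)"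
proof -
  have "AE x in lebesgue_on \<Omega>. weak_gradient \<Omega> u x = g x"
    using weak_gradient_AE_eq[OF assms] assms(1) by (subst AE_lebesgue_on_iff) auto
  then show ?thesis
    unfolding double_phase_def phase_density_def
    by (intro nn_integral_cong_AE) (auto elim!: eventually_mono)
qed

text \<open>Adding the gradient of the datum turns the dominating functions into 2^q (D0 + h_j),
  where D0, the density of the datum, is integrable because the datum has finite energy. Each
  approximant is admissible in the infimum, so the infimum passes to the limit.\<close>

lemma INF_test_le_modular_limit:
  fixes u\<^sub>0 :: "real^'n::finite \<Rightarrow> real"
  assumes \<Omega>: "open \<Omega>" and pq: "0 < p" "p \<le> q"
    and a: "a \<in> borel_measurable (lebesgue_on \<Omega>)" "\<And>x. x \<in> \<Omega> \<Longrightarrow> 0 \<le> a x"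
    and u0: "has_weak_gradient \<Omega> u\<^sub>0 g0" "integrable lborel g0" "double_phase p q a \<Omega> u\<^sub>0 < \<infinity>"
    and g: "g \<in> borel_measurable borel" "modular_limit p q a \<Omega> g"
  shows "(INF w\<in>translate u\<^sub>0 (test_functions \<Omega>). double_phase p q a \<Omega> w) \<le>
    (\<integral>\<^sup>+x. ennreal (phase_density p q (a x) (g0 x + g x)) \<partial>lebesgue_on \<Omega>)"
proof -
  let ?M = "lebesgue_on \<Omega>"
  have \<Omega>': "\<Omega> \<in> sets borel" using \<Omega> by simp
  obtain w h H where 1: "\<forall>j. w j \<in> test_functions \<Omega>" "\<forall>j. integrable lborel (h j)" "integrable lborel H"
     "(\<lambda>j::nat. \<integral>x. norm (h j x - H x) \<partial>lborel) \<longlonglongrightarrow> 0"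
     "AE x in lborel. x \<in> \<Omega> \<longrightarrow> (\<lambda>j. grad (w j) x) \<longlonglongrightarrow> g x"
     "\<forall>j. AE x in lborel. x \<in> \<Omega> \<longrightarrow> phase_density p q (a x) (grad (w j) x) \<le> h j x"
    using g(2) unfolding modular_limit_def by (elim exE conjE) (rule that)
  have apos: "AE x in ?M. 0 \<le> a x" using a(2) by (intro AE_I2) simp
  have gwm: "grad (w j) \<in> borel_measurable borel" for j
    using test_function_C1_grad 1(1) by (auto simp: C1_grad_def intro: borel_measurable_continuous_onI)
  have [measurable]: "g0 \<in> borel_measurable ?M" "g \<in> borel_measurable ?M" "grad (w j) \<in> borel_measurable ?M" for j
    using u0(2) g(1) gwm by (auto intro!: borel_measurable_lebesgue_on)
  note [measurable] = a(1)
  let ?D0 = "\<lambda>x. phase_density p q (a x) (g0 x)"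
  have D0: "integrable ?M ?D0"
  proof (rule integrableI_nonneg)
    show "AE x in ?M. 0 \<le> ?D0 x" using apos by eventually_elim (rule phase_density_nonneg)
    show "(\<integral>\<^sup>+x. ennreal (?D0 x) \<partial>?M) < \<infinity>" using u0(3) by (simp add: double_phase_eq[OF \<Omega> u0(1)])
  qed measurable
  have hM: "integrable ?M (h j)" "integrable ?M H" for j
    using 1(2,3) by (auto intro: integrable_lebesgue_onI[OF \<Omega>'])
  show ?thesis
  proof (rule nn_integral_ge_of_limit[where hj="\<lambda>j x. 2 powr q * (?D0 x + h j x)" and h="\<lambda>x. 2 powr q * (?D0 x + H x)"
        and Ej="\<lambda>j x. phase_density p q (a x) (g0 x + grad (w j) x)"])
    show "AE x in ?M. 0 \<le> phase_density p q (a x) (g0 x + g x)"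
      "AE x in ?M. 0 \<le> phase_density p q (a x) (g0 x + grad (w j) x)" for j
      using apos by (auto elim!: eventually_mono intro: phase_density_nonneg)
    show "integrable ?M (\<lambda>x. 2 powr q * (?D0 x + H x))" "integrable ?M (\<lambda>x. 2 powr q * (?D0 x + h j x))" for j
      using D0 hM by auto
    have "(\<integral>x. \<bar>2 powr q * (?D0 x + h j x) - 2 powr q * (?D0 x + H x)\<bar> \<partial>?M) \<le> 2 powr q * (\<integral>x. norm (h j x - H x) \<partial>lborel)" for j
    proof -
      have i: "integrable lborel (\<lambda>x. norm (h j x - H x))" using 1(2,3) by simp
      have "(\<integral>x. \<bar>2 powr q * (?D0 x + h j x) - 2 powr q * (?D0 x + H x)\<bar> \<partial>?M) = 2 powr q * (\<integral>x. norm (h j x - H x) \<partial>?M)"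
        by (subst integral_mult_right_zero[symmetric]) (simp add: abs_mult flip: right_diff_distrib)
      also have "(\<integral>x. norm (h j x - H x) \<partial>?M) = (\<integral>x. indicator \<Omega> x * norm (h j x - H x) \<partial>lborel)"
      proof -
        have "h j \<in> borel_measurable borel" "H \<in> borel_measurable borel"
          using borel_measurable_integrable[OF 1(2)[rule_format, of j]] borel_measurable_integrable[OF 1(3)] by simp_all
        then have "(\<lambda>x. indicator \<Omega> x * norm (h j x - H x)) \<in> borel_measurable lborel"
          using \<Omega>' by measurable
        from integral_completion[OF this] show ?thesis
          using \<Omega>' by (simp add: integral_restrict_space)
      qed
      also have "\<dots> \<le> (\<integral>x. norm (h j x - H x) \<partial>lborel)"
        using i integrable_mult_indicator[OF _ i, of \<Omega>] \<Omega>' by (intro integral_mono) (auto simp: indicator_def)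
      finally show ?thesis by simp
    qed
    then have "norm (\<integral>x. \<bar>2 powr q * (?D0 x + h j x) - 2 powr q * (?D0 x + H x)\<bar> \<partial>?M) \<le> 2 powr q * (\<integral>x. norm (h j x - H x) \<partial>lborel)" for j
      by simp
    then show "(\<lambda>j. \<integral>x. \<bar>2 powr q * (?D0 x + h j x) - 2 powr q * (?D0 x + H x)\<bar> \<partial>?M) \<longlonglongrightarrow> 0"
      by (intro Lim_null_comparison[OF always_eventually tendsto_mult_right_zero[OF 1(4)]] allI)
    show "AE x in ?M. phase_density p q (a x) (g0 x + grad (w j) x) \<le> 2 powr q * (?D0 x + h j x)" for j
      unfolding AE_lebesgue_on_iff[OF \<Omega>'] using 1(6)[rule_format, of j]
    proof eventually_elim
      case (elim x)
      show ?case
      proof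
        assume x: "x \<in> \<Omega>"
        have "phase_density p q (a x) (g0 x + grad (w j) x) \<le> 2 powr q * (?D0 x + phase_density p q (a x) (grad (w j) x))"
          by (rule phase_density_add[OF less_imp_le[OF pq(1)] pq(2) a(2)[OF x]])
        also have "\<dots> \<le> 2 powr q * (?D0 x + h j x)" using elim x by (intro mult_left_mono add_mono) auto
        finally show "phase_density p q (a x) (g0 x + grad (w j) x) \<le> 2 powr q * (?D0 x + h j x)" .
      qed
    qed
    show "AE x in ?M. (\<lambda>j. phase_density p q (a x) (g0 x + grad (w j) x)) \<longlonglongrightarrow> phase_density p q (a x) (g0 x + g x)"
      unfolding AE_lebesgue_on_iff[OF \<Omega>'] using 1(5)
    proof eventually_elim
      case (elim x)
      then show ?case using pq by (auto intro!: phase_density_tendsto tendsto_intros)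
    qed
    fix j
    have wj: "w j \<in> test_functions \<Omega>" using 1(1) by simp
    have "double_phase p q a \<Omega> (\<lambda>x. u\<^sub>0 x + w j x) = (\<integral>\<^sup>+x. ennreal (phase_density p q (a x) (g0 x + grad (w j) x)) \<partial>?M)"
      by (rule double_phase_eq[OF \<Omega> has_weak_gradient_add[OF \<Omega> u0(1)
            C1_grad_has_weak_gradient[OF \<Omega> test_function_C1_grad[OF wj]]]])
    moreover have "(\<lambda>x. u\<^sub>0 x + w j x) \<in> translate u\<^sub>0 (test_functions \<Omega>)"
      unfolding translate_def using wj by blast
    ultimately show "(INF w\<in>translate u\<^sub>0 (test_functions \<Omega>). double_phase p q a \<Omega> w) \<le>
       (\<integral>\<^sup>+x. ennreal (phase_density p q (a x) (g0 x + grad (w j) x)) \<partial>?M)"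
      by (metis INF_lower)
  qed measurable
qed

section \<open>Absence of the gap\<close>

text \<open>The constant is the same for all d \<le> 1. The Borel majorant b on the whole space
  replaces the density itself, because the weight is known only on \<Omega>, while the convolution
  integrates over the whole space.\<close>

lemma mollified_gradient_modular_bound:
  fixes v :: "real^'n::finite"
  assumes pq: "1 \<le> p" "p \<le> q" "q \<le> p + \<kappa>" "\<kappa> > 0"
    and C0: "C0 > 0" "\<And>x y. x \<in> \<Omega> \<Longrightarrow> y \<in> \<Omega> \<Longrightarrow> a x \<le> C0 * (a y + norm (x - y) powr \<kappa>)"
    and a: "\<And>x. x \<in> \<Omega> \<Longrightarrow> 0 \<le> a x"
    and u: "zero_trace_pair \<Omega> u g" "\<And>x. \<bar>u x\<bar> \<le> M" and \<Omega>: "open \<Omega>"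
    and b: "integrable lborel b" "\<And>y. 0 \<le> b y" "AE y in lborel. y \<in> \<Omega> \<longrightarrow> phase_density p q (a y) (g y) \<le> b y"
    and d: "0 < d" "d \<le> 1" and x: "x \<in> \<Omega>"
  defines "C1 \<equiv> 2 * C0 * (norm v + 1) powr \<kappa> * (M * bump_variation TYPE('n)) powr (q - p)"
  shows "phase_density p q (a x) (conv (mollifier v d) g x) \<le> (1 + C1 + 2 * C0) * conv (mollifier v d) b x"
proof -
  let ?K = "mollifier v d"
  note K = mollifier_unit_kernel[OF d(1), of v]
  note Kb = mollifier_cont_bdd_supp(1)[OF d(1), of v]
  note i = zero_trace_pair_integrable[OF u(1)]
  have M: "M \<ge> 0" using u(2)[of 0] by simp
  have C1: "C1 \<ge> 0" unfolding C1_def using C0(1) by simp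
  define s where "s = conv ?K (\<lambda>y. norm (g y)) x"
  define t where "t = conv ?K b x"
  let ?n = "norm (conv ?K g x)"
  have ns: "?n \<le> s" unfolding s_def by (rule norm_conv_le[OF Kb mollifier_nonneg[OF d(1)] i(2)])
  have t0: "t \<ge> 0" unfolding t_def conv_def by (intro integral_nonneg_AE AE_I2) (simp add: mollifier_nonneg[OF d(1)] b(2))
  have g0: "AE y in lborel. y \<notin> \<Omega> \<longrightarrow> g y = 0" by (rule zero_trace_pair_outside(2)[OF u(1)]) (use \<Omega> in simp)
  have in': "integrable lborel (\<lambda>y. norm (g y))" using i(2) by simp
  have sp: "s powr p \<le> t"
    unfolding s_def t_def
  proof (rule conv_powr_le[OF K pq(1) in' _ b(1)])
    show "AE y in lborel. ?K (x - y) \<noteq> 0 \<longrightarrow> norm (g y) powr p \<le> b y"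
      using b(3) g0
    proof eventually_elim
      case (elim y)
      show ?case
      proof (cases "y \<in> \<Omega>")
        case True
        then have "norm (g y) powr p + a y * norm (g y) powr q \<le> b y" using elim by (simp add: phase_density_def)
        moreover have "0 \<le> a y * norm (g y) powr q" using a[OF True] by simp
        ultimately show ?thesis by simp
      qed (use elim b(2) in simp)
    qed
  qed simp
  have np: "?n powr p \<le> t" using powr_mono2[OF _ norm_ge_zero ns, of p] sp pq(1) by simp
  \<comment> \<open>The kernel centred at x sees only points y within this distance of x.\<close>
  let ?R = "d * (norm v + 1)"
  have supp: "norm (x - y) \<le> ?R" if "?K (x - y) \<noteq> 0" for y
  proof -
    have "x - y \<in> cball (d *\<^sub>R v) d" using mollifier_supp[OF d(1)] that by blast
    then have "norm ((x - y) - d *\<^sub>R v) \<le> d" by (simp add: dist_norm norm_minus_commute)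
    moreover have "norm (x - y) \<le> norm ((x - y) - d *\<^sub>R v) + norm (d *\<^sub>R v)"
      using norm_triangle_ineq[of "(x - y) - d *\<^sub>R v" "d *\<^sub>R v"] by simp
    ultimately show ?thesis using d(1) by (simp add: algebra_simps)
  qed
  have "a x * ?n powr q \<le> (C1 + 2 * C0) * t"
  \<comment> \<open>The factor 2 makes room for absorption: above the threshold, C0 R^\<kappa> is
    less than half of a(x), and the weight condition yields a(x) \<le> 2 C0 a(y) for all y in
    reach.\<close>
  proof (cases "a x \<le> 2 * C0 * ?R powr \<kappa>")
    case True
    have "?n powr q = ?n powr (q - p) * ?n powr p"
      by (simp flip: powr_add)
    also have "\<dots> \<le> (M * bump_variation TYPE('n) / d) powr (q - p) * t"
      using norm_conv_grad_le[OF u(1,2) d(1), of v x] np pq by (intro mult_mono powr_mono2) auto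
    finally have "a x * ?n powr q \<le> (2 * C0 * ?R powr \<kappa>) * ((M * bump_variation TYPE('n) / d) powr (q - p) * t)"
      using True a[OF x] C0(1) t0 by (intro mult_mono) auto
    \<comment> \<open>C1 collects everything except the powers of d; their quotient is at most 1
      because d \<le> 1 and q - p \<le> \<kappa>.\<close>
    also have "\<dots> = C1 * (d powr \<kappa> / d powr (q - p)) * t"
      using d M bump_variation_nonneg[where 'n='n] by (simp add: C1_def powr_mult powr_divide mult_ac)
    also have "\<dots> \<le> C1 * 1 * t"
    proof (intro mult_right_mono mult_left_mono C1 t0)
      have "d powr \<kappa> \<le> d powr (q - p)" using d pq by (intro powr_mono') auto
      then show "d powr \<kappa> / d powr (q - p) \<le> 1" using d by simp
    qed
    also have "\<dots> \<le> (C1 + 2 * C0) * t" using t0 C0(1) by (intro mult_right_mono) auto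
    finally show ?thesis .
  next
    case False
    have ax: "a x > 0"
    proof -
      have "0 \<le> 2 * C0 * ?R powr \<kappa>" using C0(1) by simp
      then show ?thesis using False by linarith
    qed
    \<comment> \<open>Jensen is applied with exponent q to |g| alone; the weight enters as the
      factor 1/a(x) of the majorant, which is constant in y.\<close>
    have iB: "integrable lborel (\<lambda>y. (2 * C0 / a x) * b y)" using b(1) by simp
    have "s powr q \<le> conv ?K (\<lambda>y. (2 * C0 / a x) * b y) x"
      unfolding s_def
    proof (rule conv_powr_le[OF K _ in' _ iB])
      show "AE y in lborel. ?K (x - y) \<noteq> 0 \<longrightarrow> norm (g y) powr q \<le> 2 * C0 / a x * b y"
        using b(3) g0
      proof eventually_elim
        case (elim y)
        show ?case
        proof
          assume Ky: "?K (x - y) \<noteq> 0"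
          show "norm (g y) powr q \<le> 2 * C0 / a x * b y"
          proof (cases "y \<in> \<Omega>")
            case True
            have "norm (x - y) powr \<kappa> \<le> ?R powr \<kappa>" using supp[OF Ky] pq(4) by (intro powr_mono2) auto
            then have "C0 * norm (x - y) powr \<kappa> \<le> C0 * ?R powr \<kappa>" using C0(1) by (intro mult_left_mono) auto
            then have "a x \<le> 2 * C0 * a y" using C0(2)[OF x True] False by (simp add: algebra_simps)
            then have "a x * norm (g y) powr q \<le> 2 * C0 * (a y * norm (g y) powr q)"
              using mult_right_mono[of "a x" "2 * C0 * a y" "norm (g y) powr q"] by (simp add: mult_ac)
            also have "\<dots> \<le> 2 * C0 * b y"
              using elim True C0(1) by (intro mult_left_mono) (auto simp: phase_density_def intro: order_trans[rotated])
            finally show ?thesis using ax by (simp add: field_simps)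
          qed (use elim b(2) C0(1) ax in simp)
        qed
      qed
    qed (use pq in auto)
    also have "\<dots> = (2 * C0 / a x) * t"
      by (simp add: t_def conv_def mult.left_commute)
    finally have "?n powr q \<le> (2 * C0 / a x) * t"
      using powr_mono2[OF _ norm_ge_zero ns, of q] pq by simp
    then have "a x * ?n powr q \<le> 2 * C0 * t" using ax by (simp add: field_simps)
    also have "\<dots> \<le> (C1 + 2 * C0) * t" using C1 t0 by (intro mult_right_mono) auto
    finally show ?thesis .
  qed
  with np have "?n powr p + a x * ?n powr q \<le> (1 + C1 + 2 * C0) * t" by (simp add: algebra_simps)
  then show ?thesis by (simp add: phase_density_def t_def)
qed

text \<open>Mollification of u itself supplies the test functions, and C times the mollification of
  b supplies the dominating functions, which converge in L^1 to C b. Passing to a subsequence makes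
  the gradients converge almost everywhere.\<close>

lemma modular_limit_shifted_piece:
  fixes v :: "real^'n::finite"
  assumes pq: "1 \<le> p" "p \<le> q" "q \<le> p + \<kappa>" "\<kappa> > 0"
    and C0: "C0 > 0" "\<And>x y. x \<in> \<Omega> \<Longrightarrow> y \<in> \<Omega> \<Longrightarrow> a x \<le> C0 * (a y + norm (x - y) powr \<kappa>)"
    and a: "\<And>x. x \<in> \<Omega> \<Longrightarrow> 0 \<le> a x"
    and u: "zero_trace_pair \<Omega> u g" "\<And>x. \<bar>u x\<bar> \<le> M" and \<Omega>: "open \<Omega>"
    and b: "integrable lborel b" "\<And>y. 0 \<le> b y" "AE y in lborel. y \<in> \<Omega> \<longrightarrow> phase_density p q (a y) (g y) \<le> b y"
    and S: "compact S" "AE y in lborel. y \<notin> S \<longrightarrow> u y = 0"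
    and d0: "0 < d0" "d0 \<le> 1"
      "\<And>d y z. 0 < d \<Longrightarrow> d \<le> d0 \<Longrightarrow> y \<in> S \<Longrightarrow> z \<in> cball (d *\<^sub>R v) d \<Longrightarrow> y + z \<in> \<Omega>"
  shows "modular_limit p q a \<Omega> g"
proof -
  note i = zero_trace_pair_integrable[OF u(1)]
  obtain d where dpos: "\<And>k. d k > 0" and dle: "\<And>k. d k \<le> d0" and dlim: "d \<longlonglongrightarrow> 0"
    using null_sequence_below[OF d0(1)] by blast
  let ?K = "\<lambda>k. mollifier v (d k)"
  have ci: "integrable lborel (conv (?K k) g)" "integrable lborel (conv (?K k) b)" for k
    using conv_integrable[OF mollifier_unit_kernel[OF dpos]] i(2) b(1) by auto
  have limg: "(\<lambda>k. \<integral>x. norm (conv (?K k) g x - g x) \<partial>lborel) \<longlonglongrightarrow> 0"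
    by (rule conv_mollifier_tendsto[OF dpos dlim i(2)])
  obtain r :: "nat \<Rightarrow> nat" where r: "strict_mono r" "AE x in lborel. (\<lambda>k. conv (?K (r k)) g x - g x) \<longlonglongrightarrow> 0"
    using tendsto_L1_AE_subseq[of lborel "\<lambda>k x. conv (?K k) g x - g x"] ci(1) i(2) limg by auto
  define C where "C = 1 + 2 * C0 * (norm v + 1) powr \<kappa> * (M * bump_variation TYPE('n)) powr (q - p) + 2 * C0"
  have C: "C \<ge> 0" unfolding C_def using C0(1) by (auto intro!: add_nonneg_nonneg)
  have gw: "grad (conv (?K k) u) x = conv (?K k) g x" for k x
    by (rule grad_eq[OF zero_trace_pair_conv_grad[OF u(1) mollifier_C1_grad mollifier_cont_bdd_supp[OF dpos]]])
  show ?thesis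
    unfolding modular_limit_def
  proof (intro exI conjI allI)
    show "conv (?K (r k)) u \<in> test_functions \<Omega>" for k
    proof (rule conv_test_function[OF times_cont_diff_mollifier compact_cball mollifier_supp[OF dpos] i(1) S])
      show "x + y \<in> \<Omega>" if "x \<in> S" "y \<in> cball (d (r k) *\<^sub>R v) (d (r k))" for x y
        by (rule d0(3)[OF dpos dle that])
    qed
    show "integrable lborel (\<lambda>x. C * conv (?K (r k)) b x)" "integrable lborel (\<lambda>x. C * b x)" for k
      using ci(2) b(1) by auto
    have "(\<lambda>k. \<integral>x. norm (conv (?K (r k)) b x - b x) \<partial>lborel) \<longlonglongrightarrow> 0"
      using LIMSEQ_subseq_LIMSEQ[OF conv_mollifier_tendsto[OF dpos dlim b(1), of v] r(1)] by (simp add: o_def)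
    then have "(\<lambda>k. C * (\<integral>x. norm (conv (?K (r k)) b x - b x) \<partial>lborel)) \<longlonglongrightarrow> 0"
      by (rule tendsto_mult_right_zero)
    moreover have "(\<integral>x. norm (C * conv (?K (r k)) b x - C * b x) \<partial>lborel) = C * (\<integral>x. norm (conv (?K (r k)) b x - b x) \<partial>lborel)" for k
      using C by (simp add: abs_mult flip: right_diff_distrib)
    ultimately show "(\<lambda>k. \<integral>x. norm (C * conv (?K (r k)) b x - C * b x) \<partial>lborel) \<longlonglongrightarrow> 0"
      by simp
    show "AE x in lborel. x \<in> \<Omega> \<longrightarrow> (\<lambda>k. grad (conv (?K (r k)) u) x) \<longlonglongrightarrow> g x"
      unfolding gw using r(2) by eventually_elim (simp add: LIM_zero_iff)
    show "AE x in lborel. x \<in> \<Omega> \<longrightarrow> phase_density p q (a x) (grad (conv (?K (r k)) u) x) \<le> C * conv (?K (r k)) b x" for k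
      unfolding gw C_def
      by (intro AE_I2 impI mollified_gradient_modular_bound[OF pq C0 a u \<Omega> b dpos order_trans[OF dle d0(2)]])
  qed
qed

lemma lipschitz_domain_local_shift:
  fixes \<Omega> :: "(real^'n::finite) set"
  assumes \<Omega>: "bounded_lipschitz_domain \<Omega>" and z: "z \<in> closure \<Omega>"
  shows "\<exists>r>0. \<exists>v. \<exists>d0>0. d0 \<le> 1 \<and> (\<forall>d y w. 0 < d \<longrightarrow> d \<le> d0 \<longrightarrow> y \<in> closure \<Omega> \<inter> cball z r \<longrightarrow>
      w \<in> cball (d *\<^sub>R v) d \<longrightarrow> y + w \<in> \<Omega>)"
proof (cases "z \<in> \<Omega>")
  case True
  have "open \<Omega>" using \<Omega> by (simp add: bounded_lipschitz_domain_def)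
  then obtain \<rho> where \<rho>: "\<rho> > 0" "ball z \<rho> \<subseteq> \<Omega>" using True open_contains_ball by blast
  show ?thesis
  proof (intro exI conjI allI impI)
    show "\<rho> / 3 > 0" "min 1 (\<rho> / 3) > 0" "min 1 (\<rho> / 3) \<le> 1" using \<rho>(1) by auto
    fix d y w assume *: "d \<le> min 1 (\<rho> / 3)" "y \<in> closure \<Omega> \<inter> cball z (\<rho> / 3)" "w \<in> cball (d *\<^sub>R (0 :: real^'n)) d"
    have "norm (y - z) \<le> \<rho> / 3" "norm w \<le> \<rho> / 3" using * by (auto simp: dist_norm norm_minus_commute)
    then have "norm ((y - z) + w) < \<rho>" using norm_triangle_ineq[of "y - z" w] \<rho>(1) by linarith
    then have "y + w \<in> ball z \<rho>" by (simp add: dist_norm norm_minus_commute algebra_simps)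
    then show "y + w \<in> \<Omega>" using \<rho>(2) by blast
  qed
next
  case False
  have "open \<Omega>" using \<Omega> by (simp add: bounded_lipschitz_domain_def)
  then have "z \<in> frontier \<Omega>" using z False by (simp add: frontier_def interior_open)
  then obtain r e L and \<gamma> :: "real^'n \<Rightarrow> real" where h: "r > 0" "norm e = 1" "L-lipschitz_on {y. y \<bullet> e = 0} \<gamma>"
    "\<Omega> \<inter> ball z r = {x \<in> ball z r. \<gamma> (x - (x \<bullet> e) *\<^sub>R e) < x \<bullet> e}"
    using \<Omega> unfolding bounded_lipschitz_domain_def by blast
  have ee: "e \<bullet> e = 1" using h(2) by (simp add: dot_square_norm)
  have L: "L \<ge> 0" using h(3) by (rule lipschitz_on_nonneg)
  let ?P = "\<lambda>x. x - (x \<bullet> e) *\<^sub>R e"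
  let ?F = "\<lambda>x. x \<bullet> e - \<gamma> (?P x)"
  have P: "?P x \<in> {y. y \<bullet> e = 0}" for x by (simp add: inner_diff_left ee)
  have "continuous_on {y. y \<bullet> e = 0} \<gamma>" by (rule lipschitz_on_continuous_on[OF h(3)])
  then have "continuous_on UNIV (\<lambda>x. \<gamma> (?P x))"
    by (rule continuous_on_compose2) (use P in \<open>auto intro!: continuous_intros\<close>)
  then have Fc: "continuous_on UNIV ?F" by (intro continuous_intros)
  \<comment> \<open>A point of the closure is only known to lie on or above the graph; the vertical
    shift will restore the strict inequality.\<close>
  have Fpos: "?F y \<ge> 0" if "y \<in> closure \<Omega>" "y \<in> ball z r" for y
  proof -
    have "closed {x. 0 \<le> ?F x}" by (rule closed_Collect_le) (use Fc in \<open>auto intro: continuous_intros\<close>)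
    moreover have "\<Omega> \<inter> ball z r \<subseteq> {x. 0 \<le> ?F x}" unfolding h(4) by auto
    ultimately have "closure (\<Omega> \<inter> ball z r) \<subseteq> {x. 0 \<le> ?F x}" by (intro closure_minimal)
    moreover have "y \<in> closure (\<Omega> \<inter> ball z r)"
      using open_Int_closure_subset[OF open_ball, of z r \<Omega>] that by (auto simp: Int_commute)
    ultimately show ?thesis by blast
  qed
  \<comment> \<open>Of the vertical gain d c, the amount L d is lost to the graph and d to the
    vertical part of the ball; d remains.\<close>
  define c where "c = L + 2"
  have c: "c > 0" using L by (simp add: c_def)
  \<comment> \<open>The shifts have norm at most d (c + 1) \<le> r/4, so points starting within r/4
    of z stay in the chart ball.\<close>
  define d0 where "d0 = min 1 (r / (4 * (c + 1)))"
  have d0: "d0 > 0" "d0 \<le> 1" "d0 \<le> r / (4 * (c + 1))" using h(1) c by (auto simp: d0_def)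
  show ?thesis
  proof (intro exI conjI allI impI)
    show "r / 4 > 0" using h(1) by simp
    show "d0 > 0" "d0 \<le> 1" by (rule d0)+
    fix d y w assume *: "0 < d" "d \<le> d0" "y \<in> closure \<Omega> \<inter> cball z (r / 4)" "w \<in> cball (d *\<^sub>R (c *\<^sub>R e)) d"
    define \<beta> where "\<beta> = w - d *\<^sub>R (c *\<^sub>R e)"
    have \<beta>: "norm \<beta> \<le> d" using *(4) by (simp add: \<beta>_def dist_norm norm_minus_commute)
    have w: "w = (d * c) *\<^sub>R e + \<beta>" by (simp add: \<beta>_def)
    have "norm w \<le> d * c + d"
      unfolding w using norm_triangle_ineq[of "(d * c) *\<^sub>R e" \<beta>] \<beta> h(2) *(1) c by simp
    also have "\<dots> = d * (c + 1)" by (simp add: algebra_simps)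
    also have "\<dots> \<le> r / (4 * (c + 1)) * (c + 1)" using *(2) d0(3) c by (intro mult_right_mono) auto
    also have "\<dots> = r / 4" using c by (simp add: field_simps)
    finally have nw: "norm w \<le> r / 4" .
    have ny: "norm (y - z) \<le> r / 4" using *(3) by (auto simp: dist_norm norm_minus_commute)
    have "norm ((y - z) + w) < r" using norm_triangle_ineq[of "y - z" w] nw ny h(1) by linarith
    then have xb: "y + w \<in> ball z r" by (simp add: dist_norm norm_minus_commute algebra_simps)
    have Fy: "?F y \<ge> 0" by (rule Fpos) (use *(3) h(1) in auto)
    have Pd: "?P (y + w) - ?P y = ?P \<beta>"
      by (simp add: w inner_add_left ee algebra_simps)
    have "norm (?P \<beta>) \<le> norm \<beta>"
    proof -
      have "?P \<beta> \<bullet> ?P \<beta> = \<beta> \<bullet> \<beta> - (\<beta> \<bullet> e) * (\<beta> \<bullet> e)"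
        unfolding inner_diff_left inner_diff_right inner_scaleR_left inner_scaleR_right ee inner_commute[of e \<beta>]
        by simp
      then have "norm (?P \<beta>) ^ 2 = norm \<beta> ^ 2 - (\<beta> \<bullet> e) ^ 2"
        unfolding power2_norm_eq_inner power2_eq_square[of "\<beta> \<bullet> e"] .
      then have "norm (?P \<beta>) ^ 2 \<le> norm \<beta> ^ 2" by simp
      then show ?thesis by (rule power2_le_imp_le) simp
    qed
    then have "\<bar>\<gamma> (?P (y + w)) - \<gamma> (?P y)\<bar> \<le> L * d"
      using lipschitz_onD[OF h(3) P P, of "y + w" y] Pd \<beta> L
        mult_left_mono[of "norm (?P \<beta>)" d L] by (simp add: dist_norm)
    moreover have "\<bar>\<beta> \<bullet> e\<bar> \<le> d" using Cauchy_Schwarz_ineq2[of \<beta> e] h(2) \<beta> by simp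
    moreover have "(y + w) \<bullet> e = y \<bullet> e + d * c + \<beta> \<bullet> e" by (simp add: w inner_add_left ee)
    moreover have "d * c = L * d + 2 * d" by (simp add: c_def algebra_simps)
    ultimately have "?F (y + w) > 0" using Fy *(1) by linarith
    then have "y + w \<in> \<Omega> \<inter> ball z r" unfolding h(4) using xb by simp
    then show "y + w \<in> \<Omega>" by blast
  qed
qed

subsection \<open>A partition of unity of class \<open>C\<^sup>1\<close>\<close>

text \<open>The building block for the bumps of the partition of unity, for \<open>profile\<close>
  and for \<open>reg_square\<close>.\<close>

lemma DERIV_max_0_square: "((\<lambda>s. (max 0 s)\<^sup>2) has_real_derivative 2 * max 0 t) (at t)"
proof -
  consider "t < 0" | "t = 0" | "t > 0" by linarith
  then show ?thesis
  proof cases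
    case 1
    have "((\<lambda>_. 0) has_real_derivative 0) (at t)" by simp
    then have "((\<lambda>s. (max 0 s)\<^sup>2) has_real_derivative 0) (at t)"
      by (rule DERIV_cong_ev[THEN iffD1, rotated -1])
        (use 1 eventually_nhds_in_open[of "{..<0}" t] in \<open>auto elim!: eventually_mono\<close>)
    with 1 show ?thesis by simp
  next
    case 2
    have "((\<lambda>h. (max 0 h)\<^sup>2 / h) \<longlongrightarrow> 0) (at (0::real))"
    proof (rule Lim_null_comparison[OF always_eventually])
      show "\<forall>h::real. norm ((max 0 h)\<^sup>2 / h) \<le> \<bar>h\<bar>" by (auto simp: max_def power2_eq_square)
      show "(abs \<longlongrightarrow> 0) (at (0::real))" using tendsto_rabs[OF tendsto_ident_at, of "0::real"] by simp
    qed
    with 2 show ?thesis by (simp add: has_field_derivative_iff)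
  next
    case 3
    have "((\<lambda>s. s\<^sup>2) has_real_derivative 2 * t) (at t)" by (auto intro!: derivative_eq_intros)
    then have "((\<lambda>s. (max 0 s)\<^sup>2) has_real_derivative 2 * t) (at t)"
      by (rule DERIV_cong_ev[THEN iffD1, rotated -1])
        (use 3 eventually_nhds_in_open[of "{0<..}" t] in \<open>auto elim!: eventually_mono\<close>)
    with 3 show ?thesis by simp
  qed
qed

lemma C1_grad_max_0_square:
  assumes "C1_grad f F"
  shows "C1_grad (\<lambda>x. (max 0 (f x))\<^sup>2) (\<lambda>x. (2 * max 0 (f x)) *\<^sub>R F x)"
  by (rule C1_grad_compose_real[OF DERIV_max_0_square _ assms]) (intro continuous_intros)

lemma C1_grad_inverse:
  assumes f: "C1_grad f F" and nz: "\<And>x. f x > 0"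
  shows "C1_grad (\<lambda>x. inverse (f x)) (\<lambda>x. (- (inverse (f x))\<^sup>2) *\<^sub>R F x)"
  unfolding C1_grad_def
proof (intro conjI allI)
  fix x
  have d: "(f has_derivative (\<lambda>h. h \<bullet> F x)) (at x)" using f by (auto simp: C1_grad_def)
  have "f x \<noteq> 0" using nz[of x] by simp
  then have "(inverse has_real_derivative - (inverse (f x) ^ Suc (Suc 0))) (at (f x))"
    by (rule DERIV_inverse)
  from has_derivative_compose[OF d this[unfolded has_field_derivative_def]]
  show "((\<lambda>x. inverse (f x)) has_derivative (\<lambda>h. h \<bullet> ((- (inverse (f x))\<^sup>2) *\<^sub>R F x))) (at x)"
    by (rule has_derivative_eq_rhs) (auto simp: power2_eq_square)
  have "f x \<noteq> 0" for x using nz[of x] by simp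
  then show "continuous_on UNIV (\<lambda>x. (- (inverse (f x))\<^sup>2) *\<^sub>R F x)"
    using f C1_grad_continuous[OF f] by (auto simp: C1_grad_def intro!: continuous_intros)
qed

lemma C1_grad_const: "C1_grad (\<lambda>x. c) (\<lambda>x. 0)"
  by (simp add: C1_grad_def)

lemma C1_grad_cmult: "C1_grad f F \<Longrightarrow> C1_grad (\<lambda>x. c * f x) (\<lambda>x. c *\<^sub>R F x)"
  using C1_grad_mult[OF C1_grad_const, of f F c] by simp

lemma C1_grad_sum:
  assumes "\<And>i. i \<in> I \<Longrightarrow> C1_grad (f i) (F i)"
  shows "C1_grad (\<lambda>x. \<Sum>i\<in>I. f i x) (\<lambda>x. \<Sum>i\<in>I. F i x)"
  using assms
proof (induction I rule: infinite_finite_induct)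
  case (insert i I)
  then show ?case using C1_grad_add[of "f i" "F i" "\<lambda>x. \<Sum>i\<in>I. f i x" "\<lambda>x. \<Sum>i\<in>I. F i x"] by simp
qed (auto intro: C1_grad_const)

lemma C1_grad_norm_square: "C1_grad (\<lambda>x. c - (x - z) \<bullet> (x - z)) (\<lambda>x. (-2) *\<^sub>R (x - z))"
  unfolding C1_grad_def
proof (intro conjI allI)
  show "((\<lambda>x. c - (x - z) \<bullet> (x - z)) has_derivative (\<lambda>h. h \<bullet> ((-2) *\<^sub>R (x - z)))) (at x)" for x
    by (auto intro!: derivative_eq_intros simp: inner_commute)
qed (intro continuous_intros)

text \<open>Class C^1 is enough because the pieces are mollified afterwards. The bumps are divided
  by a modification of their sum \<sigma> that is positive everywhere and equals \<sigma> on
  C.\<close>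

lemma C1_partition_of_unity:
  fixes Z :: "(real^'n::finite) set"
  assumes C: "compact C" and Z: "finite Z" "C \<subseteq> (\<Union>z\<in>Z. ball z (r z))"
  obtains \<theta> \<Theta> where "\<forall>z\<in>Z. C1_grad (\<theta> z) (\<Theta> z)" "\<forall>z\<in>Z. \<forall>x. x \<notin> cball z (r z) \<longrightarrow> \<theta> z x = 0"
    "\<forall>x\<in>C. (\<Sum>z\<in>Z. \<theta> z x) = 1"
proof (cases "C = {}")
  case True
  show ?thesis
    by (rule that[of "\<lambda>_ _. 0" "\<lambda>_ _. 0"]) (auto simp: True C1_grad_const)
next
  case False
  define b where "b z x = (max 0 ((r z)\<^sup>2 - (x - z) \<bullet> (x - z)))\<^sup>2" for z x :: "real^'n"
  define b' where "b' z x = (2 * max 0 ((r z)\<^sup>2 - (x - z) \<bullet> (x - z))) *\<^sub>R ((-2) *\<^sub>R (x - z))" for z x :: "real^'n"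
  have bC: "C1_grad (b z) (b' z)" for z
    unfolding b_def[abs_def] b'_def[abs_def] by (rule C1_grad_max_0_square[OF C1_grad_norm_square])
  have b0: "b z x \<ge> 0" for z x by (simp add: b_def)
  have bz: "b z x = 0" if "x \<notin> cball z (r z)" "r z \<ge> 0" for z x
  proof -
    have "norm (x - z) \<ge> r z" using that by (simp add: dist_norm norm_minus_commute)
    then have "(r z)\<^sup>2 \<le> (x - z) \<bullet> (x - z)" using that(2) by (simp add: dot_square_norm power_mono)
    then show ?thesis by (simp add: b_def)
  qed
  have bp: "b z x > 0" if "x \<in> ball z (r z)" for z x
  proof -
    have "norm (x - z) < r z" using that by (simp add: dist_norm norm_minus_commute)
    then have "(x - z) \<bullet> (x - z) < (r z)\<^sup>2" by (simp add: dot_square_norm power_strict_mono)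
    then show ?thesis by (simp add: b_def)
  qed
  \<comment> \<open>The radii are arbitrary reals: a negative radius gives an empty ball but a
    positive square, so the bump of such a centre would not vanish off its ball.\<close>
  define Z' where "Z' = {z\<in>Z. r z \<ge> 0}"
  define \<sigma> where "\<sigma> x = (\<Sum>z\<in>Z'. b z x)" for x
  have Z': "finite Z'" "C \<subseteq> (\<Union>z\<in>Z'. ball z (r z))"
  proof -
    show "C \<subseteq> (\<Union>z\<in>Z'. ball z (r z))"
    proof
      fix x assume "x \<in> C"
      then obtain z where "z \<in> Z" "x \<in> ball z (r z)" using Z(2) by blast
      moreover from this have "r z \<ge> 0" using zero_le_dist[of z x] by (simp del: zero_le_dist)
      ultimately show "x \<in> (\<Union>z\<in>Z'. ball z (r z))" by (auto simp: Z'_def)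
    qed
  qed (simp add: Z'_def Z)
  have \<sigma>C: "C1_grad \<sigma> (\<lambda>x. \<Sum>z\<in>Z'. b' z x)" unfolding \<sigma>_def[abs_def] by (rule C1_grad_sum) (rule bC)
  have \<sigma>0: "\<sigma> x \<ge> 0" for x unfolding \<sigma>_def by (intro sum_nonneg b0)
  have \<sigma>p: "\<sigma> x > 0" if "x \<in> C" for x
  proof -
    obtain z where z: "z \<in> Z'" "x \<in> ball z (r z)" using Z'(2) \<open>x \<in> C\<close> by blast
    have "0 < b z x" by (rule bp[OF z(2)])
    also have "\<dots> \<le> \<sigma> x" unfolding \<sigma>_def by (rule member_le_sum[OF z(1) b0 Z'(1)])
    finally show ?thesis .
  qed
  obtain x0 where x0: "x0 \<in> C" "\<forall>x\<in>C. \<sigma> x0 \<le> \<sigma> x"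
    using continuous_attains_inf[OF C False C1_grad_continuous[OF \<sigma>C]] by blast
  define m where "m = \<sigma> x0"
  have m: "m > 0" using \<sigma>p[OF x0(1)] by (simp add: m_def)
  \<comment> \<open>On C, where \<sigma> \<ge> m, the correction is 0; where \<sigma> vanishes,
    \<rho> equals m. The square keeps \<rho> of class C^1.\<close>
  define \<rho> where "\<rho> x = \<sigma> x + (1 / m) * (max 0 (m - \<sigma> x))\<^sup>2" for x
  have \<rho>C: "\<exists>R. C1_grad \<rho> R"
    unfolding \<rho>_def[abs_def]
    by (rule exI, rule C1_grad_add[OF \<sigma>C C1_grad_cmult[OF C1_grad_max_0_square[OF C1_grad_diff[OF C1_grad_const \<sigma>C]]]])
  then obtain R where R: "C1_grad \<rho> R" by blast
  have \<rho>p: "\<rho> x > 0" for x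
  proof (cases "\<sigma> x = 0")
    case True
    then show ?thesis using m by (simp add: \<rho>_def)
  next
    case False
    then have "\<sigma> x > 0" using \<sigma>0[of x] by simp
    moreover have "(1 / m) * (max 0 (m - \<sigma> x))\<^sup>2 \<ge> 0" using m by simp
    ultimately show ?thesis unfolding \<rho>_def by linarith
  qed
  have \<rho>\<sigma>: "\<rho> x = \<sigma> x" if "x \<in> C" for x using x0(2) that by (simp add: \<rho>_def m_def)
  define \<theta> where "\<theta> z x = (if z \<in> Z' then b z x * inverse (\<rho> x) else 0)" for z x
  have "\<exists>T. C1_grad (\<theta> z) T" for z
    using C1_grad_mult[OF bC C1_grad_inverse[OF R \<rho>p], of z] C1_grad_const[of 0]
    unfolding \<theta>_def[abs_def] by (cases "z \<in> Z'") auto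
  then obtain \<Theta> where \<Theta>: "\<And>z. C1_grad (\<theta> z) (\<Theta> z)" by metis
  show ?thesis
  proof (rule that[of \<theta> \<Theta>])
    show "\<forall>z\<in>Z. \<forall>x. x \<notin> cball z (r z) \<longrightarrow> \<theta> z x = 0"
      using bz by (auto simp: \<theta>_def Z'_def)
    show "\<forall>x\<in>C. (\<Sum>z\<in>Z. \<theta> z x) = 1"
    proof
      fix x assume x: "x \<in> C"
      have "(\<Sum>z\<in>Z. \<theta> z x) = (\<Sum>z\<in>Z'. b z x * inverse (\<rho> x))"
        unfolding \<theta>_def using Z(1) by (subst sum.inter_restrict[symmetric]) (auto simp: Z'_def intro: sum.cong)
      also have "\<dots> = \<sigma> x * inverse (\<sigma> x)" by (simp add: \<sigma>_def sum_distrib_right \<rho>\<sigma>[OF x, unfolded \<sigma>_def])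
      finally show "(\<Sum>z\<in>Z. \<theta> z x) = 1" using \<sigma>p[OF x] by simp
    qed
  qed (use \<Theta> in blast)
qed

section \<open>Gluing, truncation and equality of the infima\<close>

lemma weight_class_bounded:
  assumes \<Omega>: "bounded \<Omega>" and a: "a \<in> weight_class \<kappa> \<Omega>" and \<kappa>: "\<kappa> > 0"
  obtains A where "A \<ge> 0" "\<And>x. x \<in> \<Omega> \<Longrightarrow> a x \<le> A"
proof (cases "\<Omega> = {}")
  case True
  then show ?thesis by (intro that[of 0]) auto
next
  case False
  then obtain y where y: "y \<in> \<Omega>" by blast
  obtain C where C: "C > 0" "\<And>x y. x \<in> \<Omega> \<Longrightarrow> y \<in> \<Omega> \<Longrightarrow> a x \<le> C * (a y + norm (x - y) powr \<kappa>)"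
    and nn: "\<And>x. x \<in> \<Omega> \<Longrightarrow> 0 \<le> a x"
    using a unfolding weight_class_def by blast
  obtain R where R: "\<And>x. x \<in> \<Omega> \<Longrightarrow> norm x \<le> R" using \<Omega> bounded_iff by metis
  show ?thesis
  proof (rule that[of "C * (a y + (R + R) powr \<kappa>)"])
    show "0 \<le> C * (a y + (R + R) powr \<kappa>)" using C(1) nn[OF y] by simp
    fix x assume x: "x \<in> \<Omega>"
    have "norm (x - y) \<le> R + R" using R[OF x] R[OF y] norm_triangle_ineq4[of x y] by linarith
    then have "norm (x - y) powr \<kappa> \<le> (R + R) powr \<kappa>" using \<kappa> by (intro powr_mono2) auto
    then have "C * (a y + norm (x - y) powr \<kappa>) \<le> C * (a y + (R + R) powr \<kappa>)"
      using C(1) by (intro mult_left_mono) auto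
    then show "a x \<le> C * (a y + (R + R) powr \<kappa>)" using C(2)[OF x y] by linarith
  qed
qed

lemma phase_density_le_const:
  assumes "0 \<le> p" "0 \<le> q" "0 \<le> c" "c \<le> A" "norm v \<le> N"
  shows "phase_density p q c v \<le> N powr p + A * N powr q"
proof -
  have "norm v powr p \<le> N powr p" "norm v powr q \<le> N powr q" using assms by (auto intro: powr_mono2)
  moreover from this(2) have "c * norm v powr q \<le> A * N powr q" using assms by (intro mult_mono) auto
  ultimately show ?thesis by (simp add: phase_density_def)
qed

lemma integrable_const_lebesgue_on:
  fixes \<Omega> :: "'a::euclidean_space set"
  assumes "open \<Omega>" "bounded \<Omega>"
  shows "integrable (lebesgue_on \<Omega>) (\<lambda>x. c :: real)"
proof -
  interpret finite_measure "lebesgue_on \<Omega>"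
    by (rule finite_measure_lebesgue_on[OF lmeasurable_open[OF assms(2,1)]])
  show ?thesis by simp
qed

text \<open>Makes the terms with the gradients of the cut-offs cancel when the pieces are added up
  again.\<close>

lemma sum_grad_const_zero:
  fixes \<Omega> :: "(real^'n::finite) set"
  assumes \<Omega>: "open \<Omega>" "x \<in> \<Omega>" and \<theta>: "\<And>z. z \<in> Z \<Longrightarrow> C1_grad (\<theta> z) (\<Theta> z)"
    and one: "\<And>x. x \<in> \<Omega> \<Longrightarrow> (\<Sum>z\<in>Z. \<theta> z x) = (c :: real)"
  shows "(\<Sum>z\<in>Z. \<Theta> z x) = 0"
proof -
  have "((\<lambda>x. \<Sum>z\<in>Z. \<theta> z x) has_derivative (\<lambda>h. h \<bullet> (\<Sum>z\<in>Z. \<Theta> z x))) (at x)"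
    using C1_grad_sum[of Z \<theta> \<Theta>] \<theta> by (simp add: C1_grad_def)
  from has_derivative_diff[OF this has_derivative_const[of c]]
  have d: "((\<lambda>x. (\<Sum>z\<in>Z. \<theta> z x) - c) has_derivative (\<lambda>h. h \<bullet> (\<Sum>z\<in>Z. \<Theta> z x))) (at x)"
    by simp
  show ?thesis
    by (rule grad_zero_outside[OF d, of "- \<Omega>"]) (use \<Omega> one in auto)
qed

text \<open>Each piece is mollified with the shift of its own chart. Cutting off adds the term u
  \<Theta> to the gradient, which has integrable density because u, \<Theta>, the weight and
  \<Omega> are bounded.\<close>

lemma bounded_modular_limit:
  fixes u :: "real^'n::finite \<Rightarrow> real"
  assumes pq: "1 \<le> p" "p \<le> q" "q \<le> p + \<kappa>" "\<kappa> > 0"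
    and \<Omega>: "bounded_lipschitz_domain \<Omega>" and a: "a \<in> weight_class \<kappa> \<Omega>"
    and u: "zero_trace_pair \<Omega> u g" "\<And>x. \<bar>u x\<bar> \<le> M"
    and D: "integrable (lebesgue_on \<Omega>) (\<lambda>x. phase_density p q (a x) (g x))"
  shows "modular_limit p q a \<Omega> g"
proof -
  let ?M = "lebesgue_on \<Omega>"
  have op: "open \<Omega>" and bd: "bounded \<Omega>" using \<Omega> by (auto simp: bounded_lipschitz_domain_def)
  have \<Omega>': "\<Omega> \<in> sets borel" using op by simp
  obtain C0 where C0: "C0 > 0" "\<And>x y. x \<in> \<Omega> \<Longrightarrow> y \<in> \<Omega> \<Longrightarrow> a x \<le> C0 * (a y + norm (x - y) powr \<kappa>)"
    and a0: "\<And>x. x \<in> \<Omega> \<Longrightarrow> 0 \<le> a x" and am: "a \<in> borel_measurable ?M"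
    using a unfolding weight_class_def by blast
  obtain A where A: "A \<ge> 0" "\<And>x. x \<in> \<Omega> \<Longrightarrow> a x \<le> A" using weight_class_bounded[OF bd a pq(4)] by blast
  note i = zero_trace_pair_integrable[OF u(1)]
  let ?C = "closure \<Omega>"
  have cC: "compact ?C" using bd by simp
  have M: "M \<ge> 0" using u(2)[of 0] by simp
  have "\<forall>z\<in>?C. \<exists>r v d0. r > 0 \<and> d0 > 0 \<and> d0 \<le> 1 \<and> (\<forall>d y w. 0 < d \<longrightarrow> d \<le> d0 \<longrightarrow> y \<in> ?C \<inter> cball z r \<longrightarrow>
      w \<in> cball (d *\<^sub>R v) d \<longrightarrow> y + w \<in> \<Omega>)"
    using lipschitz_domain_local_shift[OF \<Omega>] by blast
  then obtain r v d0 where sh: "\<forall>z\<in>?C. r z > 0 \<and> d0 z > 0 \<and> d0 z \<le> 1 \<and> (\<forall>d y w. 0 < d \<longrightarrow> d \<le> d0 z \<longrightarrow>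
      y \<in> ?C \<inter> cball z (r z) \<longrightarrow> w \<in> cball (d *\<^sub>R v z) d \<longrightarrow> y + w \<in> \<Omega>)"
    by metis
  have "?C \<subseteq> (\<Union>z\<in>?C. ball z (r z))" using sh by fastforce
  then obtain Z where Z: "Z \<subseteq> ?C" "finite Z" "?C \<subseteq> (\<Union>z\<in>Z. ball z (r z))"
    using compactE_image[OF cC, of ?C "\<lambda>z. ball z (r z)"] by auto
  obtain \<theta> \<Theta> where \<theta>: "\<forall>z\<in>Z. C1_grad (\<theta> z) (\<Theta> z)" "\<forall>z\<in>Z. \<forall>x. x \<notin> cball z (r z) \<longrightarrow> \<theta> z x = 0"
    "\<forall>x\<in>?C. (\<Sum>z\<in>Z. \<theta> z x) = 1"
    using C1_partition_of_unity[OF cC Z(2,3)] by blast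
  have piece: "modular_limit p q a \<Omega> (\<lambda>x. \<theta> z x *\<^sub>R g x + u x *\<^sub>R \<Theta> z x)" if z: "z \<in> Z" for z
  proof -
    have C1: "C1_grad (\<theta> z) (\<Theta> z)" using \<theta>(1) z by blast
    have t0: "\<theta> z x = 0" if "x \<notin> cball z (r z)" for x using \<theta>(2) z that by blast
    note bs = C1_grad_cont_bdd_supp(1,2)[OF C1 compact_cball t0]
    obtain M1 where M1: "M1 > 0" "\<And>x. norm (\<theta> z x) \<le> M1" using cont_bdd_supp_bounded[OF bs(1)] by blast
    obtain M2 where M2: "M2 > 0" "\<And>x. norm (\<Theta> z x) \<le> M2" using cont_bdd_supp_bounded[OF bs(2)] by blast
    let ?g = "\<lambda>x. \<theta> z x *\<^sub>R g x + u x *\<^sub>R \<Theta> z x"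
    let ?u = "\<lambda>x. \<theta> z x * u x"
    have p: "zero_trace_pair \<Omega> ?u ?g" by (rule zero_trace_pair_mult[OF u(1) C1 bs])
    have gm: "?g \<in> borel_measurable ?M"
      using zero_trace_pair_integrable(2)[OF p] by (intro borel_measurable_lebesgue_on) simp
    \<comment> \<open>N bounds |u \<Theta>|, and K the density of that term, A being a bound for the
      weight. The maximum with 1 in c lets one power M^q cover both exponents.\<close>
    let ?N = "M * M2" and ?c = "(max 1 M1) powr q"
    let ?K = "?N powr p + A * ?N powr q"
    have "integrable ?M (\<lambda>x. phase_density p q (a x) (?g x))"
    proof (rule Bochner_Integration.integrable_bound)
      show "integrable ?M (\<lambda>x. 2 powr q * (?c * phase_density p q (a x) (g x) + ?K))"
        using D integrable_const_lebesgue_on[OF op bd] by simp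
      show "AE x in ?M. norm (phase_density p q (a x) (?g x)) \<le> norm (2 powr q * (?c * phase_density p q (a x) (g x) + ?K))"
      proof (rule AE_I2)
        fix x assume "x \<in> space ?M"
        then have x: "x \<in> \<Omega>" by simp
        have "phase_density p q (a x) (?g x) \<le> 2 powr q * (phase_density p q (a x) (\<theta> z x *\<^sub>R g x) + phase_density p q (a x) (u x *\<^sub>R \<Theta> z x))"
          using pq by (intro phase_density_add a0[OF x]) auto
        also have "\<dots> \<le> 2 powr q * (?c * phase_density p q (a x) (g x) + ?K)"
        proof (intro mult_left_mono add_mono)
          show "phase_density p q (a x) (\<theta> z x *\<^sub>R g x) \<le> ?c * phase_density p q (a x) (g x)"
            using pq M1(2)[of x] by (intro phase_density_scale a0[OF x]) (auto simp: le_max_iff_disj)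
          have "norm (u x *\<^sub>R \<Theta> z x) \<le> ?N"
            using mult_mono[OF u(2)[of x] M2(2)[of x] M] by simp
          then show "phase_density p q (a x) (u x *\<^sub>R \<Theta> z x) \<le> ?K"
            using pq by (intro phase_density_le_const a0[OF x] A(2)[OF x]) auto
        qed simp
        finally show "norm (phase_density p q (a x) (?g x)) \<le> norm (2 powr q * (?c * phase_density p q (a x) (g x) + ?K))"
          using phase_density_nonneg[OF a0[OF x], of p q "?g x"] by simp
      qed
      show "(\<lambda>x. phase_density p q (a x) (?g x)) \<in> borel_measurable ?M"
        by (rule borel_measurable_phase_density[OF am gm])
    qed
    then obtain b where b: "integrable lborel b"
      "AE x in lborel. x \<in> \<Omega> \<longrightarrow> phase_density p q (a x) (?g x) = b x"
      using borel_representative[OF \<Omega>'] by blast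
    have zC: "z \<in> ?C" using z Z(1) by blast
    show ?thesis
    proof (rule modular_limit_shifted_piece[OF pq C0 a0 p _ op, where b="\<lambda>x. \<bar>b x\<bar>" and v="v z" and M="M1 * M"
          and S="?C \<inter> cball z (r z)" and ?d0.0="d0 z"])
      show "\<bar>\<theta> z x * u x\<bar> \<le> M1 * M" for x
        using mult_mono[OF M1(2)[of x] u(2)[of x]] M1(1) by (simp add: abs_mult)
      show "integrable lborel (\<lambda>x. \<bar>b x\<bar>)" using b(1) by simp
      show "AE y in lborel. y \<in> \<Omega> \<longrightarrow> phase_density p q (a y) (?g y) \<le> \<bar>b y\<bar>"
        using b(2) by eventually_elim auto
      show "compact (?C \<inter> cball z (r z))" by (intro compact_Int cC) simp
      show "AE y in lborel. y \<notin> ?C \<inter> cball z (r z) \<longrightarrow> \<theta> z y * u y = 0"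
        using zero_trace_pair_outside(1)[OF u(1) \<Omega>']
      proof eventually_elim
        case (elim y)
        then show ?case using t0[of y] closure_subset[of \<Omega>] by auto
      qed
      show "0 < d0 z" "d0 z \<le> 1" using sh zC by blast+
      show "y + w \<in> \<Omega>" if "0 < d" "d \<le> d0 z" "y \<in> ?C \<inter> cball z (r z)" "w \<in> cball (d *\<^sub>R v z) d" for d y w
        using sh zC that by blast
    qed simp_all
  qed
  have "modular_limit p q a \<Omega> (\<lambda>x. \<Sum>z\<in>Z. \<theta> z x *\<^sub>R g x + u x *\<^sub>R \<Theta> z x)"
    using pq by (intro modular_limit_sum a0 Z(2) piece) auto
  then show ?thesis
  proof (rule modular_limit_cong)
    show "AE x in lborel. x \<in> \<Omega> \<longrightarrow> (\<Sum>z\<in>Z. \<theta> z x *\<^sub>R g x + u x *\<^sub>R \<Theta> z x) = g x"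
    proof (intro AE_I2 impI)
      fix x assume x: "x \<in> \<Omega>"
      have one: "(\<Sum>z\<in>Z. \<theta> z x) = 1" if "x \<in> \<Omega>" for x using \<theta>(3) closure_subset that by blast
      have "(\<Sum>z\<in>Z. \<theta> z x *\<^sub>R g x + u x *\<^sub>R \<Theta> z x) = (\<Sum>z\<in>Z. \<theta> z x) *\<^sub>R g x + u x *\<^sub>R (\<Sum>z\<in>Z. \<Theta> z x)"
        by (simp add: sum.distrib scaleR_sum_left scaleR_sum_right)
      also have "(\<Sum>z\<in>Z. \<Theta> z x) = 0"
      proof (rule sum_grad_const_zero[OF op x, of Z \<theta> \<Theta> 1])
        show "C1_grad (\<theta> z) (\<Theta> z)" if "z \<in> Z" for z using \<theta>(1) that by blast
      qed (rule one)
      finally show "(\<Sum>z\<in>Z. \<theta> z x *\<^sub>R g x + u x *\<^sub>R \<Theta> z x) = g x" by (simp add: one[OF x])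
    qed
  qed
qed

text \<open>Allows the weak gradient of the datum and of a competitor to be replaced by Borel
  representatives.\<close>

lemma has_weak_gradient_cong_AE:
  fixes u :: "real^'n::finite \<Rightarrow> real"
  assumes \<Omega>: "open \<Omega>" and u: "has_weak_gradient \<Omega> u g"
    and h: "integrable lborel h" "AE x in lborel. x \<in> \<Omega> \<longrightarrow> g x = h x"
  shows "has_weak_gradient \<Omega> u h"
  unfolding has_weak_gradient_def
proof (intro conjI ballI allI)
  have \<Omega>': "\<Omega> \<in> sets borel" using \<Omega> by simp
  show "locally_integrable \<Omega> u" using u by (simp add: has_weak_gradient_def)
  show "locally_integrable \<Omega> h" by (rule integrable_lborel_locally_integrable[OF h(1)])
  fix \<phi> i assume \<phi>: "\<phi> \<in> test_functions \<Omega>"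
  have "\<phi> \<in> borel_measurable borel" "h \<in> borel_measurable borel"
    using C1_grad_continuous[OF test_function_C1_grad[OF \<phi>]] h(1) by (auto intro: borel_measurable_continuous_onI)
  then have [measurable]: "\<phi> \<in> borel_measurable (lebesgue_on \<Omega>)" "h \<in> borel_measurable (lebesgue_on \<Omega>)"
    by (auto intro: borel_measurable_lebesgue_on)
  have "(\<integral>x. g x $ i * \<phi> x \<partial>lebesgue_on \<Omega>) = (\<integral>x. h x $ i * \<phi> x \<partial>lebesgue_on \<Omega>)"
  proof (rule integral_cong_AE)
    show "(\<lambda>x. g x $ i * \<phi> x) \<in> borel_measurable (lebesgue_on \<Omega>)"
      using weak_gradient_integrands(2)[OF \<Omega> u \<phi>] by simp
    show "AE x in lebesgue_on \<Omega>. g x $ i * \<phi> x = h x $ i * \<phi> x"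
      unfolding AE_lebesgue_on_iff[OF \<Omega>'] using h(2) by eventually_elim auto
  qed measurable
  then show "(\<integral>x. u x * partial_deriv i \<phi> x \<partial>lebesgue_on \<Omega>) = - (\<integral>x. h x $ i * \<phi> x \<partial>lebesgue_on \<Omega>)"
    using u \<phi> by (simp add: has_weak_gradient_def)
qed

lemma test_functions_energy_space:
  fixes \<phi> :: "real^'n::finite \<Rightarrow> real"
  assumes pq: "0 \<le> p" "0 \<le> q" and \<Omega>: "open \<Omega>" "bounded \<Omega>" and a: "a \<in> weight_class \<kappa> \<Omega>" and \<kappa>: "\<kappa> > 0"
    and \<phi>: "\<phi> \<in> test_functions \<Omega>"
  shows "\<phi> \<in> energy_space p q a \<Omega>"
proof -
  obtain S where S: "C1_grad \<phi> (grad \<phi>)" "compact S" "S \<subseteq> \<Omega>" "\<And>x. x \<notin> S \<Longrightarrow> \<phi> x = 0" "\<And>x. x \<notin> S \<Longrightarrow> grad \<phi> x = 0"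
    using test_function_C1[OF \<phi>] by metis
  note bs = C1_grad_cont_bdd_supp(1,2)[OF S(1,2,4)]
  obtain N where N: "N > 0" "\<And>x. norm (grad \<phi> x) \<le> N" using cont_bdd_supp_bounded[OF bs(2)] by blast
  obtain A where A: "A \<ge> 0" "\<And>x. x \<in> \<Omega> \<Longrightarrow> a x \<le> A" using weight_class_bounded[OF \<Omega>(2) a \<kappa>] by blast
  have a0: "\<And>x. x \<in> \<Omega> \<Longrightarrow> 0 \<le> a x" using a unfolding weight_class_def by blast
  let ?c = "N powr p + A * N powr q"
  have c: "?c \<ge> 0" using A(1) by simp
  have "double_phase p q a \<Omega> \<phi> = (\<integral>\<^sup>+x. ennreal (phase_density p q (a x) (grad \<phi> x)) \<partial>lebesgue_on \<Omega>)"
    by (rule double_phase_eq[OF \<Omega>(1) C1_grad_has_weak_gradient[OF \<Omega>(1) S(1)]])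
  also have "\<dots> \<le> (\<integral>\<^sup>+x. ennreal ?c \<partial>lebesgue_on \<Omega>)"
    using pq a0 A(2) N(2) by (intro nn_integral_mono ennreal_leI phase_density_le_const) auto
  also have "\<dots> < \<infinity>"
    using integrable_const_lebesgue_on[OF \<Omega>, of ?c] c by (auto simp: integrable_iff_bounded)
  finally show ?thesis
    using zero_trace_pair_sobolev_W11_0[OF \<Omega>(1) test_function_pair[OF \<phi>]] by (simp add: energy_space_def)
qed

text \<open>A truncation with continuous slope, as \<open>zero_trace_pair_compose\<close> requires:
  it is bounded by k \<pi>/2, and its slope lies in (0, 1] and tends to 1 as k \<rightarrow>
  \<infinity>.\<close>

lemma truncation_DERIV:
  fixes k :: real
  assumes "k > 0"
  shows "((\<lambda>s. k * arctan (s / k)) has_real_derivative inverse (1 + (s / k)\<^sup>2)) (at s)"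
  using assms by (auto intro!: derivative_eq_intros)

lemma truncation_derivative_bound: "\<bar>inverse (1 + t\<^sup>2)\<bar> \<le> (1::real)"
proof -
  have "1 \<le> 1 + t\<^sup>2" by simp
  then show ?thesis by (simp add: inverse_le_1_iff)
qed

text \<open>Two limits are taken in succession. For fixed k, the truncated competitor is reached by
  test functions, so the infimum over these is at most its energy. Then k \<rightarrow> \<infinity>,
  with one dominating function for all k because truncation decreases the density. The other
  inequality is the inclusion of the test functions in W.\<close>

lemma no_gap:
  fixes u\<^sub>0 :: "real^'n::finite \<Rightarrow> real"
  assumes pq: "1 < p" "p < q" "q \<le> p + \<kappa>" "\<kappa> > 0"
    and \<Omega>: "bounded_lipschitz_domain \<Omega>" and a: "a \<in> weight_class \<kappa> \<Omega>"
    and u0: "u\<^sub>0 \<in> sobolev_W11 \<Omega>" "double_phase p q a \<Omega> u\<^sub>0 < \<infinity>"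
  shows "(INF v\<in>translate u\<^sub>0 (energy_space p q a \<Omega>). double_phase p q a \<Omega> v) =
    (INF w\<in>translate u\<^sub>0 (test_functions \<Omega>). double_phase p q a \<Omega> w)"
proof (rule antisym)
  let ?M = "lebesgue_on \<Omega>"
  have op: "open \<Omega>" and bd: "bounded \<Omega>" using \<Omega> by (auto simp: bounded_lipschitz_domain_def)
  have \<Omega>': "\<Omega> \<in> sets borel" using op by simp
  have a0: "\<And>x. x \<in> \<Omega> \<Longrightarrow> 0 \<le> a x" and am [measurable]: "a \<in> borel_measurable ?M"
    using a unfolding weight_class_def by blast+
  have apos: "AE x in ?M. 0 \<le> a x" using a0 by (intro AE_I2) simp
  have "translate u\<^sub>0 (test_functions \<Omega>) \<subseteq> translate u\<^sub>0 (energy_space p q a \<Omega>)"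
    unfolding translate_def using test_functions_energy_space[OF _ _ op bd a pq(4)] pq by (intro image_mono subsetI) auto
  then show "(INF v\<in>translate u\<^sub>0 (energy_space p q a \<Omega>). double_phase p q a \<Omega> v) \<le>
      (INF w\<in>translate u\<^sub>0 (test_functions \<Omega>). double_phase p q a \<Omega> w)"
    by (intro INF_superset_mono) auto
  obtain g1 where g1: "has_weak_gradient \<Omega> u\<^sub>0 g1" "integrable ?M g1"
    using u0(1) unfolding sobolev_W11_def by blast
  obtain g0 where g0: "integrable lborel g0" "AE x in lborel. x \<in> \<Omega> \<longrightarrow> g1 x = g0 x"
    using borel_representative[OF \<Omega>' g1(2)] by blast
  have w0: "has_weak_gradient \<Omega> u\<^sub>0 g0" by (rule has_weak_gradient_cong_AE[OF op g1(1) g0])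
  show "(INF w\<in>translate u\<^sub>0 (test_functions \<Omega>). double_phase p q a \<Omega> w) \<le>
      (INF v\<in>translate u\<^sub>0 (energy_space p q a \<Omega>). double_phase p q a \<Omega> v)"
  proof (rule INF_greatest)
    fix v assume "v \<in> translate u\<^sub>0 (energy_space p q a \<Omega>)"
    then obtain \<phi> where \<phi>: "\<phi> \<in> sobolev_W11_0 \<Omega>" "double_phase p q a \<Omega> \<phi> < \<infinity>" "v = (\<lambda>x. u\<^sub>0 x + \<phi> x)"
      unfolding translate_def energy_space_def by auto
    obtain u g where u: "zero_trace_pair \<Omega> u g" "has_weak_gradient \<Omega> \<phi> (weak_gradient \<Omega> \<phi>)"
      "AE x in lborel. x \<in> \<Omega> \<longrightarrow> weak_gradient \<Omega> \<phi> x = g x"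
      using sobolev_W11_0_pair[OF op \<phi>(1)] by metis
    note i = zero_trace_pair_integrable[OF u(1)]
    have w\<phi>: "has_weak_gradient \<Omega> \<phi> g" by (rule has_weak_gradient_cong_AE[OF op u(2) i(2) u(3)])
    have ub: "u \<in> borel_measurable borel" "g \<in> borel_measurable borel" "g0 \<in> borel_measurable borel"
      using i g0(1) by auto
    then have [measurable]: "u \<in> borel_measurable ?M" "g \<in> borel_measurable ?M" "g0 \<in> borel_measurable ?M"
      by (auto intro: borel_measurable_lebesgue_on)
    have Dfin: "integrable ?M (\<lambda>x. phase_density p q (a x) (f x))"
      if "f \<in> borel_measurable ?M" "(\<integral>\<^sup>+x. ennreal (phase_density p q (a x) (f x)) \<partial>?M) < \<infinity>" for f :: "real^'n \<Rightarrow> real^'n"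
    proof (rule integrableI_nonneg)
      show "AE x in ?M. 0 \<le> phase_density p q (a x) (f x)" using apos by eventually_elim (rule phase_density_nonneg)
    qed (use that in auto)
    have D: "integrable ?M (\<lambda>x. phase_density p q (a x) (g x))"
      using \<phi>(2) by (intro Dfin) (simp_all add: double_phase_eq[OF op w\<phi>])
    have D0: "integrable ?M (\<lambda>x. phase_density p q (a x) (g0 x))"
      using u0(2) by (intro Dfin) (simp_all add: double_phase_eq[OF op w0])
    define s where "s k x = inverse (1 + (u x / real (Suc k))\<^sup>2)" for k x
    have s1: "\<bar>s k x\<bar> \<le> 1" for k x unfolding s_def by (rule truncation_derivative_bound)
    have sm: "s k \<in> borel_measurable borel" for k unfolding s_def[abs_def] using ub(1) by measurable
    then have [measurable]: "s k \<in> borel_measurable ?M" for k by (rule borel_measurable_lebesgue_on)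
    have sD: "phase_density p q (a x) (s k x *\<^sub>R g x) \<le> phase_density p q (a x) (g x)" if "x \<in> \<Omega>" for k x
      using pq s1[of k x] by (intro phase_density_mono a0[OF that]) (auto intro: mult_left_le_one_le)
    have step: "(INF w\<in>translate u\<^sub>0 (test_functions \<Omega>). double_phase p q a \<Omega> w) \<le>
      (\<integral>\<^sup>+x. ennreal (phase_density p q (a x) (g0 x + s k x *\<^sub>R g x)) \<partial>?M)" for k
    proof (rule INF_test_le_modular_limit[OF op _ _ am a0 w0 g0(1) u0(2)])
      let ?c = "real (Suc k)"
      have p: "zero_trace_pair \<Omega> (\<lambda>x. ?c * arctan (u x / ?c)) (\<lambda>x. s k x *\<^sub>R g x)"
        unfolding s_def
      proof (rule zero_trace_pair_compose[OF u(1)])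
        show "((\<lambda>s. ?c * arctan (s / ?c)) has_real_derivative inverse (1 + (s / ?c)\<^sup>2)) (at s)" for s
          by (rule truncation_DERIV) simp
        have "1 + (s / ?c)\<^sup>2 \<noteq> 0" for s
        proof -
          have "0 < 1 + (s / ?c)\<^sup>2" by (intro add_pos_nonneg) auto
          then show ?thesis by linarith
        qed
        then show "continuous_on UNIV (\<lambda>s. inverse (1 + (s / ?c)\<^sup>2))"
          by (intro continuous_intros) auto
        show "\<bar>inverse (1 + (s / ?c)\<^sup>2)\<bar> \<le> 1" for s by (rule truncation_derivative_bound)
      qed simp
      show "modular_limit p q a \<Omega> (\<lambda>x. s k x *\<^sub>R g x)"
      proof (rule bounded_modular_limit[OF _ _ pq(3,4) \<Omega> a p])
        show "\<bar>?c * arctan (u x / ?c)\<bar> \<le> ?c * (pi / 2)" for x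
          using arctan_lbound[of "u x / ?c"] arctan_ubound[of "u x / ?c"]
          by (simp only: abs_mult) (intro mult_mono, auto)
        show "integrable ?M (\<lambda>x. phase_density p q (a x) (s k x *\<^sub>R g x))"
        proof (rule Bochner_Integration.integrable_bound[OF D])
          show "AE x in ?M. norm (phase_density p q (a x) (s k x *\<^sub>R g x)) \<le> norm (phase_density p q (a x) (g x))"
          proof (rule AE_I2)
            fix x assume "x \<in> space ?M"
            then have x: "x \<in> \<Omega>" by simp
            show "norm (phase_density p q (a x) (s k x *\<^sub>R g x)) \<le> norm (phase_density p q (a x) (g x))"
              using sD[OF x, of k] phase_density_nonneg[OF a0[OF x], of p q "s k x *\<^sub>R g x"] by simp
          qed
        qed measurable
      qed (use pq in auto)
      show "(\<lambda>x. s k x *\<^sub>R g x) \<in> borel_measurable borel" using sm ub(2) by measurable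
    qed (use pq in auto)
    have "(INF w\<in>translate u\<^sub>0 (test_functions \<Omega>). double_phase p q a \<Omega> w) \<le>
      (\<integral>\<^sup>+x. ennreal (phase_density p q (a x) (g0 x + g x)) \<partial>?M)"
    proof (rule nn_integral_ge_of_limit[where Ej="\<lambda>k x. phase_density p q (a x) (g0 x + s k x *\<^sub>R g x)" and
          h="\<lambda>x. 2 powr q * (phase_density p q (a x) (g0 x) + phase_density p q (a x) (g x))" and
          hj="\<lambda>k x. 2 powr q * (phase_density p q (a x) (g0 x) + phase_density p q (a x) (g x))"])
      show "AE x in ?M. 0 \<le> phase_density p q (a x) (g0 x + g x)"
        "AE x in ?M. 0 \<le> phase_density p q (a x) (g0 x + s k x *\<^sub>R g x)" for k
        using apos by (auto elim!: eventually_mono intro: phase_density_nonneg)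
      show "AE x in ?M. phase_density p q (a x) (g0 x + s k x *\<^sub>R g x) \<le>
        2 powr q * (phase_density p q (a x) (g0 x) + phase_density p q (a x) (g x))" for k
      proof (rule AE_I2)
        fix x assume "x \<in> space ?M"
        then have x: "x \<in> \<Omega>" by simp
        have "phase_density p q (a x) (g0 x + s k x *\<^sub>R g x) \<le>
          2 powr q * (phase_density p q (a x) (g0 x) + phase_density p q (a x) (s k x *\<^sub>R g x))"
          using pq by (intro phase_density_add a0[OF x]) auto
        also have "\<dots> \<le> 2 powr q * (phase_density p q (a x) (g0 x) + phase_density p q (a x) (g x))"
          using sD[OF x] by (intro mult_left_mono add_mono) auto
        finally show "phase_density p q (a x) (g0 x + s k x *\<^sub>R g x) \<le>
          2 powr q * (phase_density p q (a x) (g0 x) + phase_density p q (a x) (g x))" .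
      qed
      show "AE x in ?M. (\<lambda>k. phase_density p q (a x) (g0 x + s k x *\<^sub>R g x)) \<longlonglongrightarrow> phase_density p q (a x) (g0 x + g x)"
      proof (rule AE_I2)
        fix x
        have "(\<lambda>k. u x / real (Suc k)) \<longlonglongrightarrow> 0"
          using tendsto_mult_right_zero[OF LIMSEQ_inverse_real_of_nat, of "u x"] by (simp add: divide_inverse)
        then have "(\<lambda>k. s k x) \<longlonglongrightarrow> inverse (1 + 0\<^sup>2)"
          unfolding s_def by (intro tendsto_intros) auto
        then have "(\<lambda>k. g0 x + s k x *\<^sub>R g x) \<longlonglongrightarrow> g0 x + 1 *\<^sub>R g x" by (intro tendsto_intros) simp
        then show "(\<lambda>k. phase_density p q (a x) (g0 x + s k x *\<^sub>R g x)) \<longlonglongrightarrow> phase_density p q (a x) (g0 x + g x)"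
          using pq by (intro phase_density_tendsto) auto
      qed
      show "integrable ?M (\<lambda>x. 2 powr q * (phase_density p q (a x) (g0 x) + phase_density p q (a x) (g x)))"
        "integrable ?M (\<lambda>x. 2 powr q * (phase_density p q (a x) (g0 x) + phase_density p q (a x) (g x)))"
        using D D0 by simp_all
    qed (use step in simp_all)
    then show "(INF w\<in>translate u\<^sub>0 (test_functions \<Omega>). double_phase p q a \<Omega> w) \<le> double_phase p q a \<Omega> v"
      unfolding \<phi>(3) double_phase_eq[OF op has_weak_gradient_add[OF op w0 w\<phi>]] .
  qed
qed

section \<open>Presence of the gap\<close>

subsection \<open>The unit ball as a Lipschitz domain\<close>

text \<open>Near z the ball is described from the inward direction -z by the hemisphere. The square
  root has unbounded slope at |y| = 1, hence the cut at 1/2, which is inactive in the chart because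
  there |y| \<le> |x - z| < 1/2. With S, T the cut norms and A, B the roots, (A - B)(A + B) = (T -
  S)(T + S) gives the Lipschitz constant 1, as A + B \<ge> 1 and S + T \<le> 1.\<close>

lemma unit_ball_chart:
  fixes z :: "real^'n::finite"
  assumes z: "norm z = 1"
  defines "\<gamma> \<equiv> \<lambda>y :: real^'n. - sqrt (1 - (min (norm y) (1/2))\<^sup>2)"
  shows "1-lipschitz_on {y. y \<bullet> (- z) = 0} \<gamma>"
    "ball 0 1 \<inter> ball z (1/2) = {x \<in> ball z (1/2). \<gamma> (x - (x \<bullet> (- z)) *\<^sub>R (- z)) < x \<bullet> (- z)}"
proof -
  have bnd: "0 \<le> min (norm y) (1/2)" "min (norm y) (1/2) \<le> 1/2" for y :: "real^'n" by auto
  have ge: "1/2 \<le> sqrt (1 - (min (norm y) (1/2))\<^sup>2)" for y :: "real^'n"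
  proof (rule real_le_rsqrt)
    have "(min (norm y) (1/2))\<^sup>2 \<le> (1/2)\<^sup>2" using bnd by (intro power_mono) auto
    then show "(1/2)\<^sup>2 \<le> 1 - (min (norm y) (1/2))\<^sup>2" by (simp add: power2_eq_square)
  qed
  show "1-lipschitz_on {y. y \<bullet> (- z) = 0} \<gamma>"
  proof (rule lipschitz_onI)
    fix x y :: "real^'n"
    let ?s = "min (norm x) (1/2)" and ?t = "min (norm y) (1/2)"
    let ?a = "sqrt (1 - ?s\<^sup>2)" and ?b = "sqrt (1 - ?t\<^sup>2)"
    have sq: "?s\<^sup>2 \<le> 1" "?t\<^sup>2 \<le> 1" using bnd[of x] bnd[of y] by (auto intro!: power_le_one)
    have "(?a - ?b) * (?a + ?b) = ?a\<^sup>2 - ?b\<^sup>2" by (simp add: power2_eq_square algebra_simps)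
    also have "\<dots> = (?t - ?s) * (?t + ?s)" using sq by (simp add: power2_eq_square algebra_simps)
    finally have eq: "(?a - ?b) * (?a + ?b) = (?t - ?s) * (?t + ?s)" .
    have pos: "0 \<le> ?a + ?b" "0 \<le> ?t + ?s" using ge[of x] ge[of y] by simp_all
    have "\<bar>?a - ?b\<bar> * (?a + ?b) = \<bar>?t - ?s\<bar> * (?t + ?s)"
      using arg_cong[OF eq, of abs] unfolding abs_mult abs_of_nonneg[OF pos(1)] abs_of_nonneg[OF pos(2)] .
    moreover have "\<bar>?a - ?b\<bar> * 1 \<le> \<bar>?a - ?b\<bar> * (?a + ?b)"
      using ge[of x] ge[of y] by (intro mult_left_mono) auto
    moreover have "\<bar>?t - ?s\<bar> * (?t + ?s) \<le> \<bar>?t - ?s\<bar> * 1"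
      using bnd[of x] bnd[of y] by (intro mult_left_mono) auto
    moreover have "\<bar>?t - ?s\<bar> \<le> norm (x - y)"
    proof -
      have "\<bar>min b c - min a c\<bar> \<le> \<bar>a - b\<bar>" for a b c :: real by (simp add: min_def abs_if)
      then show ?thesis using norm_triangle_ineq3[of x y] order_trans by blast
    qed
    ultimately have "\<bar>?a - ?b\<bar> \<le> norm (x - y)" by linarith
    moreover have "dist (\<gamma> x) (\<gamma> y) = \<bar>?a - ?b\<bar>" unfolding \<gamma>_def dist_real_def by linarith
    ultimately show "dist (\<gamma> x) (\<gamma> y) \<le> 1 * dist x y" by (simp only: dist_norm mult_1)
  qed simp
  have "(x \<in> ball 0 1) = (\<gamma> (x - (x \<bullet> (- z)) *\<^sub>R (- z)) < x \<bullet> (- z))" if x: "x \<in> ball z (1/2)" for x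
  proof -
    let ?h = "x \<bullet> z"
    define y where "y = x - ?h *\<^sub>R z"
    have zz: "z \<bullet> z = 1" using z by (simp add: dot_square_norm)
    have d: "norm (x - z) < 1/2" using x by (simp add: dist_norm norm_minus_commute)
    have "\<bar>(x - z) \<bullet> z\<bar> \<le> norm (x - z) * norm z" by (rule Cauchy_Schwarz_ineq2)
    then have h: "?h > 0" using d z zz by (simp add: inner_diff_left)
    have ny: "(norm y)\<^sup>2 = (norm x)\<^sup>2 - ?h\<^sup>2"
      by (simp only: y_def power2_norm_eq_inner inner_diff_left inner_diff_right inner_scaleR_left inner_scaleR_right zz
          inner_commute[of z x] power2_eq_square[of ?h]) simp
    have "(norm y)\<^sup>2 \<le> (norm (x - z))\<^sup>2"
    proof -
      have "(norm (x - z))\<^sup>2 = (norm x)\<^sup>2 - 2 * ?h + 1"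
        by (simp only: power2_norm_eq_inner inner_diff_left inner_diff_right zz inner_commute[of z x])
      moreover have "0 \<le> (?h - 1)\<^sup>2" by simp
      ultimately show ?thesis unfolding ny by (simp add: power2_eq_square algebra_simps)
    qed
    then have "norm y \<le> norm (x - z)" by (rule power2_le_imp_le) simp
    then have m: "min (norm y) (1/2) = norm y" using d by simp
    have "(x \<in> ball 0 1) = ((norm x)\<^sup>2 < 1)" using abs_square_less_1[of "norm x"] by simp
    also have "\<dots> = (?h\<^sup>2 < 1 - (norm y)\<^sup>2)" unfolding ny by linarith
    also have "\<dots> = (?h < sqrt (1 - (norm y)\<^sup>2))"
      using h real_less_rsqrt real_sqrt_less_mono[of "?h\<^sup>2" "1 - (norm y)\<^sup>2"]
        real_sqrt_less_iff[of "?h\<^sup>2" "1 - (norm y)\<^sup>2"] by simp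
    also have "\<dots> = (\<gamma> (x - (x \<bullet> (- z)) *\<^sub>R (- z)) < x \<bullet> (- z))"
      using m by (simp add: \<gamma>_def y_def)
    finally show ?thesis .
  qed
  then show "ball 0 1 \<inter> ball z (1/2) = {x \<in> ball z (1/2). \<gamma> (x - (x \<bullet> (- z)) *\<^sub>R (- z)) < x \<bullet> (- z)}"
    by blast
qed

lemma bounded_lipschitz_domain_unit_ball: "bounded_lipschitz_domain (ball 0 1 :: (real^'n::finite) set)"
  unfolding bounded_lipschitz_domain_def
proof (intro conjI ballI)
  fix z :: "real^'n" assume "z \<in> frontier (ball 0 1)"
  then have z: "norm z = 1" by simp
  show "\<exists>r>0. \<exists>e L. \<exists>\<gamma> :: real^'n \<Rightarrow> real. norm e = 1 \<and> L-lipschitz_on {y. y \<bullet> e = 0} \<gamma> \<and>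
      ball 0 1 \<inter> ball z r = {x \<in> ball z r. \<gamma> (x - (x \<bullet> e) *\<^sub>R e) < x \<bullet> e}"
    by (rule exI[of _ "1/2"], intro conjI, simp, rule exI[of _ "- z"], rule exI[of _ 1],
        rule exI[of _ "\<lambda>y. - sqrt (1 - (min (norm y) (1/2))\<^sup>2)"])
      (intro conjI unit_ball_chart[OF z], simp add: z)
qed auto

subsection \<open>The singular competitor\<close>

text \<open>A \<open>C\<^sup>1\<close> odd function that is \<open>\<plusminus>1\<close> off \<open>[-1/2, 1/2]\<close>; its derivative is a hat function.\<close>

definition profile :: "real \<Rightarrow> real" where
  "profile s = -1 + 4 * ((max 0 (s + 1/2))\<^sup>2 - 2 * (max 0 s)\<^sup>2 + (max 0 (s - 1/2))\<^sup>2)"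

definition profile' :: "real \<Rightarrow> real" where
  "profile' s = 8 * (max 0 (s + 1/2) - 2 * max 0 s + max 0 (s - 1/2))"

lemma profile_DERIV: "(profile has_real_derivative profile' s) (at s)"
proof -
  have c: "((\<lambda>s. (max 0 (s + c))\<^sup>2) has_real_derivative 2 * max 0 (s + c)) (at s)" for c :: real
    using DERIV_max_0_square[of "s + c"] by (simp add: DERIV_shift)
  have "((\<lambda>s. -1 + 4 * ((max 0 (s + 1/2))\<^sup>2 - 2 * (max 0 (s + 0))\<^sup>2 + (max 0 (s + - (1/2)))\<^sup>2)) has_real_derivative
      0 + 4 * (2 * max 0 (s + 1/2) - 2 * (2 * max 0 (s + 0)) + 2 * max 0 (s + - (1/2)))) (at s)"
    by (intro DERIV_add DERIV_diff DERIV_cmult DERIV_const c)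
  then show ?thesis unfolding profile_def[abs_def] profile'_def by (simp add: algebra_simps)
qed

lemma profile'_continuous: "continuous_on UNIV profile'"
  unfolding profile'_def[abs_def] by (intro continuous_intros)

lemma profile'_bound: "\<bar>profile' s\<bar> \<le> 4"
  by (auto simp: profile'_def max_def)

lemma profile'_zero: "\<bar>s\<bar> \<ge> 1/2 \<Longrightarrow> profile' s = 0"
  by (auto simp: profile'_def max_def)

lemma profile_1: "s \<ge> 1/2 \<Longrightarrow> profile s = 1"
  by (simp add: profile_def max_def power2_eq_square algebra_simps)

lemma profile_minus_1: "s \<le> - (1/2) \<Longrightarrow> profile s = -1"
  by (simp add: profile_def max_def)

text \<open>In the middle range the formula with two numbers X, Y in [0, 1] gives values between -9
  and 3; any bound serves as a dominating constant.\<close>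

lemma profile_bound: "\<bar>profile s\<bar> \<le> 9"
proof -
  consider "s \<ge> 1/2" | "s \<le> - (1/2)" | "\<bar>s\<bar> \<le> 1/2" by linarith
  then show ?thesis
  proof cases
    case 3
    define X where "X = (max 0 (s + 1/2))\<^sup>2"
    define Y where "Y = (max 0 s)\<^sup>2"
    have "0 \<le> X" "X \<le> 1" unfolding X_def using 3 by (auto intro: power_le_one)
    moreover have "0 \<le> Y" "Y \<le> 1" unfolding Y_def using 3 by (auto intro: power_le_one)
    moreover have "max 0 (s - 1/2) = 0" using 3 by auto
    then have "profile s = -1 + 4 * (X - 2 * Y)" by (simp add: profile_def X_def Y_def)
    ultimately show ?thesis by (simp add: abs_le_iff)
  qed (simp_all add: profile_1 profile_minus_1)
qed

lemma C1_grad_powr: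
  assumes f: "C1_grad f F" and nz: "\<And>x. f x > 0"
  shows "C1_grad (\<lambda>x. f x powr r) (\<lambda>x. (r * f x powr (r - 1)) *\<^sub>R F x)"
  unfolding C1_grad_def
proof (intro conjI allI)
  fix x
  have d: "(f has_derivative (\<lambda>h. h \<bullet> F x)) (at x)" using f by (auto simp: C1_grad_def)
  have "((\<lambda>s. s powr r) has_real_derivative r * f x powr (r - 1)) (at (f x))"
    by (rule has_real_derivative_powr[OF nz])
  from has_derivative_compose[OF d this[unfolded has_field_derivative_def]]
  show "((\<lambda>x. f x powr r) has_derivative (\<lambda>h. h \<bullet> ((r * f x powr (r - 1)) *\<^sub>R F x))) (at x)"
    by (rule has_derivative_eq_rhs) auto
  have "f x \<noteq> 0" for x using nz[of x] by simp
  then show "continuous_on UNIV (\<lambda>x. (r * f x powr (r - 1)) *\<^sub>R F x)"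
    using f C1_grad_continuous[OF f] by (auto simp: C1_grad_def intro!: continuous_intros)
qed

text \<open>\<open>cone_datum\<close> regularises \<open>x \<mapsto> profile (x \<bullet> e / \<bar>x\<bar>)\<close> inside the ball of radius \<open>1/2\<close>,
  where \<open>\<bar>x\<bar>\<^sup>2\<close> is replaced by the positive function \<open>reg_square\<close>.\<close>

definition reg_square :: "real^'n::finite \<Rightarrow> real" where
  "reg_square x = x \<bullet> x + (max 0 (1/4 - x \<bullet> x))\<^sup>2"

definition cone_datum :: "real^'n::finite \<Rightarrow> real^'n \<Rightarrow> real" where
  "cone_datum e x = profile ((x \<bullet> e) * reg_square x powr (- (1/2)))"

definition cone_limit :: "real^'n::finite \<Rightarrow> real^'n \<Rightarrow> real" where
  "cone_limit e x = profile ((x \<bullet> e) / norm x)"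

text \<open>The chain rule away from the origin, where x \<bullet> e / |x| has the gradient e/|x| -
  (x \<bullet> e) x/|x|^3. The value at the origin, produced by division by zero, concerns a null
  set.\<close>

definition cone_limit_grad :: "real^'n::finite \<Rightarrow> real^'n \<Rightarrow> real^'n" where
  "cone_limit_grad e x = profile' ((x \<bullet> e) / norm x) *\<^sub>R ((1 / norm x) *\<^sub>R e - ((x \<bullet> e) / norm x ^ 3) *\<^sub>R x)"

lemma reg_square_pos: "reg_square x > 0"
proof (cases "x = 0")
  case False
  then have "x \<bullet> x > 0" by simp
  then show ?thesis unfolding reg_square_def by (intro add_pos_nonneg) auto
qed (simp add: reg_square_def)

lemma C1_grad_inner_const: "C1_grad (\<lambda>x. x \<bullet> e) (\<lambda>x. e)"
  unfolding C1_grad_def by (auto intro!: derivative_eq_intros)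

lemma C1_grad_reg_square:
  "C1_grad reg_square (\<lambda>x. 2 *\<^sub>R x + (2 * max 0 (1/4 - x \<bullet> x)) *\<^sub>R ((-2) *\<^sub>R x))"
proof -
  have q: "C1_grad (\<lambda>x :: real^'n. c - x \<bullet> x) (\<lambda>x. (-2) *\<^sub>R x)" for c
    using C1_grad_norm_square[of c 0] by simp
  have "C1_grad (\<lambda>x :: real^'n. - (0 - x \<bullet> x)) (\<lambda>x. - ((-2) *\<^sub>R x))"
    using C1_grad_cmult[OF q, of "-1" 0] by simp
  from C1_grad_add[OF this C1_grad_max_0_square[OF q, of "1/4"]] show ?thesis
    by (simp add: reg_square_def[abs_def])
qed

lemma cone_datum_C1: "C1_grad (cone_datum e) (grad (cone_datum e))"
proof -
  have "\<exists>G. C1_grad (cone_datum e) G"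
    unfolding cone_datum_def[abs_def]
    by (rule exI, rule C1_grad_compose_real[OF profile_DERIV profile'_continuous
          C1_grad_mult[OF C1_grad_inner_const C1_grad_powr[OF C1_grad_reg_square reg_square_pos]]])
  then obtain G where G: "C1_grad (cone_datum e) G" by blast
  then have "grad (cone_datum e) = G" using grad_C1 by blast
  with G show ?thesis by simp
qed

lemma reg_square_far:
  fixes x :: "real^'n::finite"
  assumes "norm x \<ge> 1/2"
  shows "1/4 - x \<bullet> x \<le> 0" "reg_square x = (norm x)\<^sup>2"
proof -
  have "(1/2)\<^sup>2 \<le> (norm x)\<^sup>2" using assms by (intro power_mono) auto
  then show *: "1/4 - x \<bullet> x \<le> 0" by (simp add: dot_square_norm power_one_over)
  show "reg_square x = (norm x)\<^sup>2"
    unfolding reg_square_def dot_square_norm max_absorb1[OF *[unfolded dot_square_norm]] by simp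
qed

lemma norm_square_powr: "(norm x)\<^sup>2 powr (- (1/2)) = 1 / norm x" "(norm x)\<^sup>2 powr (- (1/2) - 1) = 1 / norm x ^ 3"
proof -
  have eq: "(norm x)\<^sup>2 = norm x powr 2" by simp
  have "(norm x)\<^sup>2 powr (- (1/2)) = norm x powr (- 1)" unfolding eq powr_powr by simp
  then show "(norm x)\<^sup>2 powr (- (1/2)) = 1 / norm x" by (simp add: powr_minus_divide)
  have "(norm x)\<^sup>2 powr (- (1/2) - 1) = norm x powr (- 3)" unfolding eq powr_powr by simp
  then show "(norm x)\<^sup>2 powr (- (1/2) - 1) = 1 / norm x ^ 3" by (simp add: powr_minus_divide)
qed

lemma cone_datum_far:
  assumes "norm x \<ge> 1/2"
  shows "cone_datum e x = cone_limit e x" "grad (cone_datum e) x = cone_limit_grad e x"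
proof -
  note far = reg_square_far[OF assms]
  show "cone_datum e x = cone_limit e x"
    by (simp add: cone_datum_def cone_limit_def far(2) norm_square_powr)
  let ?W = "(- (1/2) * reg_square x powr (- (1/2) - 1)) *\<^sub>R (2 *\<^sub>R x + (2 * max 0 (1/4 - x \<bullet> x)) *\<^sub>R ((-2) *\<^sub>R x))"
  have "grad (cone_datum e) x = profile' ((x \<bullet> e) * reg_square x powr (- (1/2))) *\<^sub>R
      ((x \<bullet> e) *\<^sub>R ?W + reg_square x powr (- (1/2)) *\<^sub>R e)"
    unfolding cone_datum_def[abs_def]
    by (rule grad_C1[OF C1_grad_compose_real[OF profile_DERIV profile'_continuous
          C1_grad_mult[OF C1_grad_inner_const C1_grad_powr[OF C1_grad_reg_square reg_square_pos]]]])
  also have "?W = (- 1 / norm x ^ 3) *\<^sub>R x"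
    using far(1) by (simp only: far(2) norm_square_powr max_absorb1) simp
  also have "reg_square x powr (- (1/2)) = 1 / norm x" by (simp only: far(2) norm_square_powr)
  finally show "grad (cone_datum e) x = cone_limit_grad e x"
    by (simp add: cone_limit_grad_def algebra_simps)
qed

text \<open>Homogeneity of degree 0, and of degree -1 for the gradient: dilating the regularised
  datum by 2^k shrinks the region of disagreement with the limit and changes nothing
  elsewhere.\<close>

lemma cone_limit_scale:
  assumes "c > 0"
  shows "cone_limit e (c *\<^sub>R x) = cone_limit e x" "c *\<^sub>R cone_limit_grad e (c *\<^sub>R x) = cone_limit_grad e x"
  using assms by (simp_all add: cone_limit_def cone_limit_grad_def scaleR_diff_right power_mult_distrib power3_eq_cube)

lemma cone_limit_grad_zero: "\<bar>x \<bullet> e\<bar> \<ge> norm x / 2 \<Longrightarrow> cone_limit_grad e x = 0"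
proof (cases "x = 0")
  case False
  moreover assume "\<bar>x \<bullet> e\<bar> \<ge> norm x / 2"
  ultimately have "\<bar>(x \<bullet> e) / norm x\<bar> \<ge> 1/2" by (simp add: field_simps)
  then show ?thesis by (simp add: cone_limit_grad_def profile'_zero)
qed (simp add: cone_limit_grad_def)

lemma norm_cone_limit_grad:
  assumes "norm e = 1"
  shows "norm (cone_limit_grad e x) \<le> 8 / norm x"
proof (cases "x = 0")
  case False
  have "norm ((1 / norm x) *\<^sub>R e - ((x \<bullet> e) / norm x ^ 3) *\<^sub>R x) \<le> 1 / norm x + \<bar>x \<bullet> e\<bar> / norm x ^ 3 * norm x"
    using norm_triangle_ineq4[of "(1 / norm x) *\<^sub>R e" "((x \<bullet> e) / norm x ^ 3) *\<^sub>R x"] assms by simp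
  also have "\<bar>x \<bullet> e\<bar> / norm x ^ 3 * norm x \<le> norm x / norm x ^ 3 * norm x"
    using Cauchy_Schwarz_ineq2[of x e] assms by (intro mult_right_mono divide_right_mono) auto
  also have "norm x / norm x ^ 3 * norm x = 1 / norm x" using False by (simp add: power3_eq_cube)
  finally have "norm ((1 / norm x) *\<^sub>R e - ((x \<bullet> e) / norm x ^ 3) *\<^sub>R x) \<le> 2 / norm x" by simp
  then have "\<bar>profile' ((x \<bullet> e) / norm x)\<bar> * norm ((1 / norm x) *\<^sub>R e - ((x \<bullet> e) / norm x ^ 3) *\<^sub>R x) \<le> 4 * (2 / norm x)"
    by (intro mult_mono profile'_bound) auto
  then show ?thesis by (simp add: cone_limit_grad_def)
qed (simp add: cone_limit_grad_def)

text \<open>Compactness gives a bound B on the ball of radius 1/2, where |x| \<le> 1 turns it into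
  B/|x|. Outside, the bound 8/|x| of the limit applies, which is at most 16 there; B + 16 covers all
  cases.\<close>

lemma norm_grad_cone_datum:
  fixes e :: "real^'n::finite"
  assumes e: "norm e = 1"
  obtains C where "C > 0" "\<And>x. norm (grad (cone_datum e) x) \<le> C" "\<And>x. x \<noteq> 0 \<Longrightarrow> norm (grad (cone_datum e) x) \<le> C / norm x"
    "\<And>x. x \<noteq> 0 \<Longrightarrow> norm (cone_limit_grad e x) \<le> C / norm x"
proof -
  have "continuous_on (cball 0 (1/2)) (grad (cone_datum e))"
    using cone_datum_C1[of e] by (auto simp: C1_grad_def intro: continuous_on_subset)
  then have "compact (grad (cone_datum e) ` cball 0 (1/2))" by (rule compact_continuous_image) simp
  then obtain B where B': "\<forall>y\<in>grad (cone_datum e) ` cball 0 (1/2). norm y \<le> B"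
    using compact_imp_bounded bounded_iff by metis
  have B: "norm (grad (cone_datum e) x) \<le> B" if "norm x \<le> 1/2" for x
    using B' that by simp
  have B0: "B \<ge> 0" using order_trans[OF norm_ge_zero B[of 0]] by simp
  have far: "norm (grad (cone_datum e) x) \<le> 8 / norm x" if "norm x \<ge> 1/2" for x
    using norm_cone_limit_grad[OF e, of x] cone_datum_far(2)[OF that, of e] by simp
  show ?thesis
  proof (rule that[of "B + 16"])
    show "B + 16 > 0" using B0 by simp
    show "norm (grad (cone_datum e) x) \<le> B + 16" for x
    proof (cases "norm x \<le> 1/2")
      case False
      then have "8 / norm x \<le> 16" by (subst pos_divide_le_eq) linarith+
      then show ?thesis using far[of x] False B0 by simp
    next
      case True
      then show ?thesis using B[OF True] by simp
    qed
    show "norm (grad (cone_datum e) x) \<le> (B + 16) / norm x" if "x \<noteq> 0" for x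
    proof (cases "norm x \<le> 1/2")
      case True
      then have "norm (grad (cone_datum e) x) * norm x \<le> B * 1" using B0 by (intro mult_mono B) auto
      then show ?thesis using that by (simp add: field_simps)
    next
      case False
      then have "norm (grad (cone_datum e) x) \<le> 8 / norm x" by (intro far) simp
      also have "\<dots> \<le> (B + 16) / norm x" using B0 by (intro divide_right_mono) auto
      finally show ?thesis .
    qed
    show "norm (cone_limit_grad e x) \<le> (B + 16) / norm x" if "x \<noteq> 0" for x
    proof -
      have "8 / norm x \<le> (B + 16) / norm x" using B0 by (intro divide_right_mono) auto
      then show ?thesis using norm_cone_limit_grad[OF e, of x] by linarith
    qed
  qed
qed

section \<open>Integrability of negative powers of the norm\<close>

lemma nn_integral_powr_from_0:
  fixes r c :: real
  assumes r: "r > -1" and c: "c > 0"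
  shows "(\<integral>\<^sup>+s. ennreal (s powr r) * indicator {0<..c} s \<partial>lborel) = ennreal (c powr (r + 1) / (r + 1))"
proof -
  have "(\<integral>\<^sup>+s. ennreal (s powr r) * indicator {0<..c} s \<partial>lborel) = (\<integral>\<^sup>+s. ennreal (s powr r) * indicator {0..c} s \<partial>lborel)"
  proof (rule nn_integral_cong_AE)
    show "AE s in lborel. ennreal (s powr r) * indicator {0<..c} s = ennreal (s powr r) * indicator {0..c} s"
      using AE_lborel_singleton[of 0] by eventually_elim (auto simp: indicator_def)
  qed
  also have "\<dots> = ennreal (c powr (r + 1) / (r + 1))"
    by (rule nn_integral_has_integral_lebesgue') (use has_integral_powr_from_0[OF r, of c] c in auto)
  finally show ?thesis .
qed

text \<open>A substitute for polar coordinates: up to the factor 2^(p+1), |x|^(-p) is at most the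
  integral of s^(-p-1) over [|x|, 2|x|], which lies in (0, 2]. After exchanging the integrals, the
  ball of radius s contributes s^n, and s^(n-p-1) is integrable at 0 because p < n.\<close>

lemma nn_integral_norm_powr_ball:
  fixes p :: real
  assumes p: "0 \<le> p" "p < real CARD('n::finite)"
  shows "(\<integral>\<^sup>+x. ennreal (norm x powr (- p)) * indicator (cball 0 1) x \<partial>(lborel :: (real^'n) measure)) < \<infinity>"
proof -
  let ?n = "real CARD('n)"
  let ?L = "lborel :: (real^'n) measure"
  let ?f = "\<lambda>(x :: real^'n) (s :: real). ennreal (s powr (- p - 1)) * indicator {0<..2} s * indicator {y. norm y \<le> s} x"
  have pw: "ennreal (norm x powr (- p)) * indicator (cball 0 1) x \<le> ennreal (2 powr (p + 1)) * (\<integral>\<^sup>+s. ?f x s \<partial>lborel)"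
    if x0: "x \<noteq> 0" for x :: "real^'n"
  proof (cases "norm x \<le> 1")
    case True
    let ?r = "norm x"
    have r: "?r > 0" using x0 by simp
    have "ennreal ((2 * ?r) powr (- p - 1)) * ennreal ?r = (\<integral>\<^sup>+s. ennreal ((2 * ?r) powr (- p - 1)) * indicator {?r..2 * ?r} s \<partial>lborel)"
      by (simp add: nn_integral_cmult_indicator)
    also have "\<dots> \<le> (\<integral>\<^sup>+s. ?f x s \<partial>lborel)"
    proof (rule nn_integral_mono)
      fix s
      show "ennreal ((2 * ?r) powr (- p - 1)) * indicator {?r..2 * ?r} s \<le> ?f x s"
      proof (cases "s \<in> {?r..2 * ?r}")
        case s: True
        then have s2: "norm x \<le> s" "s \<le> 2" using True by auto
        then have s0: "0 < s" using r by linarith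
        have "(2 * ?r) powr (- p - 1) \<le> s powr (- p - 1)" using s s0 p by (intro powr_mono2') auto
        moreover note s0 s2
        ultimately show ?thesis using s by (simp add: ennreal_leI)
      qed simp
    qed
    finally have *: "ennreal ((2 * ?r) powr (- p - 1)) * ennreal ?r \<le> (\<integral>\<^sup>+s. ?f x s \<partial>lborel)" .
    have "?r powr (- p) = 2 powr (p + 1) * ((2 * ?r) powr (- p - 1) * ?r)"
    proof -
      have "?r powr (- p) = ?r powr (- p - 1) * ?r" using r by (simp add: powr_diff)
      moreover have "2 powr (p + 1) * 2 powr (- p - 1) = (1 :: real)" by (simp flip: powr_add)
      ultimately show ?thesis by (simp add: powr_mult algebra_simps)
    qed
    then have "ennreal (?r powr (- p)) = ennreal (2 powr (p + 1)) * (ennreal ((2 * ?r) powr (- p - 1)) * ennreal ?r)"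
      by (simp add: ennreal_mult)
    also have "\<dots> \<le> ennreal (2 powr (p + 1)) * (\<integral>\<^sup>+s. ?f x s \<partial>lborel)" by (intro mult_left_mono *) simp
    finally show ?thesis using True by simp
  qed simp
  have m: "case_prod ?f \<in> borel_measurable (?L \<Otimes>\<^sub>M lborel)" by measurable
  have "(\<integral>\<^sup>+x. ennreal (norm x powr (- p)) * indicator (cball 0 1) x \<partial>?L) \<le>
     (\<integral>\<^sup>+x. ennreal (2 powr (p + 1)) * (\<integral>\<^sup>+s. ?f x s \<partial>lborel) \<partial>?L)"
    by (rule nn_integral_mono_AE) (use AE_lborel_singleton[of "0 :: real^'n"] pw in \<open>auto elim!: eventually_mono\<close>)
  also have "\<dots> = ennreal (2 powr (p + 1)) * (\<integral>\<^sup>+x. (\<integral>\<^sup>+s. ?f x s \<partial>lborel) \<partial>?L)"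
    by (rule nn_integral_cmult) measurable
  also have "(\<integral>\<^sup>+x. (\<integral>\<^sup>+s. ?f x s \<partial>lborel) \<partial>?L) = (\<integral>\<^sup>+s. (\<integral>\<^sup>+x. ?f x s \<partial>?L) \<partial>lborel)"
    by (rule lborel_pair.Fubini'[OF m, symmetric])
  also have "\<dots> = (\<integral>\<^sup>+s. emeasure ?L (cball 0 1) * (ennreal (s powr (?n - p - 1)) * indicator {0<..2} s) \<partial>lborel)"
  proof (rule nn_integral_cong)
    fix s :: real
    show "(\<integral>\<^sup>+x. ?f x s \<partial>?L) = emeasure ?L (cball 0 1) * (ennreal (s powr (?n - p - 1)) * indicator {0<..2} s)"
    proof (cases "s \<in> {0<..2}")
      case True
      then have s: "s > 0" by simp
      have [measurable]: "{y :: real^'n. norm y \<le> s} \<in> sets borel" by simp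
      have "(\<integral>\<^sup>+x. ?f x s \<partial>?L) = ennreal (s powr (- p - 1)) * (\<integral>\<^sup>+x. indicator {y. norm y \<le> s} x \<partial>?L)"
        using True by (simp add: nn_integral_cmult_indicator)
      also have "(\<integral>\<^sup>+x. indicator {y. norm y \<le> s} x \<partial>?L) =
          ennreal (\<bar>s\<bar> ^ DIM(real^'n)) * (\<integral>\<^sup>+x. indicator {y. norm y \<le> s} (0 + s *\<^sub>R x) \<partial>?L)"
        using s by (intro nn_integral_lborel_affine) auto
      also have "(\<integral>\<^sup>+x. indicator {y. norm y \<le> s} (0 + s *\<^sub>R x) \<partial>?L) = (\<integral>\<^sup>+x. indicator (cball 0 1) x \<partial>?L)"
        using s by (intro nn_integral_cong) (auto simp: indicator_def)
      also have "\<dots> = emeasure ?L (cball 0 1)" by simp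
      also have "\<bar>s\<bar> ^ DIM(real^'n) = s powr ?n" using s by (simp add: powr_realpow)
      also have "ennreal (s powr (- p - 1)) * (ennreal (s powr ?n) * emeasure ?L (cball 0 1)) =
          emeasure ?L (cball 0 1) * ennreal (s powr (- p - 1) * s powr ?n)"
        by (simp add: ennreal_mult mult_ac)
      also have "s powr (- p - 1) * s powr ?n = s powr (?n - p - 1)" by (simp flip: powr_add add: algebra_simps)
      finally show ?thesis using True by simp
    qed simp
  qed
  also have "\<dots> = emeasure ?L (cball 0 1) * (\<integral>\<^sup>+s. ennreal (s powr (?n - p - 1)) * indicator {0<..2} s \<partial>lborel)"
    by (rule nn_integral_cmult) measurable
  also have "\<dots> = emeasure ?L (cball 0 1) * ennreal (2 powr (?n - p - 1 + 1) / (?n - p - 1 + 1))"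
    using p by (subst nn_integral_powr_from_0) auto
  also have "ennreal (2 powr (p + 1)) * \<dots> < \<infinity>"
    using emeasure_bounded_finite[OF bounded_cball, of "0 :: real^'n" 1] by (simp add: ennreal_mult_less_top)
  finally show ?thesis .
qed

section \<open>The singular function as a limit of regularised ones\<close>

lemma cone_limit_measurable [measurable]: "cone_limit e \<in> borel_measurable borel"
proof -
  have [measurable]: "profile \<in> borel_measurable borel"
    by (intro borel_measurable_continuous_onI continuous_at_imp_continuous_on ballI DERIV_isCont[OF profile_DERIV])
  show ?thesis unfolding cone_limit_def[abs_def] by measurable
qed

lemma cone_limit_grad_measurable [measurable]: "cone_limit_grad e \<in> borel_measurable borel"
proof -
  have [measurable]: "profile' \<in> borel_measurable borel"
    by (rule borel_measurable_continuous_onI[OF profile'_continuous])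
  show ?thesis unfolding cone_limit_grad_def[abs_def] by measurable
qed

lemma cone_datum_measurable [measurable]:
  "cone_datum e \<in> borel_measurable borel" "grad (cone_datum e) \<in> borel_measurable borel"
  using cone_datum_C1[of e] C1_grad_continuous[OF cone_datum_C1[of e]]
  by (auto simp: C1_grad_def intro: borel_measurable_continuous_onI)

lemma integrable_inverse_norm:
  assumes "CARD('n::finite) \<ge> 2"
  shows "integrable lborel (\<lambda>x :: real^'n. indicator (cball 0 1) x * (C / norm x))"
proof -
  have "integrable lborel (\<lambda>x :: real^'n. norm x powr (- 1) * indicator (cball 0 1) x)"
  proof (rule integrableI_nonneg)
    have [measurable]: "cball 0 1 \<in> sets (borel :: (real^'n) measure)" by simp
    show "(\<lambda>x :: real^'n. norm x powr (- 1) * indicator (cball 0 1) x) \<in> borel_measurable lborel" by measurable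
    show "(\<integral>\<^sup>+x. ennreal (norm x powr (- 1) * indicator (cball 0 1) x) \<partial>(lborel :: (real^'n) measure)) < \<infinity>"
    proof -
      have "(\<integral>\<^sup>+x. ennreal (norm x powr (- 1) * indicator (cball 0 1) x) \<partial>(lborel :: (real^'n) measure)) =
          (\<integral>\<^sup>+x. ennreal (norm x powr (- 1)) * indicator (cball 0 1) x \<partial>(lborel :: (real^'n) measure))"
        by (intro nn_integral_cong) (simp add: indicator_def)
      also have "\<dots> < \<infinity>" by (rule nn_integral_norm_powr_ball) (use assms in auto)
      finally show ?thesis .
    qed
  qed auto
  then have "integrable lborel (\<lambda>x :: real^'n. C * (norm x powr (- 1) * indicator (cball 0 1) x))"
    by (rule integrable_mult_right)
  then show ?thesis
    by (rule Bochner_Integration.integrable_cong[THEN iffD1, OF refl, rotated]) (simp add: powr_minus_divide)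
qed

text \<open>The approximants are U(2^k x) - U(x), with U the regularised datum. They vanish for |x|
  \<ge> 1/2, where both terms equal the limit, and the first term equals the limit outside the
  radius 2^(-k)/2. The errors are dominated by 18 and by 2C/|x| on the unit ball; the latter is
  integrable because n \<ge> 2.\<close>

lemma cone_zero_trace_pair:
  fixes e :: "real^'n::finite"
  assumes n: "CARD('n) \<ge> 2" and e: "norm e = 1"
  shows "zero_trace_pair (ball 0 1) (\<lambda>x. cone_limit e x - cone_datum e x)
    (\<lambda>x. cone_limit_grad e x - grad (cone_datum e) x)"
proof -
  let ?U = "cone_datum e" and ?V = "cone_limit e" and ?Q = "cone_limit_grad e"
  obtain C where C: "C > 0" "\<And>x. x \<noteq> 0 \<Longrightarrow> norm (grad ?U x) \<le> C / norm x" "\<And>x. x \<noteq> 0 \<Longrightarrow> norm (?Q x) \<le> C / norm x"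
    using norm_grad_cone_datum[OF e] by metis
  define Uk where "Uk k x = ?U ((2 ^ k) *\<^sub>R x)" for k :: nat and x
  define Gk where "Gk k x = (2 ^ k) *\<^sub>R grad ?U ((2 ^ k) *\<^sub>R x)" for k :: nat and x
  have far: "Uk k x = ?V x" "Gk k x = ?Q x" if "norm x \<ge> 1 / 2 / 2 ^ k" for k x
  proof -
    have n: "norm ((2 ^ k) *\<^sub>R x) \<ge> 1/2" using that by (simp add: field_simps)
    show "Uk k x = ?V x" "Gk k x = ?Q x"
      unfolding Uk_def Gk_def using cone_datum_far[OF n, of e] cone_limit_scale[of "2 ^ k" e x] by simp_all
  qed
  have far': "Uk k x = ?V x" "Gk k x = ?Q x" if "norm x \<ge> 1 / 2" for k x
  proof -
    have "1 / 2 / 2 ^ k \<le> (1 / 2 :: real)" by (simp add: field_simps)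
    then have "norm x \<ge> 1 / 2 / 2 ^ k" using that by linarith
    then show "Uk k x = ?V x" "Gk k x = ?Q x" by (rule far)+
  qed
  have ev: "eventually (\<lambda>k. Uk k x = ?V x \<and> Gk k x = ?Q x) sequentially" if "x \<noteq> 0" for x
  proof -
    have "(\<lambda>k. 1 / 2 * (1 / 2 :: real) ^ k) \<longlonglongrightarrow> 0"
      by (intro tendsto_mult_right_zero LIMSEQ_power_zero) simp
    from order_tendstoD(2)[OF this, of "norm x"]
    have "eventually (\<lambda>k. 1 / 2 * (1 / 2) ^ k < norm x) sequentially" using that by simp
    then show ?thesis
    proof eventually_elim
      case (elim k)
      then have "1 / 2 / 2 ^ k \<le> norm x" by (simp add: power_one_over)
      then show ?case using far by blast
    qed
  qed
  have UC: "C1_grad (Uk k) (Gk k)" for k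
    unfolding Uk_def[abs_def] Gk_def[abs_def] using C1_grad_affine[OF cone_datum_C1, of e "2 ^ k" 0] by simp
  have [measurable]: "Uk k \<in> borel_measurable borel" "Gk k \<in> borel_measurable borel" for k
    using UC[of k] C1_grad_continuous[OF UC] by (auto simp: C1_grad_def intro: borel_measurable_continuous_onI)
  have U9: "\<bar>?U x\<bar> \<le> 9" "\<bar>?V x\<bar> \<le> 9" "\<bar>Uk k x\<bar> \<le> 9" for x k
    unfolding Uk_def cone_datum_def cone_limit_def by (rule profile_bound)+
  have Gk: "norm (Gk k x) \<le> C / norm x" if "x \<noteq> 0" for k x
  proof -
    have "norm (grad ?U ((2 ^ k) *\<^sub>R x)) \<le> C / norm ((2 ^ k) *\<^sub>R x)" using that by (intro C(2)) simp
    then have "2 ^ k * norm (grad ?U ((2 ^ k) *\<^sub>R x)) \<le> 2 ^ k * (C / norm ((2 ^ k) *\<^sub>R x))"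
      by (rule mult_left_mono) simp
    then show ?thesis by (simp add: Gk_def)
  qed
  have iC: "integrable lborel (\<lambda>x :: real^'n. indicator (cball 0 1) x * (2 * C / norm x))"
    by (rule integrable_inverse_norm[OF n])
  have i18: "integrable lborel (\<lambda>x :: real^'n. (18 :: real) * indicator (cball 0 1) x)"
    using emeasure_bounded_finite[OF bounded_cball, of "0 :: real^'n" 1] by (intro integrable_mult_right integrable_real_indicator) auto
  have bU: "norm (Uk k x - ?V x) \<le> 18 * indicator (cball 0 1) x" for k x
  proof (cases "norm x \<ge> 1/2")
    case False
    then show ?thesis using U9(2)[of x] U9(3)[of k x] by simp
  qed (simp add: far')
  have bG: "norm (Gk k x - ?Q x) \<le> indicator (cball 0 1) x * (2 * C / norm x)" if "x \<noteq> 0" for k x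
  proof (cases "norm x \<ge> 1/2")
    case False
    have "norm (Gk k x - ?Q x) \<le> C / norm x + C / norm x"
      using norm_triangle_ineq4[of "Gk k x" "?Q x"] Gk[OF that, of k] C(3)[OF that] by linarith
    then show ?thesis using False by simp
  qed (simp add: far' C(1) less_imp_le)
  have ae0: "AE x in lborel. x \<noteq> (0 :: real^'n)" by (rule AE_lborel_singleton)
  \<comment> \<open>For k = 0 the error is the pair itself up to sign, so the two bounds just proved
    also give its integrability.\<close>
  have U0: "Uk 0 = ?U" "Gk 0 = grad ?U" by (simp_all add: Uk_def[abs_def] Gk_def[abs_def])
  have iu: "integrable lborel (\<lambda>x. ?V x - ?U x)"
  proof (rule Bochner_Integration.integrable_bound[OF i18])
    show "AE x in lborel. norm (?V x - ?U x) \<le> norm (18 * indicator (cball 0 1) x :: real)"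
      using bU[of 0] by (intro AE_I2) (simp add: U0 abs_minus_commute)
  qed measurable
  have ig: "integrable lborel (\<lambda>x. ?Q x - grad ?U x)"
  proof (rule Bochner_Integration.integrable_bound[OF iC])
    show "AE x in lborel. norm (?Q x - grad ?U x) \<le> norm (indicator (cball 0 1) x * (2 * C / norm x))"
      using ae0
    proof eventually_elim
      case (elim x)
      have "norm (?Q x - grad ?U x) \<le> indicator (cball 0 1) x * (2 * C / norm x)"
        using bG[OF elim, of 0] by (simp add: U0 norm_minus_commute)
      then show ?case by (rule order_trans) (simp only: real_norm_def abs_ge_self)
    qed
  qed measurable
  have "zero_trace_seq (ball 0 1) (\<lambda>k x. Uk k x - ?U x) (\<lambda>k x. Gk k x - grad ?U x) (\<lambda>x. ?V x - ?U x) (\<lambda>x. ?Q x - grad ?U x)"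
    unfolding zero_trace_seq_def
  proof (intro conjI allI)
    show "C1_grad (\<lambda>x. Uk k x - ?U x) (\<lambda>x. Gk k x - grad ?U x)" for k
      by (rule C1_grad_diff[OF UC cone_datum_C1])
    have "Uk k x - ?U x = 0" if "x \<notin> cball 0 (1/2)" for k x
      using far'(1)[of x k] cone_datum_far(1)[of x e] that by simp
    then show "\<exists>S. compact S \<and> S \<subseteq> ball 0 1 \<and> (\<forall>x. x \<notin> S \<longrightarrow> Uk k x - ?U x = 0)" for k
      by (intro exI[of _ "cball 0 (1/2)"]) auto
    have "(\<lambda>k. \<integral>x. norm (Uk k x - ?V x) \<partial>lborel) \<longlonglongrightarrow> (\<integral>x. 0 \<partial>(lborel :: (real^'n) measure))"
    proof (rule integral_dominated_convergence[OF _ _ i18])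
      show "AE x in lborel. (\<lambda>k. norm (Uk k x - ?V x)) \<longlonglongrightarrow> 0"
        using ae0
      proof eventually_elim
        case (elim x)
        show ?case by (rule tendsto_eventually, rule eventually_mono[OF ev[OF elim]]) simp
      qed
      show "AE x in lborel. norm (norm (Uk k x - ?V x)) \<le> 18 * indicator (cball 0 1) x" for k
        using bU by (intro AE_I2) simp
    qed measurable
    then show "(\<lambda>k. \<integral>x. norm (Uk k x - ?U x - (?V x - ?U x)) \<partial>lborel) \<longlonglongrightarrow> 0" by simp
    have "(\<lambda>k. \<integral>x. norm (Gk k x - ?Q x) \<partial>lborel) \<longlonglongrightarrow> (\<integral>x. 0 \<partial>(lborel :: (real^'n) measure))"
    proof (rule integral_dominated_convergence[OF _ _ iC])
      show "AE x in lborel. (\<lambda>k. norm (Gk k x - ?Q x)) \<longlonglongrightarrow> 0"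
        using ae0
      proof eventually_elim
        case (elim x)
        show ?case by (rule tendsto_eventually, rule eventually_mono[OF ev[OF elim]]) simp
      qed
      show "AE x in lborel. norm (norm (Gk k x - ?Q x)) \<le> indicator (cball 0 1) x * (2 * C / norm x)" for k
        using ae0 by eventually_elim (use bG in simp)
    qed measurable
    then show "(\<lambda>k. \<integral>x. norm (Gk k x - grad ?U x - (?Q x - grad ?U x)) \<partial>lborel) \<longlonglongrightarrow> 0" by simp
  qed
  then show ?thesis unfolding zero_trace_pair_def using iu ig by blast
qed

subsection \<open>The weight\<close>

text \<open>The threshold 1/2 is that of \<open>profile\<close>: the weight is supported in the
  double cone on which the singular function is constant. The base of the power is Lipschitz, which
  suits the class of exponent \<kappa>.\<close>

definition cone_weight :: "real \<Rightarrow> real \<Rightarrow> real^'n::finite \<Rightarrow> real^'n \<Rightarrow> real" where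
  "cone_weight \<Lambda> \<kappa> e x = \<Lambda> * (max 0 (\<bar>x \<bullet> e\<bar> - norm x / 2)) powr \<kappa>"

lemma cone_weight_nonneg: "\<Lambda> \<ge> 0 \<Longrightarrow> cone_weight \<Lambda> \<kappa> e x \<ge> 0"
  by (simp add: cone_weight_def)

lemma cone_weight_measurable [measurable]: "cone_weight \<Lambda> \<kappa> e \<in> borel_measurable borel"
  unfolding cone_weight_def[abs_def] by measurable

lemma cone_weight_mult_grad: "cone_weight \<Lambda> \<kappa> e x = 0 \<or> cone_limit_grad e x = 0"
  using cone_limit_grad_zero[of x e] by (auto simp: cone_weight_def max_def)

text \<open>The base of the power is Lipschitz with constant 3/2, hence 2. The constant 4^\<kappa>
  (1 + \<Lambda>) covers both coefficients that arise, 2^\<kappa> for the weight at y and 4^\<kappa>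
  \<Lambda> for the distance.\<close>

lemma cone_weight_class:
  fixes e :: "real^'n::finite"
  assumes \<Lambda>: "\<Lambda> > 0" and \<kappa>: "\<kappa> > 0" and e: "norm e = 1"
  shows "cone_weight \<Lambda> \<kappa> e \<in> weight_class \<kappa> \<Omega>"
  unfolding weight_class_def mem_Collect_eq
proof (intro conjI ballI exI[of _ "4 powr \<kappa> * (1 + \<Lambda>)"])
  show "cone_weight \<Lambda> \<kappa> e \<in> borel_measurable (lebesgue_on \<Omega>)"
    by (rule borel_measurable_lebesgue_on) measurable
  show "0 \<le> cone_weight \<Lambda> \<kappa> e x" for x using \<Lambda> by (simp add: cone_weight_nonneg)
  show "0 < 4 powr \<kappa> * (1 + \<Lambda>)" using \<Lambda> by simp
  fix x y :: "real^'n"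
  let ?f = "\<lambda>x. max 0 (\<bar>x \<bullet> e\<bar> - norm x / 2)"
  have "\<bar>\<bar>x \<bullet> e\<bar> - \<bar>y \<bullet> e\<bar>\<bar> \<le> \<bar>(x - y) \<bullet> e\<bar>" by (simp add: inner_diff_left)
  also have "\<dots> \<le> norm (x - y)" using Cauchy_Schwarz_ineq2[of "x - y" e] e by simp
  finally have "?f x \<le> ?f y + 2 * norm (x - y)"
    using norm_triangle_ineq3[of x y] norm_ge_zero[of "x - y"] by (simp add: max_def abs_if split: if_splits)
  then have "?f x powr \<kappa> \<le> (?f y + 2 * norm (x - y)) powr \<kappa>" using \<kappa> by (intro powr_mono2) auto
  also have "\<dots> \<le> 2 powr \<kappa> * (?f y powr \<kappa> + (2 * norm (x - y)) powr \<kappa>)" using \<kappa> by (intro powr_add_le) auto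
  also have "\<dots> = 2 powr \<kappa> * ?f y powr \<kappa> + 4 powr \<kappa> * norm (x - y) powr \<kappa>"
  proof -
    have "4 powr \<kappa> = 2 powr \<kappa> * 2 powr \<kappa>" by (simp flip: powr_mult)
    then show ?thesis by (simp add: powr_mult algebra_simps)
  qed
  finally have "\<Lambda> * ?f x powr \<kappa> \<le> \<Lambda> * (2 powr \<kappa> * ?f y powr \<kappa> + 4 powr \<kappa> * norm (x - y) powr \<kappa>)"
    using \<Lambda> by (intro mult_left_mono) auto
  also have "\<dots> = 2 powr \<kappa> * (\<Lambda> * ?f y powr \<kappa>) + 4 powr \<kappa> * \<Lambda> * norm (x - y) powr \<kappa>" by (simp add: algebra_simps)
  also have "\<dots> \<le> (4 powr \<kappa> * (1 + \<Lambda>)) * (\<Lambda> * ?f y powr \<kappa>) + (4 powr \<kappa> * (1 + \<Lambda>)) * norm (x - y) powr \<kappa>"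
  proof (intro add_mono mult_right_mono)
    have "2 powr \<kappa> * 1 \<le> 4 powr \<kappa> * (1 + \<Lambda>)" using \<kappa> \<Lambda> by (intro mult_mono powr_mono2) auto
    then show "2 powr \<kappa> \<le> 4 powr \<kappa> * (1 + \<Lambda>)" by simp
    show "4 powr \<kappa> * \<Lambda> \<le> 4 powr \<kappa> * (1 + \<Lambda>)" by simp
  qed (use \<Lambda> in auto)
  finally show "cone_weight \<Lambda> \<kappa> e x \<le> 4 powr \<kappa> * (1 + \<Lambda>) * (cone_weight \<Lambda> \<kappa> e y + norm (x - y) powr \<kappa>)"
    by (simp add: cone_weight_def algebra_simps)
qed

subsection \<open>The lower bound for regular competitors\<close>

text \<open>Above \<sigma>, in t = t^(1-q) t^q the first factor is at most \<sigma>^(1-q). The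
  threshold is free and will be varied along each ray.\<close>

lemma young_threshold:
  fixes t \<sigma> q :: real
  assumes "t \<ge> 0" "\<sigma> > 0" "q \<ge> 1"
  shows "t \<le> \<sigma> + \<sigma> powr (1 - q) * t powr q"
proof (cases "t \<le> \<sigma>")
  case True
  moreover have "0 \<le> \<sigma> powr (1 - q) * t powr q" by simp
  ultimately show ?thesis by linarith
next
  case False
  then have t: "t > \<sigma>" "t > 0" using assms by auto
  have "t powr (1 - q) \<le> \<sigma> powr (1 - q)" using assms t by (intro powr_mono2') auto
  then have "t powr (1 - q) * t powr q \<le> \<sigma> powr (1 - q) * t powr q" by (intro mult_right_mono) auto
  moreover have "t powr (1 - q) * t powr q = t" using t by (simp flip: powr_add)
  ultimately show ?thesis using assms by linarith
qed

text \<open>The fundamental theorem along a segment. The parameter 0 is left out because negative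
  powers of s and a dilation by s will follow.\<close>

lemma ray_increment_le:
  fixes w :: "real^'n::finite \<Rightarrow> real"
  assumes w: "C1_grad w G"
  shows "ennreal \<bar>w y - w 0\<bar> \<le> (\<integral>\<^sup>+s. ennreal (norm y * norm (G (s *\<^sub>R y))) * indicator {0<..1} s \<partial>lborel)"
proof -
  let ?g = "\<lambda>s. norm y * norm (G (s *\<^sub>R y))"
  have Gc: "continuous_on {0..1} (\<lambda>s :: real. G (s *\<^sub>R y))"
    using w unfolding C1_grad_def by (auto intro!: continuous_on_compose2[of UNIV G] continuous_intros)
  have d: "((\<lambda>s. w (s *\<^sub>R y)) has_vector_derivative (y \<bullet> G (s *\<^sub>R y))) (at s within {0..1})" for s
  proof -
    have 1: "((\<lambda>s. s *\<^sub>R y) has_derivative (\<lambda>h. h *\<^sub>R y)) (at s within {0..1})" by (auto intro!: derivative_eq_intros)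
    have 2: "(w has_derivative (\<lambda>h. h \<bullet> G (s *\<^sub>R y))) (at (s *\<^sub>R y))" using w by (simp add: C1_grad_def)
    show ?thesis
      unfolding has_vector_derivative_def using has_derivative_compose[OF 1 2] by (rule has_derivative_eq_rhs) auto
  qed
  have I: "((\<lambda>s. y \<bullet> G (s *\<^sub>R y)) has_integral (w (1 *\<^sub>R y) - w (0 *\<^sub>R y))) {0..1}"
    by (rule fundamental_theorem_of_calculus) (use d in auto)
  have gi: "?g integrable_on {0..1}"
    by (rule integrable_continuous_real) (intro continuous_intros Gc)
  have "norm (integral {0..1} (\<lambda>s. y \<bullet> G (s *\<^sub>R y))) \<le> integral {0..1} ?g"
    by (rule integral_norm_bound_integral[OF has_integral_integrable[OF I] gi]) (simp add: Cauchy_Schwarz_ineq2)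
  then have "\<bar>w y - w 0\<bar> \<le> integral {0..1} ?g" using integral_unique[OF I] by simp
  then have "ennreal \<bar>w y - w 0\<bar> \<le> ennreal (integral {0..1} ?g)" by (rule ennreal_leI)
  also have "\<dots> = (\<integral>\<^sup>+s. ennreal (?g s) * indicator {0..1} s \<partial>lborel)"
    by (rule nn_integral_has_integral_lebesgue'[symmetric, OF _ integrable_integral[OF gi]]) simp
  also have "\<dots> = (\<integral>\<^sup>+s. ennreal (?g s) * indicator {0<..1} s \<partial>lborel)"
  proof (rule nn_integral_cong_AE)
    show "AE s in lborel. ennreal (?g s) * indicator {0..1} s = ennreal (?g s) * indicator {0<..1} s"
      using AE_lborel_singleton[of 0] by eventually_elim (auto simp: indicator_def)
  qed
  finally show ?thesis .
qed

lemma nn_integral_lborel_dilate: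
  fixes F :: "'a::euclidean_space \<Rightarrow> ennreal"
  assumes F: "F \<in> borel_measurable borel" and s: "c \<noteq> 0"
  shows "(\<integral>\<^sup>+y. F (c *\<^sub>R y) \<partial>lborel) = ennreal (\<bar>c\<bar> powr - real DIM('a)) * (\<integral>\<^sup>+x. F x \<partial>lborel)"
proof -
  have "ennreal (\<bar>c\<bar> powr - real DIM('a)) * (\<integral>\<^sup>+x. F x \<partial>lborel) =
      ennreal (\<bar>c\<bar> powr - real DIM('a)) * (ennreal (\<bar>c\<bar> ^ DIM('a)) * (\<integral>\<^sup>+y. F (c *\<^sub>R y) \<partial>lborel))"
    using nn_integral_lborel_affine[OF F s, of 0] by simp
  also have "\<dots> = ennreal (\<bar>c\<bar> powr - real DIM('a) * \<bar>c\<bar> ^ DIM('a)) * (\<integral>\<^sup>+y. F (c *\<^sub>R y) \<partial>lborel)"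
    by (simp add: ennreal_mult mult.assoc)
  also have "\<bar>c\<bar> powr - real DIM('a) * \<bar>c\<bar> ^ DIM('a) = 1"
    using s by (simp add: powr_minus powr_realpow)
  finally show ?thesis by simp
qed

text \<open>The increment along a ray \<open>s \<mapsto> s y\<close> is split by \<open>young_threshold\<close> at \<open>\<sigma> = \<mu> s\<^bsup>-\<beta>/(q-1)\<^esup>\<close>. The exponent
  \<open>\<beta>\<close> must satisfy \<open>\<beta> < q - 1\<close>, so that \<open>\<sigma>\<close> is integrable, and \<open>\<beta> - \<kappa> - n > -1\<close>, so that the energy term
  survives the dilation by \<open>s\<close>; this is where \<open>q > n + \<kappa>\<close> enters.\<close>

lemma regular_competitor_bound:
  fixes e :: "real^'n::finite"
  assumes q: "q > real CARD('n) + \<kappa>" and \<kappa>: "\<kappa> > 0" and e: "norm e = 1"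
  obtains c where "c > 0" "\<And>\<Lambda> \<psi>. \<Lambda> > 0 \<Longrightarrow> \<psi> \<in> test_functions (ball 0 1) \<Longrightarrow>
      ennreal (\<Lambda> * c) \<le> double_phase p q (cone_weight \<Lambda> \<kappa> e) (ball 0 1) (\<lambda>x. cone_datum e x + \<psi> x)"
proof -
  let ?n = "real CARD('n)"
  have n1: "?n \<ge> 1" using finite_UNIV_card_ge_0[where 'a='n] by simp
  have q1: "q > 1" using q \<kappa> n1 by linarith
  \<comment> \<open>The midpoint of the interval (n + \<kappa> - 1, q - 1), which is nonempty
    because q > n + \<kappa>.\<close>
  define \<beta> where "\<beta> = (?n + \<kappa> - 1 + (q - 1)) / 2"
  have \<beta>: "?n + \<kappa> - 1 < \<beta>" "\<beta> < q - 1" using q by (auto simp: \<beta>_def)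
  have \<beta>0: "0 < \<beta>" using \<beta>(1) n1 \<kappa> by linarith
  define \<beta>' where "\<beta>' = \<beta> / (q - 1)"
  have \<beta>': "0 < \<beta>'" "\<beta>' < 1" "\<beta>' * (q - 1) = \<beta>" using \<beta> \<beta>0 q1 by (auto simp: \<beta>'_def)
  \<comment> \<open>Chosen so that 3 \<mu> times the integral of s^(-\<beta>') over (0, 1] is 1/2:
    the part of the increment not controlled by the energy accounts for at most half of the required
    1.\<close>
  define \<mu> where "\<mu> = (1 - \<beta>') / 6"
  have \<mu>: "\<mu> > 0" using \<beta>' by (simp add: \<mu>_def)
  \<comment> \<open>The rays end in a solid ball instead of the unit sphere, so that Lebesgue
    measure and dilations average over the directions. This ball lies outside the unit ball, where
    the competitor equals the datum, and inside the cone that carries the weight.\<close>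
  let ?E = "ball (2 *\<^sub>R e) (1/2)"
  define m where "m = measure lborel ?E"
  have Em: "emeasure lborel ?E = ennreal m" "m > 0"
  proof -
    show "emeasure lborel ?E = ennreal m"
      unfolding m_def using emeasure_bounded_finite[OF bounded_ball, of "2 *\<^sub>R e" "1/2"]
      by (intro emeasure_eq_ennreal_measure) auto
    show "m > 0" unfolding m_def by (rule content_ball_pos) simp
  qed
  define D where "D = 3 * \<mu> powr (1 - q) * 4 powr \<kappa> / (\<beta> - \<kappa> - ?n + 1)"
  have D: "D > 0" unfolding D_def using \<mu> \<beta>(1) by (intro divide_pos_pos mult_pos_pos) auto
  have ee: "e \<bullet> e = 1" using e by (simp add: dot_square_norm)
  have Ey: "y \<bullet> e \<ge> 3/2" "norm y \<le> 5/2" "norm y \<ge> 3/2" if "y \<in> ?E" for y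
  proof -
    have d: "norm (y - 2 *\<^sub>R e) < 1/2" using that by (simp add: dist_norm norm_minus_commute)
    have "\<bar>(y - 2 *\<^sub>R e) \<bullet> e\<bar> \<le> norm (y - 2 *\<^sub>R e) * norm e" by (rule Cauchy_Schwarz_ineq2)
    then have "\<bar>y \<bullet> e - 2\<bar> \<le> 1/2" using d e ee by (simp add: inner_diff_left)
    then show "y \<bullet> e \<ge> 3/2" by linarith
    have n2: "norm (2 *\<^sub>R e) = 2" using e by simp
    show "norm y \<le> 5/2" "norm y \<ge> 3/2"
      using norm_triangle_ineq2[of y "2 *\<^sub>R e"] norm_triangle_ineq2[of "2 *\<^sub>R e" y] d n2
      by (simp_all only: norm_minus_commute[of "2 *\<^sub>R e" y])
  qed
  have main: "ennreal (\<Lambda> * (m / (2 * D))) \<le> double_phase p q (cone_weight \<Lambda> \<kappa> e) (ball 0 1) (\<lambda>x. cone_datum e x + \<psi> x)"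
    if \<Lambda>: "\<Lambda> > 0" and \<psi>: "\<psi> \<in> test_functions (ball 0 1)" for \<Lambda> \<psi>
  proof -
    let ?a = "cone_weight \<Lambda> \<kappa> e"
    define w where "w x = cone_datum e x + \<psi> x" for x
    define G where "G x = grad (cone_datum e) x + grad \<psi> x" for x
    obtain S where S: "C1_grad \<psi> (grad \<psi>)" "compact S" "S \<subseteq> ball 0 1" "\<And>x. x \<notin> S \<Longrightarrow> \<psi> x = 0" "\<And>x. x \<notin> S \<Longrightarrow> grad \<psi> x = 0"
      using test_function_C1[OF \<psi>] by metis
    have wC: "C1_grad w G" unfolding w_def[abs_def] G_def[abs_def] by (rule C1_grad_add[OF cone_datum_C1 S(1)])
    have [measurable]: "G \<in> borel_measurable borel" using wC by (auto simp: C1_grad_def intro: borel_measurable_continuous_onI)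
    define F where "F x = ennreal (?a x * norm (G x) powr q) * indicator (ball 0 1) x" for x
    have [measurable]: "ball 0 1 \<in> sets (borel :: (real^'n) measure)" "?E \<in> sets borel" by simp_all
    have Fm [measurable]: "F \<in> borel_measurable borel" unfolding F_def[abs_def] by measurable
    let ?FF = "\<integral>\<^sup>+x. F x \<partial>lborel"
    have FF: "?FF \<le> double_phase p q ?a (ball 0 1) w"
    proof -
      have "?FF \<le> (\<integral>\<^sup>+x. ennreal (phase_density p q (?a x) (G x)) * indicator (ball 0 1) x \<partial>lborel)"
        unfolding F_def by (intro nn_integral_mono mult_right_mono ennreal_leI) (auto simp: phase_density_def)
      also have "\<dots> = (\<integral>\<^sup>+x. ennreal (phase_density p q (?a x) (G x)) * indicator (ball 0 1) x \<partial>lebesgue)"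
        by (rule nn_integral_completion[symmetric]) measurable
      also have "\<dots> = (\<integral>\<^sup>+x. ennreal (phase_density p q (?a x) (G x)) \<partial>lebesgue_on (ball 0 1))"
        by (rule nn_integral_restrict_space[symmetric]) simp
      also have "\<dots> = double_phase p q ?a (ball 0 1) w"
        by (rule double_phase_eq[OF open_ball C1_grad_has_weak_gradient[OF open_ball wC], symmetric])
      finally show ?thesis .
    qed
    \<comment> \<open>The sign selects one of the two cones: the competitor takes the value \<sigma>
      on \<sigma> E, and its value at the origin is 0 or has the opposite sign.\<close>
    define \<sigma> :: real where "\<sigma> = (if w 0 \<le> 0 then 1 else -1)"
    have \<sigma>: "\<bar>\<sigma>\<bar> = 1" "\<sigma> \<noteq> 0" by (auto simp: \<sigma>_def)
    have out: "\<psi> x = 0" "grad \<psi> x = 0" if "norm x \<ge> 1" for x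
    proof -
      have "x \<notin> S" using S(3) that by auto
      then show "\<psi> x = 0" "grad \<psi> x = 0" by (auto intro: S(4,5))
    qed
    have inc: "1 \<le> \<bar>w (\<sigma> *\<^sub>R y) - w 0\<bar>" if y: "y \<in> ?E" for y
    proof -
      have ny: "norm (\<sigma> *\<^sub>R y) = norm y" using \<sigma> by simp
      have "\<psi> (\<sigma> *\<^sub>R y) = 0" by (rule out(1)) (use ny Ey(3)[OF y] in linarith)
      moreover have "cone_datum e (\<sigma> *\<^sub>R y) = cone_limit e (\<sigma> *\<^sub>R y)"
        by (rule cone_datum_far(1)) (use ny Ey(3)[OF y] in linarith)
      moreover have "cone_limit e (\<sigma> *\<^sub>R y) = profile (\<sigma> * ((y \<bullet> e) / norm y))"
        unfolding cone_limit_def ny by simp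
      ultimately have "w (\<sigma> *\<^sub>R y) = profile (\<sigma> * ((y \<bullet> e) / norm y))" by (simp add: w_def)
      moreover have "1/2 \<le> (y \<bullet> e) / norm y" using Ey[OF y] by (subst pos_le_divide_eq) linarith+
      ultimately have "w (\<sigma> *\<^sub>R y) = \<sigma>" by (auto simp: \<sigma>_def profile_1 profile_minus_1)
      then show ?thesis by (auto simp: \<sigma>_def)
    qed
    \<comment> \<open>The coefficients of the two parts of the split increment, k1 free of energy
      and k2 in front of the density F. The factor 3 bounds |y| \<le> 5/2, and 4^\<kappa>/\<Lambda>
      is the price of inserting the weight.\<close>
    define k1 where "k1 s = ennreal (3 * \<mu> * s powr (- \<beta>')) * indicator {0<..1} s" for s :: real
    define k2 where "k2 s = ennreal (3 * \<mu> powr (1 - q) * 4 powr \<kappa> / \<Lambda> * s powr (\<beta> - \<kappa>)) * indicator {0<..1} s" for s :: real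
    have [measurable]: "k1 \<in> borel_measurable borel" "k2 \<in> borel_measurable borel"
      unfolding k1_def[abs_def] k2_def[abs_def] by measurable
    have pw: "ennreal (norm (\<sigma> *\<^sub>R y) * norm (G (s *\<^sub>R \<sigma> *\<^sub>R y))) * indicator {0<..1} s \<le> k1 s + k2 s * F ((s * \<sigma>) *\<^sub>R y)"
      if y: "y \<in> ?E" for y s
    proof (cases "s \<in> {0<..1}")
      case s: True
      then have s0: "s > 0" by simp
      let ?x = "(s * \<sigma>) *\<^sub>R y"
      let ?t = "norm (G ?x)"
      have nx: "norm ?x = s * norm y" "\<bar>?x \<bullet> e\<bar> = s * (y \<bullet> e)"
        using \<sigma> s0 Ey(1)[OF y] by (simp_all add: abs_mult)
      have t3: "norm (\<sigma> *\<^sub>R y) * ?t \<le> 3 * ?t" using Ey(2)[OF y] \<sigma> by (intro mult_right_mono) auto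
      show ?thesis
      proof (cases "?x \<in> ball 0 1")
        \<comment> \<open>Beyond the unit ball the test function vanishes and the datum is constant
          on the cone, so the integrand is 0.\<close>
        case False
        then have "norm ?x \<ge> 1" by simp
        moreover from this have "grad (cone_datum e) ?x = 0"
        proof -
          have "grad (cone_datum e) ?x = cone_limit_grad e ?x" using \<open>norm ?x \<ge> 1\<close> by (intro cone_datum_far) simp
          moreover have "\<bar>?x \<bullet> e\<bar> \<ge> norm ?x / 2"
          proof -
            have "s * (norm y / 2) \<le> s * (y \<bullet> e)" using Ey[OF y] s0 by (intro mult_left_mono) linarith+
            then show ?thesis unfolding nx by simp
          qed
          from cone_limit_grad_zero[OF this] have "cone_limit_grad e ?x = 0" .
          ultimately show ?thesis by simp
        qed
        ultimately have "?t = 0" using out(2)[of ?x] by (simp add: G_def)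
        then show ?thesis by simp
      next
        case True
        \<comment> \<open>Since y \<bullet> e \<ge> 3/2 and |y|/2 \<le> 5/4, the difference is at
          least 1/4, and the weight along the ray is at least \<Lambda> (s/4)^\<kappa>.\<close>
        have "s * (1/4) \<le> s * (y \<bullet> e - norm y / 2)" using Ey[OF y] s0 by (intro mult_left_mono) linarith+
        then have "s / 4 \<le> max 0 (\<bar>?x \<bullet> e\<bar> - norm ?x / 2)" unfolding nx by (simp add: algebra_simps le_max_iff_disj)
        then have "(s / 4) powr \<kappa> \<le> (max 0 (\<bar>?x \<bullet> e\<bar> - norm ?x / 2)) powr \<kappa>"
          by (rule powr_mono2[rotated 2]) (use s0 \<kappa> in simp_all)
        then have a: "\<Lambda> * (s powr \<kappa> / 4 powr \<kappa>) \<le> ?a ?x"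
          unfolding cone_weight_def using \<Lambda> by (intro mult_left_mono) (auto simp: powr_divide)
        have tq: "?t powr q \<le> 4 powr \<kappa> / \<Lambda> * s powr (- \<kappa>) * (?a ?x * ?t powr q)"
        proof -
          have "?t powr q = 4 powr \<kappa> / \<Lambda> * s powr (- \<kappa>) * (\<Lambda> * (s powr \<kappa> / 4 powr \<kappa>) * ?t powr q)"
            using \<Lambda> s0 by (simp add: powr_minus field_simps)
          also have "\<dots> \<le> 4 powr \<kappa> / \<Lambda> * s powr (- \<kappa>) * (?a ?x * ?t powr q)"
            using a \<Lambda> by (intro mult_left_mono mult_right_mono) auto
          finally show ?thesis .
        qed
        have "?t \<le> \<mu> * s powr (- \<beta>') + (\<mu> * s powr (- \<beta>')) powr (1 - q) * ?t powr q"
          using \<mu> s0 q1 by (intro young_threshold) auto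
        also have "(\<mu> * s powr (- \<beta>')) powr (1 - q) = \<mu> powr (1 - q) * s powr \<beta>"
        proof -
          have "- \<beta>' * (1 - q) = \<beta>" using \<beta>'(3) by (simp add: algebra_simps)
          then show ?thesis by (simp add: powr_mult powr_powr)
        qed
        also have "\<mu> powr (1 - q) * s powr \<beta> * ?t powr q \<le>
            \<mu> powr (1 - q) * s powr \<beta> * (4 powr \<kappa> / \<Lambda> * s powr (- \<kappa>) * (?a ?x * ?t powr q))"
          by (intro mult_left_mono tq) simp
        also have "\<dots> = \<mu> powr (1 - q) * 4 powr \<kappa> / \<Lambda> * s powr (\<beta> - \<kappa>) * (?a ?x * ?t powr q)"
          using s0 by (simp add: powr_diff powr_minus field_simps)
        finally have "norm (\<sigma> *\<^sub>R y) * ?t \<le> 3 * \<mu> * s powr (- \<beta>') +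
            3 * \<mu> powr (1 - q) * 4 powr \<kappa> / \<Lambda> * s powr (\<beta> - \<kappa>) * (?a ?x * ?t powr q)"
          using t3 by (simp add: algebra_simps)
        then have "ennreal (norm (\<sigma> *\<^sub>R y) * ?t) \<le> ennreal (3 * \<mu> * s powr (- \<beta>') +
            3 * \<mu> powr (1 - q) * 4 powr \<kappa> / \<Lambda> * s powr (\<beta> - \<kappa>) * (?a ?x * ?t powr q))"
          by (rule ennreal_leI)
        also have "\<dots> = k1 s + k2 s * F ?x"
        proof -
          have nn: "0 \<le> 3 * \<mu> * s powr (- \<beta>')" "0 \<le> 3 * \<mu> powr (1 - q) * 4 powr \<kappa> / \<Lambda> * s powr (\<beta> - \<kappa>)"
            "0 \<le> ?a ?x * ?t powr q"
            using \<mu> \<Lambda> cone_weight_nonneg[of \<Lambda> \<kappa> e ?x] by auto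
          have k: "k1 s = ennreal (3 * \<mu> * s powr (- \<beta>'))"
            "k2 s = ennreal (3 * \<mu> powr (1 - q) * 4 powr \<kappa> / \<Lambda> * s powr (\<beta> - \<kappa>))"
            "F ?x = ennreal (?a ?x * ?t powr q)"
            using s True unfolding k1_def k2_def F_def by simp_all
          show ?thesis
            unfolding k ennreal_mult[OF nn(2,3), symmetric]
            by (rule ennreal_plus[OF nn(1) mult_nonneg_nonneg[OF nn(2,3)]])
        qed
        finally show ?thesis using s by simp
      qed
    qed simp
    have "ennreal m = (\<integral>\<^sup>+y. indicator ?E y \<partial>lborel)" using Em(1) by simp
    also have "\<dots> \<le> (\<integral>\<^sup>+y. (\<integral>\<^sup>+s. indicator ?E y * k1 s + k2 s * F ((s * \<sigma>) *\<^sub>R y) \<partial>lborel) \<partial>lborel)"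
    proof (rule nn_integral_mono)
      fix y
      show "indicator ?E y \<le> (\<integral>\<^sup>+s. indicator ?E y * k1 s + k2 s * F ((s * \<sigma>) *\<^sub>R y) \<partial>lborel)"
      proof (cases "y \<in> ?E")
        case True
        have "1 \<le> ennreal \<bar>w (\<sigma> *\<^sub>R y) - w 0\<bar>" using ennreal_leI[OF inc[OF True]] by simp
        also have "\<dots> \<le> (\<integral>\<^sup>+s. ennreal (norm (\<sigma> *\<^sub>R y) * norm (G (s *\<^sub>R \<sigma> *\<^sub>R y))) * indicator {0<..1} s \<partial>lborel)"
          by (rule ray_increment_le[OF wC])
        also have "\<dots> \<le> (\<integral>\<^sup>+s. k1 s + k2 s * F ((s * \<sigma>) *\<^sub>R y) \<partial>lborel)" by (intro nn_integral_mono pw[OF True])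
        finally show ?thesis using True by simp
      qed simp
    qed
    \<comment> \<open>With the integral over y innermost, the dilation y \<mapsto> s \<sigma> y
      turns the energy term at each s into s^(-n) times the whole energy.\<close>
    also have "\<dots> = (\<integral>\<^sup>+s. (\<integral>\<^sup>+y. indicator ?E y * k1 s + k2 s * F ((s * \<sigma>) *\<^sub>R y) \<partial>lborel) \<partial>lborel)"
      by (rule lborel_pair.Fubini'[symmetric]) measurable
    also have "\<dots> = (\<integral>\<^sup>+s. ennreal m * k1 s + ?FF * (k2 s * ennreal (s powr - ?n)) \<partial>lborel)"
    proof (rule nn_integral_cong)
      fix s :: real
      have "(\<integral>\<^sup>+y. indicator ?E y * k1 s + k2 s * F ((s * \<sigma>) *\<^sub>R y) \<partial>lborel) =
          (\<integral>\<^sup>+y. indicator ?E y * k1 s \<partial>lborel) + (\<integral>\<^sup>+y. k2 s * F ((s * \<sigma>) *\<^sub>R y) \<partial>lborel)"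
        by (rule nn_integral_add) measurable
      also have "(\<integral>\<^sup>+y. indicator ?E y * k1 s \<partial>lborel) = ennreal m * k1 s"
        using Em(1) by (subst nn_integral_multc) auto
      also have "(\<integral>\<^sup>+y. k2 s * F ((s * \<sigma>) *\<^sub>R y) \<partial>lborel) = ?FF * (k2 s * ennreal (s powr - ?n))"
      proof (cases "s > 0")
        case True
        have "(\<integral>\<^sup>+y. k2 s * F ((s * \<sigma>) *\<^sub>R y) \<partial>lborel) = k2 s * (\<integral>\<^sup>+y. F ((s * \<sigma>) *\<^sub>R y) \<partial>lborel)"
          by (rule nn_integral_cmult) measurable
        also have "\<dots> = k2 s * (ennreal (s powr - ?n) * ?FF)"
          using True \<sigma> by (subst nn_integral_lborel_dilate[OF Fm]) (simp_all add: abs_mult)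
        finally show ?thesis by (simp add: mult_ac)
      qed (simp add: k2_def)
      finally show "(\<integral>\<^sup>+y. indicator ?E y * k1 s + k2 s * F ((s * \<sigma>) *\<^sub>R y) \<partial>lborel) =
        ennreal m * k1 s + ?FF * (k2 s * ennreal (s powr - ?n))" .
    qed
    also have "\<dots> = ennreal m * (\<integral>\<^sup>+s. k1 s \<partial>lborel) + ?FF * (\<integral>\<^sup>+s. k2 s * ennreal (s powr - ?n) \<partial>lborel)"
      by (simp add: nn_integral_add nn_integral_cmult)
    also have "(\<integral>\<^sup>+s. k1 s \<partial>lborel) = ennreal (1/2)"
    proof -
      have "(\<integral>\<^sup>+s. k1 s \<partial>lborel) = (\<integral>\<^sup>+s. ennreal (3 * \<mu>) * (ennreal (s powr (- \<beta>')) * indicator {0<..1} s) \<partial>lborel)"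
        unfolding k1_def using \<mu> by (intro nn_integral_cong) (simp add: ennreal_mult' mult.assoc)
      also have "\<dots> = ennreal (3 * \<mu>) * ennreal (1 powr (- \<beta>' + 1) / (- \<beta>' + 1))"
        using \<beta>' by (subst nn_integral_cmult, measurable, subst nn_integral_powr_from_0) auto
      also have "\<dots> = ennreal (3 * \<mu> * (1 / (1 - \<beta>')))"
        using \<mu> \<beta>' by (subst ennreal_mult[symmetric]) auto
      also have "3 * \<mu> * (1 / (1 - \<beta>')) = 1/2" using \<beta>' by (simp add: \<mu>_def)
      finally show ?thesis .
    qed
    also have "(\<integral>\<^sup>+s. k2 s * ennreal (s powr - ?n) \<partial>lborel) = ennreal (D / \<Lambda>)"
    proof -
      let ?c = "3 * \<mu> powr (1 - q) * 4 powr \<kappa> / \<Lambda>"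
      have "(\<integral>\<^sup>+s. k2 s * ennreal (s powr - ?n) \<partial>lborel) =
         (\<integral>\<^sup>+s. ennreal ?c * (ennreal (s powr (\<beta> - \<kappa> - ?n)) * indicator {0<..1} s) \<partial>lborel)"
      proof (rule nn_integral_cong)
        fix s :: real
        have "s powr (\<beta> - \<kappa>) * s powr - ?n = s powr (\<beta> - \<kappa> - ?n)" by (simp flip: powr_add)
        then have "ennreal (?c * s powr (\<beta> - \<kappa>)) * ennreal (s powr - ?n) = ennreal ?c * ennreal (s powr (\<beta> - \<kappa> - ?n))"
          using \<Lambda> by (simp add: mult.assoc flip: ennreal_mult)
        then show "k2 s * ennreal (s powr - ?n) = ennreal ?c * (ennreal (s powr (\<beta> - \<kappa> - ?n)) * indicator {0<..1} s)"
          by (cases "s \<in> {0<..1}") (simp_all add: k2_def)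
      qed
      also have "\<dots> = ennreal ?c * ennreal (1 powr (\<beta> - \<kappa> - ?n + 1) / (\<beta> - \<kappa> - ?n + 1))"
        using \<beta>(1) by (subst nn_integral_cmult, measurable, subst nn_integral_powr_from_0) auto
      also have "\<dots> = ennreal (?c * (1 / (\<beta> - \<kappa> - ?n + 1)))"
        using \<Lambda> \<beta>(1) by (subst ennreal_mult[symmetric]) auto
      also have "?c * (1 / (\<beta> - \<kappa> - ?n + 1)) = D / \<Lambda>" by (simp add: D_def)
      finally show ?thesis .
    qed
    \<comment> \<open>Absorbing m/2 into the left side leaves the bound \<Lambda> m/(2D). The
      subtraction is done in the reals, hence the case of infinite energy apart.\<close>
    finally have le: "ennreal m \<le> ennreal m * ennreal (1/2) + ?FF * ennreal (D / \<Lambda>)" .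
    have "ennreal (\<Lambda> * (m / (2 * D))) \<le> ?FF"
    proof (cases "?FF = \<infinity>")
      case False
      then obtain f where f: "?FF = ennreal f" "f \<ge> 0" by (cases ?FF) auto
      have "ennreal m \<le> ennreal (m * (1/2) + f * (D / \<Lambda>))"
      proof -
        have nn: "0 \<le> m" "0 \<le> (1/2 :: real)" "0 \<le> f" "0 \<le> D / \<Lambda>" using f(2) D \<Lambda> Em(2) by simp_all
        show ?thesis
          using le unfolding f(1) ennreal_mult[OF nn(1,2), symmetric] ennreal_mult[OF nn(3,4), symmetric]
            ennreal_plus[OF mult_nonneg_nonneg[OF nn(1,2)] mult_nonneg_nonneg[OF nn(3,4)], symmetric] .
      qed
      then have "m \<le> m * (1/2) + f * (D / \<Lambda>)"
        using f D \<Lambda> Em(2) by (subst (asm) ennreal_le_iff) auto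
      then have "\<Lambda> * (m / (2 * D)) \<le> f" using D \<Lambda> by (simp add: field_simps)
      then show ?thesis unfolding f(1) by (rule ennreal_leI)
    qed simp
    with FF show ?thesis unfolding w_def by (rule order_trans[rotated])
  qed
  show ?thesis by (rule that[of "m / (2 * D)"]) (use Em(2) D main in auto)
qed

lemma gap_present:
  fixes p q \<kappa> :: real
  assumes n: "CARD('n::finite) \<ge> 2" and p: "1 < p" "p < real CARD('n)" and q: "real CARD('n) + \<kappa> < q" and \<kappa>: "\<kappa> > 0"
  shows "\<exists>(\<Omega> :: (real^'n) set) a u\<^sub>0. bounded_lipschitz_domain \<Omega> \<and> a \<in> weight_class \<kappa> \<Omega> \<and>
      u\<^sub>0 \<in> sobolev_W11 \<Omega> \<and> double_phase p q a \<Omega> u\<^sub>0 < \<infinity> \<and>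
      (INF v\<in>translate u\<^sub>0 (energy_space p q a \<Omega>). double_phase p q a \<Omega> v) <
      (INF w\<in>translate u\<^sub>0 (test_functions \<Omega>). double_phase p q a \<Omega> w)"
proof -
  obtain k :: 'n where True by blast
  define e :: "real^'n" where "e = axis k 1"
  have e: "norm e = 1" by (simp add: e_def)
  let ?B = "ball 0 1 :: (real^'n) set" and ?M = "lebesgue_on (ball 0 1 :: (real^'n) set)"
  let ?U = "cone_datum e" and ?Q = "cone_limit_grad e"
  have pq: "p < q" using p q \<kappa> by linarith
  obtain C where C: "C > 0" "\<And>x. norm (grad ?U x) \<le> C" "\<And>x. x \<noteq> 0 \<Longrightarrow> norm (?Q x) \<le> C / norm x"
    using norm_grad_cone_datum[OF e] by metis
  let ?J = "\<integral>\<^sup>+x. ennreal (norm x powr (- p)) * indicator (cball 0 1) x \<partial>(lborel :: (real^'n) measure)"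
  have Jfin: "ennreal (C powr p) * ?J < \<infinity>"
    using nn_integral_norm_powr_ball[of p, where 'n='n] p by (simp add: ennreal_mult_less_top)
  obtain c where c: "c > 0" "\<And>\<Lambda> \<psi>. \<Lambda> > 0 \<Longrightarrow> \<psi> \<in> test_functions ?B \<Longrightarrow>
      ennreal (\<Lambda> * c) \<le> double_phase p q (cone_weight \<Lambda> \<kappa> e) ?B (\<lambda>x. ?U x + \<psi> x)"
    using regular_competitor_bound[OF q \<kappa> e] by metis
  obtain A where A: "ennreal (C powr p) * ?J = ennreal A" "A \<ge> 0" using Jfin by (cases "ennreal (C powr p) * ?J") auto
  \<comment> \<open>Neither the energy bound A of the singular function nor c depends on \<Lambda>;
    this choice lifts the lower bound \<Lambda> c for all regular competitors to A + 1.\<close>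
  define \<Lambda> where "\<Lambda> = (A + 1) / c"
  have \<Lambda>: "\<Lambda> > 0" "\<Lambda> * c = A + 1" using A(2) c(1) by (auto simp: \<Lambda>_def intro: divide_pos_pos)
  let ?a = "cone_weight \<Lambda> \<kappa> e"
  have a: "?a \<in> weight_class \<kappa> ?B" by (rule cone_weight_class[OF \<Lambda>(1) \<kappa> e])
  obtain a1 where a1: "a1 \<ge> 0" "\<And>x. x \<in> ?B \<Longrightarrow> ?a x \<le> a1" using weight_class_bounded[OF bounded_ball a \<kappa>] by blast
  have a0: "?a x \<ge> 0" for x using \<Lambda>(1) by (simp add: cone_weight_nonneg)
  have wU: "has_weak_gradient ?B ?U (grad ?U)" by (rule C1_grad_has_weak_gradient[OF open_ball cone_datum_C1])
  have iB: "integrable ?M (\<lambda>x. r :: real)" for r by (rule integrable_const_lebesgue_on[OF open_ball bounded_ball])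
  have UW: "?U \<in> sobolev_W11 ?B"
    unfolding sobolev_W11_def mem_Collect_eq
  proof (intro conjI exI[of _ "grad ?U"] wU)
    show "integrable ?M ?U"
    proof (rule Bochner_Integration.integrable_bound[OF iB[of 9]])
      show "AE x in ?M. norm (?U x) \<le> norm (9 :: real)" by (intro AE_I2) (simp add: cone_datum_def profile_bound)
    qed (intro borel_measurable_lebesgue_on, measurable)
    show "integrable ?M (grad ?U)"
    proof (rule Bochner_Integration.integrable_bound[OF iB[of C]])
      show "AE x in ?M. norm (grad ?U x) \<le> norm C" using C(1,2) by (intro AE_I2) simp
    qed (intro borel_measurable_lebesgue_on, measurable)
  qed
  have pdU: "(\<integral>\<^sup>+x. ennreal (phase_density p q (?a x) (grad ?U x)) \<partial>?M) < \<infinity>"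
  proof -
    let ?c = "C powr p + a1 * C powr q"
    have "(\<integral>\<^sup>+x. ennreal (phase_density p q (?a x) (grad ?U x)) \<partial>?M) \<le> (\<integral>\<^sup>+x. ennreal ?c \<partial>?M)"
      using p pq a0 a1(2) C(2) by (intro nn_integral_mono ennreal_leI phase_density_le_const) auto
    also have "\<dots> < \<infinity>"
      using iB[of ?c] a1(1) by (auto simp: integrable_iff_bounded)
    finally show ?thesis .
  qed
  have dU: "double_phase p q ?a ?B ?U < \<infinity>" unfolding double_phase_eq[OF open_ball wU] by (rule pdU)
  let ?\<phi> = "\<lambda>x. cone_limit e x - ?U x" and ?g = "\<lambda>x. ?Q x - grad ?U x"
  note zp = cone_zero_trace_pair[OF n e]
  have w\<phi>: "has_weak_gradient ?B ?\<phi> ?g" by (rule zero_trace_pair_has_weak_gradient[OF open_ball zp])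
  have pdQ: "(\<integral>\<^sup>+x. ennreal (phase_density p q (?a x) (?Q x)) \<partial>?M) \<le> ennreal A"
  proof -
    have [measurable]: "?B \<in> sets borel" "cball 0 1 \<in> sets (borel :: (real^'n) measure)" by simp_all
    have "(\<integral>\<^sup>+x. ennreal (phase_density p q (?a x) (?Q x)) \<partial>?M) =
        (\<integral>\<^sup>+x. ennreal (phase_density p q (?a x) (?Q x)) * indicator ?B x \<partial>lebesgue)"
      by (rule nn_integral_restrict_space) simp
    also have "\<dots> = (\<integral>\<^sup>+x. ennreal (phase_density p q (?a x) (?Q x)) * indicator ?B x \<partial>lborel)"
      by (rule nn_integral_completion) measurable
    also have "\<dots> \<le> (\<integral>\<^sup>+x. ennreal (C powr p) * (ennreal (norm x powr (- p)) * indicator (cball 0 1) x) \<partial>(lborel :: (real^'n) measure))"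
    proof (rule nn_integral_mono_AE)
      show "AE x in lborel. ennreal (phase_density p q (?a x) (?Q x)) * indicator ?B x \<le>
          ennreal (C powr p) * (ennreal (norm x powr (- p)) * indicator (cball 0 1) x)"
        using AE_lborel_singleton[of "0 :: real^'n"]
      proof eventually_elim
        case (elim x)
        \<comment> \<open>Weight and gradient are never both nonzero, so the q-term, and with it
          \<Lambda>, disappears.\<close>
        have "phase_density p q (?a x) (?Q x) = norm (?Q x) powr p"
          using cone_weight_mult_grad[of \<Lambda> \<kappa> e x] p pq by (auto simp: phase_density_def)
        also have "\<dots> \<le> (C / norm x) powr p" using C(3)[OF elim] p by (intro powr_mono2) auto
        also have "\<dots> = C powr p * norm x powr (- p)" using C(1) by (simp add: powr_divide powr_minus_divide)
        finally have "ennreal (phase_density p q (?a x) (?Q x)) \<le> ennreal (C powr p) * ennreal (norm x powr (- p))"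
          by (simp add: ennreal_leI flip: ennreal_mult)
        then show ?case by (auto simp: indicator_def)
      qed
    qed
    also have "\<dots> = ennreal A" unfolding A(1)[symmetric] by (rule nn_integral_cmult) measurable
    finally show ?thesis .
  qed
  have "double_phase p q ?a ?B ?\<phi> < \<infinity>"
  proof -
    have [measurable]: "?a \<in> borel_measurable ?M" "?Q \<in> borel_measurable ?M" "grad ?U \<in> borel_measurable ?M"
      by (intro borel_measurable_lebesgue_on, measurable)+
    have "double_phase p q ?a ?B ?\<phi> = (\<integral>\<^sup>+x. ennreal (phase_density p q (?a x) (?Q x + - grad ?U x)) \<partial>?M)"
      using double_phase_eq[OF open_ball w\<phi>] by simp
    also have "\<dots> \<le> (\<integral>\<^sup>+x. ennreal (2 powr q) * (ennreal (phase_density p q (?a x) (?Q x)) + ennreal (phase_density p q (?a x) (grad ?U x))) \<partial>?M)"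
    proof (rule nn_integral_mono)
      fix x
      have "phase_density p q (?a x) (?Q x + - grad ?U x) \<le> 2 powr q * (phase_density p q (?a x) (?Q x) + phase_density p q (?a x) (- grad ?U x))"
        using p pq by (intro phase_density_add a0) auto
      then have "ennreal (phase_density p q (?a x) (?Q x + - grad ?U x)) \<le> ennreal (2 powr q * (phase_density p q (?a x) (?Q x) + phase_density p q (?a x) (grad ?U x)))"
        by (intro ennreal_leI) (simp add: phase_density_def)
      also have "ennreal (2 powr q * (phase_density p q (?a x) (?Q x) + phase_density p q (?a x) (grad ?U x))) =
          ennreal (2 powr q) * (ennreal (phase_density p q (?a x) (?Q x)) + ennreal (phase_density p q (?a x) (grad ?U x)))"
        by (simp add: ennreal_mult phase_density_nonneg[OF a0])
      finally show "ennreal (phase_density p q (?a x) (?Q x + - grad ?U x)) \<le>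
          ennreal (2 powr q) * (ennreal (phase_density p q (?a x) (?Q x)) + ennreal (phase_density p q (?a x) (grad ?U x)))" .
    qed
    also have "\<dots> = ennreal (2 powr q) * ((\<integral>\<^sup>+x. ennreal (phase_density p q (?a x) (?Q x)) \<partial>?M) +
        (\<integral>\<^sup>+x. ennreal (phase_density p q (?a x) (grad ?U x)) \<partial>?M))"
      by (simp add: nn_integral_cmult nn_integral_add)
    also have "\<dots> < \<infinity>"
      using pdU le_less_trans[OF pdQ ennreal_less_top] by (simp add: ennreal_mult_less_top)
    finally show ?thesis .
  qed
  then have "?\<phi> \<in> energy_space p q ?a ?B"
    using zero_trace_pair_sobolev_W11_0[OF open_ball zp] by (simp add: energy_space_def)
  \<comment> \<open>This competitor is \<open>cone_limit e\<close> itself, with gradient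
    \<open>cone_limit_grad e\<close>.\<close>
  then have "(\<lambda>x. ?U x + ?\<phi> x) \<in> translate ?U (energy_space p q ?a ?B)"
    unfolding translate_def by (rule imageI)
  then have "(INF v\<in>translate ?U (energy_space p q ?a ?B). double_phase p q ?a ?B v) \<le> double_phase p q ?a ?B (\<lambda>x. ?U x + ?\<phi> x)"
    by (rule INF_lower)
  also have "\<dots> = (\<integral>\<^sup>+x. ennreal (phase_density p q (?a x) (?Q x)) \<partial>?M)"
    using double_phase_eq[OF open_ball has_weak_gradient_add[OF open_ball wU w\<phi>], of p q ?a] by simp
  also have "\<dots> \<le> ennreal A" by (rule pdQ)
  also have "\<dots> < ennreal (\<Lambda> * c)" unfolding \<Lambda>(2) using A(2) by (simp add: ennreal_less_iff)
  also have "\<dots> \<le> (INF w\<in>translate ?U (test_functions ?B). double_phase p q ?a ?B w)"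
    by (rule INF_greatest) (use c(2)[OF \<Lambda>(1)] in \<open>auto simp: translate_def\<close>)
  finally show ?thesis
    using bounded_lipschitz_domain_unit_ball a UW dU by blast
qed

theorem theorem1:
  fixes p q \<kappa> :: real
  assumes "CARD('n::finite) \<ge> 2" and "1 < p" and "p < q" and "\<kappa> > 0"
  shows "(q \<le> p + \<kappa> \<longrightarrow>
           (\<forall>(\<Omega> :: (real^'n) set) a u\<^sub>0.
              bounded_lipschitz_domain \<Omega> \<and> a \<in> weight_class \<kappa> \<Omega> \<and>
              u\<^sub>0 \<in> sobolev_W11 \<Omega> \<and> double_phase p q a \<Omega> u\<^sub>0 < \<infinity> \<longrightarrow>
              (INF v\<in>translate u\<^sub>0 (energy_space p q a \<Omega>). double_phase p q a \<Omega> v) =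
              (INF w\<in>translate u\<^sub>0 (test_functions \<Omega>). double_phase p q a \<Omega> w)))
       \<and> (p < real CARD('n) \<and> real CARD('n) + \<kappa> < q \<longrightarrow>
           (\<exists>(\<Omega> :: (real^'n) set) a u\<^sub>0.
              bounded_lipschitz_domain \<Omega> \<and> a \<in> weight_class \<kappa> \<Omega> \<and>
              u\<^sub>0 \<in> sobolev_W11 \<Omega> \<and> double_phase p q a \<Omega> u\<^sub>0 < \<infinity> \<and>
              (INF v\<in>translate u\<^sub>0 (energy_space p q a \<Omega>). double_phase p q a \<Omega> v) <
              (INF w\<in>translate u\<^sub>0 (test_functions \<Omega>). double_phase p q a \<Omega> w)))"
  using no_gap[of p q \<kappa>, where 'n='n] gap_present[of p \<kappa> q, where 'n='n] assms by blast

end
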